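(* Let $H$ be a semisimple Hopf algebra over an algebraically closed field $k$ of characteristic $0$ and let $N$ be a normal left coideal subalgebra of $H$. If the Hopf algebra $H//N$ is solvable, then $H$ has a solvable series $N_0\subset N_1\subset\dots\subset N_t$ with $N_0=N$ and $N_t=H$.
   Context: A left coideal subalgebra of $H$ is a unital subalgebra $N$ with $\Delta(N)\subset H\otimes N$. The left adjoint action is $a\,_{\dot{ad}}\,b=\sum a_1bS(a_2)$; $N$ is normal if it is stable under the left adjoint action of $H$. For normal $N$, $H//N$ denotes the Hopf quotient $H/HN^+$, $N^+=N\cap\ker\varepsilon$. Every left coideal subalgebra $N$ has a unique idempotent two-sided integral $\Lambda_N\in N$: $n\Lambda_N=\Lambda_Nn=\langle\varepsilon,n\rangle\Lambda_N$ for $n\in N$, $\langle\varepsilon,\Lambda_N\rangle=1$. A chain of left coideal subalgebras $N_0\subset N_1\subset\dots\subset N_t$ of a semisimple Hopf algebra is a solvable series if for all $0\le i\le t-1$: (i) $\Lambda_{N_i}$ lies in the center of $N_{i+1}$; and (ii) $(a\,_{\dot{ad}}\,b)\Lambda_{N_i}=\langle\varepsilon,a\rangle b\Lambda_{N_i}$ for all $a,b\in N_{i+1}$. A semisimple Hopf algebra is solvable if it has a solvable series with $N_0=k$ and $N_t$ the whole Hopf algebra. *)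

theory Defs
  imports "HOL-Algebra.Algebra" "HOL-Algebra.Algebraic_Closure_Type" "HOL-Library.Poly_Mapping"
begin

section \<open>Tensor powers\<close>

text \<open>
  An element \<open>p :: ('h \<times> 'h) \<Rightarrow>\<^sub>0 'k\<close> is the formal sum of the pairs \<open>(a, b)\<close> with coefficients
  \<open>lookup p (a, b)\<close>. The tensor square of \<open>M\<close> is the free module on \<open>carrier M \<times> carrier M\<close> modulo
  the bilinearity relations \<open>tensor_null M\<close>; its elements are cosets of formal sums. The tensor
  cube is treated in the same way, with the trilinearity relations \<open>tensor_null3 M\<close>. All relations
  are taken with an arbitrary coefficient \<open>c\<close>, so that closure under sums gives a submodule.
\<close>

inductive_set tensor_null ::
    "('k::field, 'h, 'm) module_scheme \<Rightarrow> (('h \<times> 'h) \<Rightarrow>\<^sub>0 'k) set"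
  for M (structure) where
  zero: "0 \<in> tensor_null M"
| plus: "\<lbrakk>p \<in> tensor_null M; q \<in> tensor_null M\<rbrakk> \<Longrightarrow> p + q \<in> tensor_null M"
| add_fst: "\<lbrakk>a \<in> carrier M; a' \<in> carrier M; b \<in> carrier M\<rbrakk> \<Longrightarrow>
    Poly_Mapping.single (a \<oplus> a', b) c - Poly_Mapping.single (a, b) c
      - Poly_Mapping.single (a', b) c \<in> tensor_null M"
| add_snd: "\<lbrakk>a \<in> carrier M; b \<in> carrier M; b' \<in> carrier M\<rbrakk> \<Longrightarrow>
    Poly_Mapping.single (a, b \<oplus> b') c - Poly_Mapping.single (a, b) c
      - Poly_Mapping.single (a, b') c \<in> tensor_null M"
| smult_fst: "\<lbrakk>a \<in> carrier M; b \<in> carrier M\<rbrakk> \<Longrightarrow>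
    Poly_Mapping.single (d \<odot> a, b) c - Poly_Mapping.single (a, b) (c * d) \<in> tensor_null M"
| smult_snd: "\<lbrakk>a \<in> carrier M; b \<in> carrier M\<rbrakk> \<Longrightarrow>
    Poly_Mapping.single (a, d \<odot> b) c - Poly_Mapping.single (a, b) (c * d) \<in> tensor_null M"

inductive_set tensor_null3 ::
    "('k::field, 'h, 'm) module_scheme \<Rightarrow> (('h \<times> 'h \<times> 'h) \<Rightarrow>\<^sub>0 'k) set"
  for M (structure) where
  zero: "0 \<in> tensor_null3 M"
| plus: "\<lbrakk>p \<in> tensor_null3 M; q \<in> tensor_null3 M\<rbrakk> \<Longrightarrow> p + q \<in> tensor_null3 M"
| add_1: "\<lbrakk>x \<in> carrier M; x' \<in> carrier M; y \<in> carrier M; z \<in> carrier M\<rbrakk> \<Longrightarrow>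
    Poly_Mapping.single (x \<oplus> x', y, z) c - Poly_Mapping.single (x, y, z) c
      - Poly_Mapping.single (x', y, z) c \<in> tensor_null3 M"
| add_2: "\<lbrakk>x \<in> carrier M; y \<in> carrier M; y' \<in> carrier M; z \<in> carrier M\<rbrakk> \<Longrightarrow>
    Poly_Mapping.single (x, y \<oplus> y', z) c - Poly_Mapping.single (x, y, z) c
      - Poly_Mapping.single (x, y', z) c \<in> tensor_null3 M"
| add_3: "\<lbrakk>x \<in> carrier M; y \<in> carrier M; z \<in> carrier M; z' \<in> carrier M\<rbrakk> \<Longrightarrow>
    Poly_Mapping.single (x, y, z \<oplus> z') c - Poly_Mapping.single (x, y, z) c
      - Poly_Mapping.single (x, y, z') c \<in> tensor_null3 M"
| smult_1: "\<lbrakk>x \<in> carrier M; y \<in> carrier M; z \<in> carrier M\<rbrakk> \<Longrightarrow>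
    Poly_Mapping.single (d \<odot> x, y, z) c - Poly_Mapping.single (x, y, z) (c * d) \<in> tensor_null3 M"
| smult_2: "\<lbrakk>x \<in> carrier M; y \<in> carrier M; z \<in> carrier M\<rbrakk> \<Longrightarrow>
    Poly_Mapping.single (x, d \<odot> y, z) c - Poly_Mapping.single (x, y, z) (c * d) \<in> tensor_null3 M"
| smult_3: "\<lbrakk>x \<in> carrier M; y \<in> carrier M; z \<in> carrier M\<rbrakk> \<Longrightarrow>
    Poly_Mapping.single (x, y, d \<odot> z) c - Poly_Mapping.single (x, y, z) (c * d) \<in> tensor_null3 M"

definition tensor_class ::
    "('k::field, 'h, 'm) module_scheme \<Rightarrow> (('h \<times> 'h) \<Rightarrow>\<^sub>0 'k) \<Rightarrow> (('h \<times> 'h) \<Rightarrow>\<^sub>0 'k) set" where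
  "tensor_class M p = {q. q - p \<in> tensor_null M}"

definition tensor_carrier ::
    "('k::field, 'h, 'm) module_scheme \<Rightarrow> (('h \<times> 'h) \<Rightarrow>\<^sub>0 'k) set set" where
  "tensor_carrier M = tensor_class M ` {p. Poly_Mapping.keys p \<subseteq> carrier M \<times> carrier M}"

text \<open>The linear extension to formal sums of a map \<open>f\<close> on basis elements.\<close>

definition formal_extend :: "('a \<Rightarrow> ('b \<Rightarrow>\<^sub>0 'k)) \<Rightarrow> ('a \<Rightarrow>\<^sub>0 'k) \<Rightarrow> ('b \<Rightarrow>\<^sub>0 'k::field)" where
  "formal_extend f p = (\<Sum>u\<in>Poly_Mapping.keys p. Poly_Mapping.map ((*) (Poly_Mapping.lookup p u)) (f u))"

section \<open>Hopf algebras\<close>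

record (overloaded) ('k::field, 'h) hopf = "('k, 'h) module" +
  comult :: "'h \<Rightarrow> (('h \<times> 'h) \<Rightarrow>\<^sub>0 'k) set"
  counit :: "'h \<Rightarrow> 'k"
  antipode :: "'h \<Rightarrow> 'h"

text \<open>
  A formal sum representing the coproduct of \<open>x\<close>. Everything below depends only on its class
  in the tensor square.
\<close>

definition sweedler :: "('k::field, 'h, 'm) hopf_scheme \<Rightarrow> 'h \<Rightarrow> (('h \<times> 'h) \<Rightarrow>\<^sub>0 'k)" where
  "sweedler H x = (SOME p. p \<in> comult H x \<and> Poly_Mapping.keys p \<subseteq> carrier H \<times> carrier H)"

text \<open>The Sweedler sum \<open>\<Sum> f x\<^sub>1 x\<^sub>2\<close>, for bilinear \<open>f\<close> with values in \<open>H\<close>.\<close>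

definition sweedler_sum :: "('k::field, 'h, 'm) hopf_scheme \<Rightarrow> ('h \<Rightarrow> 'h \<Rightarrow> 'h) \<Rightarrow> 'h \<Rightarrow> 'h" where
  "sweedler_sum H f x =
     (\<Oplus>\<^bsub>H\<^esub>u\<in>Poly_Mapping.keys (sweedler H x).
        Poly_Mapping.lookup (sweedler H x) u \<odot>\<^bsub>H\<^esub> f (fst u) (snd u))"

locale hopf_algebra =
  module "ring_of_type_algebra :: 'k ring" H + ring H
  for H :: "('k::field, 'h, 'm) hopf_scheme" (structure) +
  assumes smult_mult_left:
      "\<lbrakk>x \<in> carrier H; y \<in> carrier H\<rbrakk> \<Longrightarrow> (c \<odot> x) \<otimes> y = c \<odot> (x \<otimes> y)"
    and smult_mult_right:
      "\<lbrakk>x \<in> carrier H; y \<in> carrier H\<rbrakk> \<Longrightarrow> x \<otimes> (c \<odot> y) = c \<odot> (x \<otimes> y)"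
    and comult_closed: "x \<in> carrier H \<Longrightarrow> comult H x \<in> tensor_carrier H"
    and comult_add: "\<lbrakk>x \<in> carrier H; y \<in> carrier H\<rbrakk> \<Longrightarrow>
      comult H (x \<oplus> y) = tensor_class H (sweedler H x + sweedler H y)"
    and comult_smult: "x \<in> carrier H \<Longrightarrow>
      comult H (c \<odot> x) = tensor_class H (Poly_Mapping.map ((*) c) (sweedler H x))"
    and comult_mult: "\<lbrakk>x \<in> carrier H; y \<in> carrier H\<rbrakk> \<Longrightarrow>
      comult H (x \<otimes> y) = tensor_class H
        (formal_extend (\<lambda>(a, b). formal_extend (\<lambda>(a', b'). Poly_Mapping.single (a \<otimes> a', b \<otimes> b') 1)
           (sweedler H y)) (sweedler H x))"
    and comult_one: "comult H \<one> = tensor_class H (Poly_Mapping.single (\<one>, \<one>) 1)"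
    and coassoc: "x \<in> carrier H \<Longrightarrow>
      formal_extend (\<lambda>(a, b). formal_extend (\<lambda>(a\<^sub>1, a\<^sub>2). Poly_Mapping.single (a\<^sub>1, a\<^sub>2, b) 1)
         (sweedler H a)) (sweedler H x)
      - formal_extend (\<lambda>(a, b). formal_extend (\<lambda>(b\<^sub>1, b\<^sub>2). Poly_Mapping.single (a, b\<^sub>1, b\<^sub>2) 1)
         (sweedler H b)) (sweedler H x) \<in> tensor_null3 H"
    and counit_add: "\<lbrakk>x \<in> carrier H; y \<in> carrier H\<rbrakk> \<Longrightarrow>
      counit H (x \<oplus> y) = counit H x + counit H y"
    and counit_smult: "x \<in> carrier H \<Longrightarrow> counit H (c \<odot> x) = c * counit H x"
    and counit_mult: "\<lbrakk>x \<in> carrier H; y \<in> carrier H\<rbrakk> \<Longrightarrow>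
      counit H (x \<otimes> y) = counit H x * counit H y"
    and counit_one: "counit H \<one> = 1"
    and counit_left: "x \<in> carrier H \<Longrightarrow> sweedler_sum H (\<lambda>a b. counit H a \<odot> b) x = x"
    and counit_right: "x \<in> carrier H \<Longrightarrow> sweedler_sum H (\<lambda>a b. counit H b \<odot> a) x = x"
    and antipode_closed: "x \<in> carrier H \<Longrightarrow> antipode H x \<in> carrier H"
    and antipode_add: "\<lbrakk>x \<in> carrier H; y \<in> carrier H\<rbrakk> \<Longrightarrow>
      antipode H (x \<oplus> y) = antipode H x \<oplus> antipode H y"
    and antipode_smult: "x \<in> carrier H \<Longrightarrow> antipode H (c \<odot> x) = c \<odot> antipode H x"
    and antipode_left: "x \<in> carrier H \<Longrightarrow>
      sweedler_sum H (\<lambda>a b. antipode H a \<otimes> b) x = counit H x \<odot> \<one>"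
    and antipode_right: "x \<in> carrier H \<Longrightarrow>
      sweedler_sum H (\<lambda>a b. a \<otimes> antipode H b) x = counit H x \<odot> \<one>"

text \<open>A ring is semisimple if every left ideal is a direct summand of the left regular module.\<close>

definition left_ideal :: "'h set \<Rightarrow> ('h, 'm) ring_scheme \<Rightarrow> bool" where
  "left_ideal I R \<longleftrightarrow>
     additive_subgroup I R \<and> (\<forall>r\<in>carrier R. \<forall>x\<in>I. r \<otimes>\<^bsub>R\<^esub> x \<in> I)"

definition semisimple_ring :: "('h, 'm) ring_scheme \<Rightarrow> bool" where
  "semisimple_ring R \<longleftrightarrow>
     (\<forall>I. left_ideal I R \<longrightarrow>
       (\<exists>J. left_ideal J R \<and> I \<inter> J = {\<zero>\<^bsub>R\<^esub>} \<and> I <+>\<^bsub>R\<^esub> J = carrier R))"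

definition semisimple_hopf_algebra :: "('k::field, 'h, 'm) hopf_scheme \<Rightarrow> bool" where
  "semisimple_hopf_algebra H \<longleftrightarrow> hopf_algebra H \<and> semisimple_ring H"

section \<open>Left coideal subalgebras\<close>

text \<open>
  The last condition says that the coproduct of \<open>n\<close> lies in the image of \<open>H \<otimes> N\<close> in \<open>H \<otimes> H\<close>.
\<close>

definition left_coideal_subalgebra :: "('k::field, 'h, 'm) hopf_scheme \<Rightarrow> 'h set \<Rightarrow> bool" where
  "left_coideal_subalgebra H N \<longleftrightarrow>
     subring N H \<and> (\<forall>c. \<forall>n\<in>N. c \<odot>\<^bsub>H\<^esub> n \<in> N) \<and>
     (\<forall>n\<in>N. \<exists>p\<in>comult H n. Poly_Mapping.keys p \<subseteq> carrier H \<times> N)"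

definition left_adjoint :: "('k::field, 'h, 'm) hopf_scheme \<Rightarrow> 'h \<Rightarrow> 'h \<Rightarrow> 'h" where
  "left_adjoint H a b = sweedler_sum H (\<lambda>a\<^sub>1 a\<^sub>2. a\<^sub>1 \<otimes>\<^bsub>H\<^esub> b \<otimes>\<^bsub>H\<^esub> antipode H a\<^sub>2) a"

definition normal_left_coideal_subalgebra ::
    "('k::field, 'h, 'm) hopf_scheme \<Rightarrow> 'h set \<Rightarrow> bool" where
  "normal_left_coideal_subalgebra H N \<longleftrightarrow>
     left_coideal_subalgebra H N \<and> (\<forall>h\<in>carrier H. \<forall>n\<in>N. left_adjoint H h n \<in> N)"

definition augmentation_part :: "('k::field, 'h, 'm) hopf_scheme \<Rightarrow> 'h set \<Rightarrow> 'h set" where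
  "augmentation_part H N = {n \<in> N. counit H n = 0}"

text \<open>
  The quotient structure on the cosets of \<open>I\<close>. For a Hopf ideal \<open>I\<close> the scalar multiple, coproduct,
  counit and antipode of a coset do not depend on the representative; then the unions below
  are unions of equal sets.
\<close>

definition quotient_algebra ::
    "('k::field, 'h, 'm) hopf_scheme \<Rightarrow> 'h set \<Rightarrow> ('k, 'h set) module" where
  "quotient_algebra H I = ring.extend (H Quot I)
     (module.fields (\<lambda>c C. \<Union>x\<in>C. I +>\<^bsub>H\<^esub> (c \<odot>\<^bsub>H\<^esub> x)))"

definition quotient_by ::
    "('k::field, 'h, 'm) hopf_scheme \<Rightarrow> 'h set \<Rightarrow> ('k, 'h set) hopf" where
  "quotient_by H I = module.extend (quotient_algebra H I)
     (hopf.fields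
       (\<lambda>C. \<Union>x\<in>C. tensor_class (quotient_algebra H I)
          (formal_extend (\<lambda>(a, b). Poly_Mapping.single (I +>\<^bsub>H\<^esub> a, I +>\<^bsub>H\<^esub> b) 1) (sweedler H x)))
       (\<lambda>C. the_elem (counit H ` C))
       (\<lambda>C. \<Union>x\<in>C. I +>\<^bsub>H\<^esub> antipode H x))"

text \<open>
  \<open>ideal_prod\<close> forms finite sums of products and does not require its arguments to be ideals,
  so the divisor below is literally \<open>HN\<^sup>+\<close>; it is a Hopf ideal when \<open>N\<close> is normal.
\<close>

definition hopf_quotient ::
    "('k::field, 'h, 'm) hopf_scheme \<Rightarrow> 'h set \<Rightarrow> ('k, 'h set) hopf" (infixl \<open>'/'/h\<close> 65) where
  "H //h N = quotient_by H (ideal_prod H (carrier H) (augmentation_part H N))"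

section \<open>Solvability\<close>

text \<open>
  The two-sided integral of counit 1. It is idempotent (take \<open>n = L\<close>) and unique:
  \<open>L = L L' = L'\<close> for two such elements.
\<close>

definition integral_of :: "('k::field, 'h, 'm) hopf_scheme \<Rightarrow> 'h set \<Rightarrow> 'h" where
  "integral_of H N = (THE L. L \<in> N \<and> counit H L = 1 \<and>
     (\<forall>n\<in>N. n \<otimes>\<^bsub>H\<^esub> L = counit H n \<odot>\<^bsub>H\<^esub> L \<and> L \<otimes>\<^bsub>H\<^esub> n = counit H n \<odot>\<^bsub>H\<^esub> L))"

definition center_of :: "('h, 'm) ring_scheme \<Rightarrow> 'h set \<Rightarrow> 'h set" where
  "center_of R A = {z \<in> A. \<forall>a\<in>A. z \<otimes>\<^bsub>R\<^esub> a = a \<otimes>\<^bsub>R\<^esub> z}"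

definition solvable_series ::
    "('k::field, 'h, 'm) hopf_scheme \<Rightarrow> nat \<Rightarrow> (nat \<Rightarrow> 'h set) \<Rightarrow> bool" where
  "solvable_series H t N \<longleftrightarrow>
     (\<forall>i\<le>t. left_coideal_subalgebra H (N i)) \<and>
     (\<forall>i<t. N i \<subseteq> N (Suc i)) \<and>
     (\<forall>i<t. integral_of H (N i) \<in> center_of H (N (Suc i)) \<and>
        (\<forall>a\<in>N (Suc i). \<forall>b\<in>N (Suc i).
           left_adjoint H a b \<otimes>\<^bsub>H\<^esub> integral_of H (N i)
             = counit H a \<odot>\<^bsub>H\<^esub> (b \<otimes>\<^bsub>H\<^esub> integral_of H (N i))))"

definition solvable_hopf_algebra :: "('k::field, 'h, 'm) hopf_scheme \<Rightarrow> bool" where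
  "solvable_hopf_algebra H \<longleftrightarrow>
     (\<exists>t N. solvable_series H t N \<and> N 0 = range (\<lambda>c. c \<odot>\<^bsub>H\<^esub> \<one>\<^bsub>H\<^esub>) \<and> N t = carrier H)"

end

theory Submission
  imports Defs "HOL-Library.Function_Algebras"
begin

text \<open>
  Let \<open>L\<close> be the integral of \<open>N\<close>. Normality makes \<open>L\<close> a central idempotent of \<open>H\<close>, and the elements
  killed by \<open>L\<close> are exactly those of \<open>HN\<^sup>+\<close>. So \<open>x \<mapsto> xL\<close> identifies \<open>H//N\<close> with the ideal \<open>HL\<close>, and
  an equation between multiples of \<open>L\<close> may be checked in the quotient. A left coideal subalgebra \<open>R\<close> of
  \<open>H//N\<close> is pulled back to the largest left coideal of \<open>H\<close> that projects into \<open>R\<close>. The pullback is again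
  a subalgebra, it contains \<open>N\<close>, and it contains \<open>xL\<close> whenever \<open>x\<close> projects into \<open>R\<close>
  (\<open>preim_mult_L\<close>). Hence it projects onto \<open>R\<close>, and its integral is a multiple of \<open>L\<close> that lifts the
  integral of \<open>R\<close> (\<open>pullback_integral\<close>). The two conditions on a solvable series are equations between
  multiples of the integrals, so they pass from \<open>R\<close> to its pullback. The series for \<open>H\<close> starts with \<open>N\<close>
  and continues with the pullbacks of the members of the given series. The pullback of the scalars may
  be added after \<open>N\<close> at no cost: modulo \<open>HN\<^sup>+\<close> its elements are scalars, on which the adjoint action is
  trivial.

  This uses that every left coideal subalgebra \<open>A\<close> of \<open>H\<close> has a two-sided integral of counit 1, which
  is the larger part of the work. The algebra \<open>H\<close> has such an integral \<open>\<Lambda>\<close>, because the kernel of the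
  counit is a direct summand, and \<open>\<Lambda>\<close> forces \<open>H\<close> to be finite dimensional with bijective antipode. It
  remains to see that the trivial \<open>A\<close>-module is projective. The argument is a variant of Skryabin's
  proof that \<open>H\<close> is projective over \<open>A\<close>, reduced to an inequality of dimensions: for a right submodule
  \<open>K\<close> of a power of \<open>A\<close>, with \<open>KH\<close> the subspace that it spans in the same power of \<open>H\<close>,
  \<open>dim K \<cdot> dim H \<le> dim KH \<cdot> dim A\<close>. Among the pairs \<open>K \<subseteq> K'\<close> choose one for which the
  slope \<open>(dim K'H - dim KH) / (dim K' - dim K)\<close> is maximal. Tensoring with \<open>H\<close>, with \<open>A\<close> acting on both
  factors, multiplies all these dimensions by \<open>dim H\<close>, so the slope stays maximal. But now the quotient
  is a faithful \<open>A\<close>-module, so a power of it contains a copy of \<open>A\<close>, and by maximality the slope of this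
  copy is maximal too. Its denominator is \<open>dim A\<close> and its numerator is at most \<open>dim H\<close>; hence no slope
  exceeds \<open>dim H / dim A\<close> (\<open>slope_le\<close>). For \<open>K'\<close> the whole power of \<open>A\<close>, this is the
  inequality. Two cases of the inequality show that everything in \<open>H\<close> which
  \<open>A\<^sup>+\<close> annihilates from the left comes from elements of \<open>A\<close> with this property. As \<open>\<Lambda>\<close> is annihilated
  and has counit 1, so is some element of \<open>A\<close> (\<open>left_integral_exists\<close>). The opposite multiplication
  gives an integral on the other side, and the two coincide.
\<close>

section \<open>Dimensions of subspaces\<close>

definition fin_dim :: "('k::field \<Rightarrow> 'v \<Rightarrow> 'v) \<Rightarrow> 'v::ab_group_add set \<Rightarrow> bool" where
  "fin_dim s S \<longleftrightarrow> (\<exists>B. finite B \<and> S \<subseteq> Modules.module.span s B)"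

context vector_space
begin

lemma fin_dim_subset: "fin_dim scale Y \<Longrightarrow> S \<subseteq> Y \<Longrightarrow> fin_dim scale S"
  unfolding fin_dim_def by blast

lemma independent_finite: "fin_dim scale S \<Longrightarrow> \<not> dependent B \<Longrightarrow> B \<subseteq> S \<Longrightarrow> finite B"
  unfolding fin_dim_def using independent_span_bound[of _ B] by blast

lemma fin_dim_basis:
  assumes "subspace S" "fin_dim scale S"
  obtains B where "finite B" "B \<subseteq> S" "\<not> dependent B" "span B = S" "card B = dim S"
proof -
  obtain B where B: "B \<subseteq> S" "\<not> dependent B" "S \<subseteq> span B" "card B = dim S"
    using basis_exists by blast
  have "finite B" using independent_finite[OF assms(2) B(2,1)] .
  moreover have "span B = S" by (rule span_subspace[OF B(1,3) assms(1)])
  ultimately show ?thesis using that[of B] B(1,2,4) by blast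
qed

lemma basis_extension:
  assumes "subspace S" "fin_dim scale S" "B \<subseteq> S" "\<not> dependent B"
  obtains E where "finite E" "E \<inter> B = {}" "\<not> dependent (B \<union> E)" "span (B \<union> E) = S"
    "dim S = card B + card E"
proof -
  obtain B' where B': "B \<subseteq> B'" "B' \<subseteq> S" "\<not> dependent B'" "S \<subseteq> span B'"
    using maximal_independent_subset_extend[OF assms(3,4)] by blast
  have f: "finite B'" using independent_finite[OF assms(2) B'(3,2)] .
  have s: "span B' = S" by (rule span_subspace[OF B'(2,4) assms(1)])
  have d: "dim S = card B'" using dim_span_eq_card_independent[OF B'(3)] s by simp
  have u: "B \<union> (B' - B) = B'" using B'(1) by blast
  have cB: "card B' = card B + card (B' - B)"
    using card_Diff_subset[OF finite_subset[OF B'(1) f] B'(1)] card_mono[OF f B'(1)] by linarith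
  show ?thesis
  proof (rule that[of "B' - B"])
    show "finite (B' - B)" using f by (rule finite_Diff)
    show "(B' - B) \<inter> B = {}" by blast
    show "\<not> dependent (B \<union> (B' - B))" unfolding u by (rule B'(3))
    show "span (B \<union> (B' - B)) = S" unfolding u by (rule s)
    show "dim S = card B + card (B' - B)" unfolding d by (rule cB)
  qed
qed

lemma dim_mono_subspace:
  assumes "subspace Y" "fin_dim scale Y" "subspace S" "S \<subseteq> Y" shows "dim S \<le> dim Y"
proof -
  obtain B where B0: "finite B" and B1: "B \<subseteq> S" "\<not> dependent B"
      and B2: "span B = S" and B3: "card B = dim S"
    by (rule fin_dim_basis[OF assms(3) fin_dim_subset[OF assms(2,4)]])
  note B = B1 B3
  have BY: "B \<subseteq> Y" using B(1) assms(4) by blast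
  obtain E where "finite E" "E \<inter> B = {}" "\<not> dependent (B \<union> E)" "span (B \<union> E) = Y"
      and E: "dim Y = card B + card E"
    by (rule basis_extension[OF assms(1,2) BY B(2)])
  show ?thesis using E B(3) by linarith
qed

lemma subspace_eq_if_dim_le:
  assumes "subspace Y" "fin_dim scale Y" "subspace S" "S \<subseteq> Y" "dim Y \<le> dim S" shows "S = Y"
proof -
  obtain B where B0: "finite B" and B1: "B \<subseteq> S" "\<not> dependent B"
      and B2: "span B = S" and B3: "card B = dim S"
    by (rule fin_dim_basis[OF assms(3) fin_dim_subset[OF assms(2,4)]])
  note B = B1 B2 B3
  have BY: "B \<subseteq> Y" using B(1) assms(4) by blast
  obtain E where "\<not> dependent (B \<union> E)" "E \<inter> B = {}"
      and E: "finite E" "span (B \<union> E) = Y" "dim Y = card B + card E"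
    by (rule basis_extension[OF assms(1,2) BY B(2)])
  have "card E = 0" using E(3) B(4) assms(5) by linarith
  then have "E = {}" using E(1) by simp
  then show ?thesis using E(2) B(3) by simp
qed

lemma dim_zero_space: "dim {0} = 0"
  using dim_eq_card_independent[OF independent_empty] dim_span[of "{}"] by simp

end

context vector_space_pair
begin

text \<open>
  Rank and nullity modulo \<open>U\<close>. A basis of the kernel modulo \<open>U\<close> is extended to a basis of \<open>W\<close>; the image
  of the added part extends a basis of \<open>U\<close>. All dimension counts below reduce to this one.
\<close>

lemma dim_plus_image:
  assumes g: "Vector_Spaces.linear s1 s2 g"
    and W: "vs1.subspace W" "fin_dim s1 W"
    and U: "vs2.subspace U" "fin_dim s2 U"
  shows "vs2.dim {u + g w |u w. u \<in> U \<and> w \<in> W} + vs1.dim {w \<in> W. g w \<in> U} = vs2.dim U + vs1.dim W"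
    and "fin_dim s2 {u + g w |u w. u \<in> U \<and> w \<in> W}"
proof -
  interpret g: Vector_Spaces.linear s1 s2 g by (fact g)
  let ?Z = "{w \<in> W. g w \<in> U}"
  have Z: "vs1.subspace ?Z"
    using vs1.subspace_inter[OF W(1) g.subspace_linear_preimage[OF U(1)]] by (simp add: Collect_conj_eq)
  have fZ: "fin_dim s1 ?Z" by (rule vs1.fin_dim_subset[OF W(2)]) simp
  obtain B where B: "finite B" "B \<subseteq> ?Z" "\<not> vs1.dependent B" "vs1.span B = ?Z" "card B = vs1.dim ?Z"
    by (rule vs1.fin_dim_basis[OF Z fZ])
  have BW: "B \<subseteq> W" by (rule order_trans[OF B(2)]) blast
  obtain E where E: "finite E" "E \<inter> B = {}" "\<not> vs1.dependent (B \<union> E)" "vs1.span (B \<union> E) = W"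
      "vs1.dim W = card B + card E"
    by (rule vs1.basis_extension[OF W BW B(3)])
  obtain BU where BU: "finite BU" "BU \<subseteq> U" "\<not> vs2.dependent BU" "vs2.span BU = U" "card BU = vs2.dim U"
    by (rule vs2.fin_dim_basis[OF U])
  have key: "\<not> vs2.dependent (BU \<union> g ` F) \<and> card (BU \<union> g ` F) = card BU + card F"
    if "finite F" "F \<subseteq> E" for F
    using that
  proof (induction F)
    case empty then show ?case using BU by simp
  next
    case (insert x F)
    have notin: "g x \<notin> vs2.span (BU \<union> g ` F)"
    proof
      assume "g x \<in> vs2.span (BU \<union> g ` F)"
      then obtain u v where uv: "g x = u + v" "u \<in> U" "v \<in> vs2.span (g ` F)"
        unfolding vs2.span_Un using BU(4) by auto
      then obtain w where w: "w \<in> vs1.span F" "v = g w"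
        unfolding g.span_image by (elim imageE)
      have "F \<subseteq> W" using insert.prems E(4) vs1.span_superset[of "B \<union> E"] by blast
      then have wW: "w \<in> W" using w vs1.span_minimal[OF _ W(1)] by blast
      have xW: "x \<in> W" using insert.prems E(4) vs1.span_superset[of "B \<union> E"] by blast
      have "x - w \<in> ?Z" using uv w wW xW vs1.subspace_diff[OF W(1)] by (auto simp: g.diff)
      then have 1: "x - w \<in> vs1.span (B \<union> F)" using B(4) vs1.span_mono[of B "B \<union> F"] by blast
      have 2: "w \<in> vs1.span (B \<union> F)" using w vs1.span_mono[of F "B \<union> F"] by blast
      have "x \<in> vs1.span (B \<union> F)" using vs1.span_add[OF 1 2] by simp
      moreover have "B \<union> F \<subseteq> (B \<union> E) - {x}" using insert E(2) by blast
      ultimately have "x \<in> vs1.span ((B \<union> E) - {x})" using vs1.span_mono by blast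
      moreover have "x \<in> B \<union> E" using insert.prems by simp
      ultimately have "vs1.dependent (B \<union> E)" unfolding vs1.dependent_def by (rule bexI)
      with E(3) show False by (rule notE)
    qed
    have "g x \<notin> BU \<union> g ` F" using notin by (rule contrapos_nn) (rule vs2.span_base)
    with insert notin show ?case using BU(1)
      by (auto simp: vs2.independent_insertI)
  qed
  have sp: "vs2.span (BU \<union> g ` E) = {u + g w |u w. u \<in> U \<and> w \<in> W}" (is "_ = ?S")
  proof -
    have sub: "g b \<in> U" if "b \<in> vs1.span B" for b using that B(4) by blast
    have "?S = {u + g w |u w. u \<in> U \<and> w \<in> vs1.span E}"
    proof (intro equalityI subsetI)
      fix y assume "y \<in> ?S"
      then obtain u w where y: "y = u + g w" "u \<in> U" "w \<in> W" by blast
      then obtain b e where be: "w = b + e" "b \<in> vs1.span B" "e \<in> vs1.span E"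
        using E(4) unfolding vs1.span_Un by auto
      have "y = (u + g b) + g e" using y be by (simp add: g.add add.assoc)
      moreover have "u + g b \<in> U" using y sub be vs2.subspace_add[OF U(1)] by blast
      ultimately show "y \<in> {u + g w |u w. u \<in> U \<and> w \<in> vs1.span E}" using be by blast
    next
      fix y assume "y \<in> {u + g w |u w. u \<in> U \<and> w \<in> vs1.span E}"
      then show "y \<in> ?S" using E(4) vs1.span_mono[of E "B \<union> E"] by blast
    qed
    then show ?thesis unfolding vs2.span_Un BU(4) g.span_image by auto
  qed
  have k: "\<not> vs2.dependent (BU \<union> g ` E)" "card (BU \<union> g ` E) = card BU + card E"
    using key[OF E(1)] by auto
  have "vs2.dim {u + g w |u w. u \<in> U \<and> w \<in> W} = card BU + card E"
    using vs2.dim_span_eq_card_independent[OF k(1)] k(2) sp by simp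
  then show "vs2.dim {u + g w |u w. u \<in> U \<and> w \<in> W} + vs1.dim ?Z = vs2.dim U + vs1.dim W"
    using B(5) E(5) BU(5) by linarith
  show "fin_dim s2 {u + g w |u w. u \<in> U \<and> w \<in> W}"
    unfolding fin_dim_def sp[symmetric] using BU(1) E(1) by (intro exI[of _ "BU \<union> g ` E"]) simp
qed

lemma dim_image_kernel:
  assumes g: "Vector_Spaces.linear s1 s2 g"
    and W: "vs1.subspace W" "fin_dim s1 W"
  shows "vs2.dim (g ` W) + vs1.dim {w \<in> W. g w = 0} = vs1.dim W"
    and "fin_dim s2 (g ` W)"
proof -
  have fd0: "fin_dim s2 {0}" unfolding fin_dim_def by (rule exI[of _ "{}"]) simp
  have eq: "{u + g w |u w. u \<in> {0} \<and> w \<in> W} = g ` W" by auto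
  note * = dim_plus_image[OF g W vs2.subspace_single_0 fd0, unfolded eq]
  show "vs2.dim (g ` W) + vs1.dim {w \<in> W. g w = 0} = vs1.dim W"
    using *(1) by (simp add: vs2.dim_zero_space)
  show "fin_dim s2 (g ` W)" by (rule *(2))
qed

lemma dim_image_inj:
  assumes g: "Vector_Spaces.linear s1 s2 g"
    and W: "vs1.subspace W" "fin_dim s1 W" and inj: "\<And>w. w \<in> W \<Longrightarrow> g w = 0 \<Longrightarrow> w = 0"
  shows "vs2.dim (g ` W) = vs1.dim W"
proof -
  have "{w \<in> W. g w = 0} = {0}"
    using inj vs1.subspace_0[OF W(1)] module_hom.zero[OF g[unfolded linear_iff_module_hom]] by auto
  with dim_image_kernel(1)[OF g W] show ?thesis by (simp add: vs1.dim_zero_space)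
qed

end

lemma vector_space_fun:
  assumes "vector_space scale"
  shows "vector_space (\<lambda>c (f :: 'j \<Rightarrow> 'v::ab_group_add) j. scale c (f j))"
proof -
  interpret vector_space scale by fact
  show ?thesis
    by unfold_locales (auto simp: scale_right_distrib scale_left_distrib fun_eq_iff)
qed

section \<open>Twists of a subalgebra\<close>

text \<open>
  The linear algebra that the slope argument needs. In the intended model \<open>C\<close> is a Hopf algebra with
  basis \<open>b\<close> and dual basis \<open>f\<close>, and \<open>A\<close> is a left coideal subalgebra. There
  \<open>E i l x = \<Sum> f\<^sub>i(b\<^sub>l S(x\<^sub>1)) x\<^sub>2\<close> and \<open>D i l x = \<Sum> f\<^sub>i(b\<^sub>l x\<^sub>1) x\<^sub>2\<close>: the matrix \<open>E\<close> is an algebra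
  homomorphism, and \<open>D\<close> undoes it. The last assumption is what makes twisted modules faithful: the entries
  of \<open>D\<close> at \<open>a\<close>, which span the right legs of the coproduct of \<open>a\<close>, generate \<open>C\<close> as a right ideal.
\<close>

locale twisted_subalgebra = vector_space scale
  for scale :: "'k::field \<Rightarrow> 'v::ab_group_add \<Rightarrow> 'v" +
  fixes mult :: "'v \<Rightarrow> 'v \<Rightarrow> 'v" (infixl "\<cdot>" 70)
    and e :: 'v and C A :: "'v set" and n :: nat and E D :: "nat \<Rightarrow> nat \<Rightarrow> 'v \<Rightarrow> 'v"
  assumes add_mult: "(x + y) \<cdot> z = x \<cdot> z + y \<cdot> z"
    and mult_add: "x \<cdot> (y + z) = x \<cdot> y + x \<cdot> z"
    and scale_mult: "scale c x \<cdot> y = scale c (x \<cdot> y)"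
    and mult_scale: "x \<cdot> scale c y = scale c (x \<cdot> y)"
    and mult_assoc: "(x \<cdot> y) \<cdot> z = x \<cdot> (y \<cdot> z)"
    and C: "subspace C" "fin_dim scale C" and C_mult: "x \<in> C \<Longrightarrow> y \<in> C \<Longrightarrow> x \<cdot> y \<in> C"
    and A: "subspace A" "A \<subseteq> C" and A_mult: "x \<in> A \<Longrightarrow> y \<in> A \<Longrightarrow> x \<cdot> y \<in> A"
    and e_A: "e \<in> A" and e_left: "x \<in> C \<Longrightarrow> e \<cdot> x = x" and e_right: "x \<in> C \<Longrightarrow> x \<cdot> e = x"
    and e_nonzero: "e \<noteq> 0"
    and E_linear: "i < n \<Longrightarrow> l < n \<Longrightarrow> Vector_Spaces.linear scale scale (E i l)"
    and D_linear: "i < n \<Longrightarrow> l < n \<Longrightarrow> Vector_Spaces.linear scale scale (D i l)"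
    and E_C: "i < n \<Longrightarrow> l < n \<Longrightarrow> x \<in> C \<Longrightarrow> E i l x \<in> C"
    and D_C: "i < n \<Longrightarrow> l < n \<Longrightarrow> x \<in> C \<Longrightarrow> D i l x \<in> C"
    and E_A: "i < n \<Longrightarrow> l < n \<Longrightarrow> x \<in> A \<Longrightarrow> E i l x \<in> A"
    and D_A: "i < n \<Longrightarrow> l < n \<Longrightarrow> x \<in> A \<Longrightarrow> D i l x \<in> A"
    and E_mult: "i < n \<Longrightarrow> l < n \<Longrightarrow> x \<in> C \<Longrightarrow> y \<in> C \<Longrightarrow>
      E i l (x \<cdot> y) = (\<Sum>r<n. E i r x \<cdot> E r l y)"
    and E_D: "i < n \<Longrightarrow> l < n \<Longrightarrow> x \<in> C \<Longrightarrow> (\<Sum>r<n. E i r (D r l x)) = (if i = l then x else 0)"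
    and D_E: "i < n \<Longrightarrow> l < n \<Longrightarrow> x \<in> C \<Longrightarrow> (\<Sum>r<n. D i r (E r l x)) = (if i = l then x else 0)"
    and unit_in_span: "a \<in> A \<Longrightarrow> a \<noteq> 0 \<Longrightarrow> e \<in> span {D i l a \<cdot> c |i l c. i < n \<and> l < n \<and> c \<in> C}"
begin

text \<open>
  Elements of powers of \<open>C\<close> are functions on lists of indices. Prepending an index to a list passes to a
  further power, so that one type serves for all powers.
\<close>

abbreviation fscale :: "'k \<Rightarrow> (nat list \<Rightarrow> 'v) \<Rightarrow> nat list \<Rightarrow> 'v" where
  "fscale \<equiv> \<lambda>c f j. scale c (f j)"

sublocale F: vector_space fscale
  by (rule vector_space_fun[OF vector_space_axioms])

sublocale FF: vector_space_pair fscale fscale by unfold_locales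
sublocale SF: vector_space_pair scale fscale by unfold_locales

definition rmult :: "(nat list \<Rightarrow> 'v) \<Rightarrow> 'v \<Rightarrow> nat list \<Rightarrow> 'v" where
  "rmult f h = (\<lambda>j. f j \<cdot> h)"

definition submod :: "(nat list \<Rightarrow> 'v) set \<Rightarrow> bool" where
  "submod K \<longleftrightarrow> F.subspace K \<and> fin_dim fscale K \<and> (\<forall>f\<in>K. \<forall>j. f j \<in> A) \<and>
     (\<forall>f\<in>K. \<forall>a\<in>A. rmult f a \<in> K)"

definition times_C :: "(nat list \<Rightarrow> 'v) set \<Rightarrow> (nat list \<Rightarrow> 'v) set" where
  "times_C K = F.span {rmult f h |f h. f \<in> K \<and> h \<in> C}"

text \<open>
  The power \<open>K\<^sup>m\<close>, with the factor as head of the list. The empty list is no index of a power.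
\<close>

definition copies :: "nat \<Rightarrow> (nat list \<Rightarrow> 'v) set \<Rightarrow> (nat list \<Rightarrow> 'v) set" where
  "copies m K = {z. (\<forall>i<m. (\<lambda>j. z (i # j)) \<in> K) \<and> z [] = 0 \<and> (\<forall>i j. m \<le> i \<longrightarrow> z (i # j) = 0)}"

definition copy_at :: "nat \<Rightarrow> (nat list \<Rightarrow> 'v) \<Rightarrow> nat list \<Rightarrow> 'v" where
  "copy_at i x = (\<lambda>w. case w of [] \<Rightarrow> 0 | l # j \<Rightarrow> if l = i then x j else 0)"

text \<open>
  A matrix of linear maps, applied to an \<open>n\<close>-tuple of elements of a power of \<open>C\<close>.
\<close>

definition twist :: "(nat \<Rightarrow> nat \<Rightarrow> 'v \<Rightarrow> 'v) \<Rightarrow> (nat list \<Rightarrow> 'v) \<Rightarrow> nat list \<Rightarrow> 'v" where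
  "twist T z = (\<lambda>w. case w of [] \<Rightarrow> 0 | i # j \<Rightarrow> if i < n then (\<Sum>l<n. T i l (z (l # j))) else 0)"

lemma copy_at_simps [simp]: "copy_at i x [] = 0" "copy_at i x (l # j) = (if l = i then x j else 0)"
  by (auto simp: copy_at_def)

lemma twist_simps [simp]: "twist T z [] = 0"
    "twist T z (i # j) = (if i < n then (\<Sum>l<n. T i l (z (l # j))) else 0)"
  by (auto simp: twist_def)

abbreviation vals :: "'v set \<Rightarrow> (nat list \<Rightarrow> 'v) set" where
  "vals S \<equiv> {f. \<forall>j. f j \<in> S}"

lemma list_fun_eqI: "f [] = g [] \<Longrightarrow> (\<And>i j. f (i # j) = g (i # j)) \<Longrightarrow> f = (g :: nat list \<Rightarrow> 'v)"
  by (rule ext) (metis list.exhaust)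

lemma F_linearI:
  assumes "\<And>x y. g (x + y) = g x + g y" "\<And>c x. g (fscale c x) = fscale c (g x)"
  shows "Vector_Spaces.linear fscale fscale g"
  using assms by (simp add: Vector_Spaces.linear_iff F.vector_space_axioms)

lemma SF_linearI:
  assumes "\<And>x y. g (x + y) = g x + g y" "\<And>c x. g (scale c x) = fscale c (g x)"
  shows "Vector_Spaces.linear scale fscale g"
  using assms by (simp add: Vector_Spaces.linear_iff F.vector_space_axioms vector_space_axioms)

lemma copy_at_linear: "Vector_Spaces.linear fscale fscale (copy_at i)"
  by (rule F_linearI) (auto intro!: list_fun_eqI)

lemma linear_add: "Vector_Spaces.linear s1 s2 f \<Longrightarrow> f (x + y) = f x + f y"
  and linear_scale: "Vector_Spaces.linear s1 s2 f \<Longrightarrow> f (s1 c x) = s2 c (f x)"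
  and linear_0: "Vector_Spaces.linear s1 s2 f \<Longrightarrow> f 0 = 0"
  using module_hom.zero[of s1 s2 f] by (auto simp: Vector_Spaces.linear_iff module_hom_iff_linear)

lemma twist_linear:
  assumes "\<And>i l. i < n \<Longrightarrow> l < n \<Longrightarrow> Vector_Spaces.linear scale scale (T i l)"
  shows "Vector_Spaces.linear fscale fscale (twist T)"
  by (rule F_linearI; rule list_fun_eqI)
    (auto simp: linear_add[OF assms] linear_scale[OF assms] sum.distrib scale_sum_right)

lemma rmult_linear: "Vector_Spaces.linear fscale fscale (\<lambda>f. rmult f h)"
  by (rule F_linearI) (auto simp: rmult_def add_mult scale_mult)

lemma rmult_linear2: "Vector_Spaces.linear scale fscale (rmult f)"
  by (rule SF_linearI) (auto simp: rmult_def mult_add mult_scale)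

lemma rmult_assoc: "rmult (rmult f x) y = rmult f (x \<cdot> y)"
  by (simp add: rmult_def mult_assoc)

lemma A_fin_dim: "fin_dim scale A"
  using C(2) A(2) fin_dim_subset by blast

lemma subspace_copies: "F.subspace K \<Longrightarrow> F.subspace (copies m K)"
  unfolding copies_def F.subspace_def by (auto simp: plus_fun_def zero_fun_def)

lemma copies_0: "copies 0 K = {0}"
  by (auto simp: copies_def intro!: list_fun_eqI)

lemma copies_Suc:
  assumes "F.subspace K"
  shows "copies (Suc m) K = {u + copy_at m x |u x. u \<in> copies m K \<and> x \<in> K}"
proof (intro equalityI subsetI)
  fix z assume z: "z \<in> copies (Suc m) K"
  \<comment> \<open>Split off the last factor.\<close>
  define x where "x = (\<lambda>j. z (m # j))"
  have x: "x \<in> K" using z by (auto simp: copies_def x_def)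
  have "(\<lambda>j. (z - copy_at m x) (i # j)) \<in> K" if "i < m" for i
    using z that by (auto simp: copies_def)
  then have "z - copy_at m x \<in> copies m K"
    using z by (auto simp: copies_def x_def)
  then show "z \<in> {u + copy_at m x |u x. u \<in> copies m K \<and> x \<in> K}"
    using x by (force intro: exI[of _ "z - copy_at m x"])
next
  fix z assume "z \<in> {u + copy_at m x |u x. u \<in> copies m K \<and> x \<in> K}"
  then obtain u x where z: "z = u + copy_at m x" "u \<in> copies m K" "x \<in> K" by blast
  have "(\<lambda>j. z (i # j)) \<in> K" if "i < Suc m" for i
  proof (cases "i = m")
    case True
    then have "(\<lambda>j. z (i # j)) = x" using z by (auto simp: copies_def)
    then show ?thesis using z by simp
  next
    case False
    then have "(\<lambda>j. z (i # j)) = (\<lambda>j. u (i # j))" using z by auto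
    then show ?thesis using z that False by (auto simp: copies_def)
  qed
  then show "z \<in> copies (Suc m) K" using z by (auto simp: copies_def)
qed

lemma dim_copies:
  assumes K: "F.subspace K" "fin_dim fscale K"
  shows "fin_dim fscale (copies m K) \<and> F.dim (copies m K) = m * F.dim K"
proof (induction m)
  case 0
  show ?case unfolding copies_0 by (auto simp: F.dim_zero_space fin_dim_def intro: exI[of _ "{}"])
next
  case (Suc m)
  have z: "{x \<in> K. copy_at m x \<in> copies m K} = {0}"
  proof -
    have "x = 0" if "copy_at m x \<in> copies m K" for x
      using that by (auto simp: copies_def fun_eq_iff)
    then show ?thesis using F.subspace_0[OF K(1)] F.subspace_0[OF subspace_copies[OF K(1)]]
      by (auto simp: linear_0[OF copy_at_linear])
  qed
  note * = FF.dim_plus_image[OF copy_at_linear K subspace_copies[OF K(1)] conjunct1[OF Suc.IH], of m]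
  show ?case using * Suc.IH by (simp add: z F.dim_zero_space copies_Suc[OF K(1)])
qed

lemma subspace_times_C: "F.subspace (times_C K)"
  by (simp add: times_C_def)

lemma rmult_in_times_C: "f \<in> K \<Longrightarrow> h \<in> C \<Longrightarrow> rmult f h \<in> times_C K"
  unfolding times_C_def by (rule F.span_base) blast

lemma times_C_minimal:
  assumes "F.subspace S" "\<And>f h. f \<in> K \<Longrightarrow> h \<in> C \<Longrightarrow> rmult f h \<in> S"
  shows "times_C K \<subseteq> S"
  unfolding times_C_def by (rule F.span_minimal[OF _ assms(1)]) (use assms(2) in auto)

lemma times_C_mono: "K \<subseteq> K' \<Longrightarrow> times_C K \<subseteq> times_C K'"
  unfolding times_C_def by (rule F.span_mono) auto

lemma fin_dim_times_C:
  assumes "F.subspace K" "fin_dim fscale K"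
  shows "fin_dim fscale (times_C K)"
proof -
  obtain B where B: "finite B" "F.span B = K"
    by (rule F.fin_dim_basis[OF assms])
  obtain G where G: "finite G" "span G = C"
    by (rule fin_dim_basis[OF C])
  let ?S = "(\<lambda>(f, h). rmult f h) ` (B \<times> G)"
  have "times_C K \<subseteq> F.span ?S"
  proof (rule times_C_minimal)
    fix f h assume "f \<in> K" "h \<in> C"
    have *: "rmult b h \<in> F.span ?S" if "b \<in> B" for b
    proof -
      have "span G \<subseteq> {h. rmult b h \<in> F.span ?S}"
        by (rule span_minimal) (use that in \<open>auto intro!: F.span_base
          module_hom.subspace_linear_preimage[OF rmult_linear2[unfolded linear_iff_module_hom]]\<close>)
      then show ?thesis using \<open>h \<in> C\<close> G(2) by blast
    qed
    have "F.span B \<subseteq> {f. rmult f h \<in> F.span ?S}"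
      by (rule F.span_minimal) (use * in \<open>auto intro!:
          module_hom.subspace_linear_preimage[OF rmult_linear[unfolded linear_iff_module_hom]]\<close>)
    then show "rmult f h \<in> F.span ?S" using \<open>f \<in> K\<close> B(2) by blast
  qed simp
  moreover have "finite ?S" using B G by simp
  ultimately show ?thesis unfolding fin_dim_def by blast
qed

lemma zero_mult: "0 \<cdot> x = 0" and mult_zero: "x \<cdot> 0 = 0"
  using add_mult[of 0 0 x] mult_add[of x 0 0] by simp_all

lemma rmult_zero [simp]: "rmult 0 h = 0" "rmult f 0 = 0"
  by (auto simp: rmult_def zero_mult mult_zero zero_fun_def)

lemma sum_mult: "(\<Sum>i\<in>I. f i) \<cdot> x = (\<Sum>i\<in>I. f i \<cdot> x)"
  by (induction I rule: infinite_finite_induct) (auto simp: zero_mult add_mult)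

lemma mult_sum: "x \<cdot> (\<Sum>i\<in>I. f i) = (\<Sum>i\<in>I. x \<cdot> f i)"
  by (induction I rule: infinite_finite_induct) (auto simp: mult_zero mult_add)

lemma linear_sum: "Vector_Spaces.linear s1 s2 f \<Longrightarrow> f (\<Sum>i\<in>I. x i) = (\<Sum>i\<in>I. f (x i))"
  by (induction I rule: infinite_finite_induct) (auto simp: linear_0 linear_add)

lemma sum_fun_apply: "(\<Sum>i\<in>I. f i) j = (\<Sum>i\<in>I. (f i :: nat list \<Rightarrow> 'v) j)"
  by (induction I rule: infinite_finite_induct) auto

lemma e_C: "e \<in> C"
  using e_A A(2) by blast

lemma submodD:
  assumes "submod K"
  shows "F.subspace K" "fin_dim fscale K" "K \<subseteq> vals A" "K \<subseteq> vals C"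
    "f \<in> K \<Longrightarrow> a \<in> A \<Longrightarrow> rmult f a \<in> K"
  using assms A(2) unfolding submod_def by auto

lemma rmult_e: "(\<And>j. f j \<in> C) \<Longrightarrow> rmult f e = f"
  by (auto simp: rmult_def e_right)

lemma times_C_values:
  assumes "K \<subseteq> vals C" "f \<in> times_C K"
  shows "f j \<in> C"
proof -
  have "F.subspace {f. \<forall>j. f j \<in> C}"
    unfolding F.subspace_def using subspace_0[OF C(1)] subspace_add[OF C(1)] subspace_scale[OF C(1)]
    by (auto simp: plus_fun_def zero_fun_def)
  then have "times_C K \<subseteq> {f. \<forall>j. f j \<in> C}"
    by (rule times_C_minimal) (use assms(1) in \<open>auto simp: rmult_def intro!: C_mult\<close>)
  with assms(2) show ?thesis by auto
qed

lemma copies_values: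
  assumes "z \<in> copies m K" "0 \<in> S" "K \<subseteq> vals S"
  shows "z j \<in> S"
proof (cases j)
  case Nil then show ?thesis using assms by (simp add: copies_def)
next
  case (Cons i k)
  show ?thesis
  proof (cases "i < m")
    case True
    then have "(\<lambda>j. z (i # j)) \<in> K" using assms(1) by (simp add: copies_def)
    with assms(3) show ?thesis using Cons by auto
  next
    case False then show ?thesis using assms Cons by (simp add: copies_def)
  qed
qed

lemma rmult_copies:
  assumes "\<And>f. f \<in> K \<Longrightarrow> rmult f h \<in> K'" "z \<in> copies m K"
  shows "rmult z h \<in> copies m K'"
proof -
  have "(\<lambda>j. rmult z h (i # j)) = rmult (\<lambda>j. z (i # j)) h" for i by (simp add: rmult_def)
  then show ?thesis using assms by (auto simp: copies_def) (auto simp: rmult_def zero_mult)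
qed

lemma copy_at_copies: "i < m \<Longrightarrow> x \<in> K \<Longrightarrow> F.subspace K \<Longrightarrow> copy_at i x \<in> copies m K"
proof -
  assume *: "i < m" "x \<in> K" "F.subspace K"
  have "(\<lambda>j. copy_at i x (l # j)) = (if l = i then x else 0)" for l by auto
  then show ?thesis using * F.subspace_0[of K] by (auto simp: copies_def)
qed

lemma copies_eq_sum:
  assumes "z \<in> copies m K"
  shows "z = (\<Sum>i<m. copy_at i (\<lambda>j. z (i # j)))"
  by (rule list_fun_eqI) (use assms in \<open>auto simp: copies_def sum_fun_apply sum.delta\<close>)

lemma rmult_copy_at: "rmult (copy_at i x) h = copy_at i (rmult x h)"
  by (rule list_fun_eqI) (auto simp: rmult_def zero_mult)

lemma subspace_preimage:
  assumes "Vector_Spaces.linear fscale fscale g" "F.subspace S" shows "F.subspace {x. g x \<in> S}"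
  by (rule module_hom.subspace_linear_preimage[OF assms(1)[unfolded linear_iff_module_hom] assms(2)])

lemma subspace_preimage2:
  assumes "Vector_Spaces.linear scale fscale g" "F.subspace S" shows "subspace {x. g x \<in> S}"
  by (rule module_hom.subspace_linear_preimage[OF assms(1)[unfolded linear_iff_module_hom] assms(2)])

lemma times_C_copies:
  assumes K: "F.subspace K"
  shows "times_C (copies m K) = copies m (times_C K)"
proof
  show "times_C (copies m K) \<subseteq> copies m (times_C K)"
    by (rule times_C_minimal[OF subspace_copies[OF subspace_times_C]]) (auto intro: rmult_copies rmult_in_times_C)
  have *: "copy_at i x \<in> times_C (copies m K)" if "i < m" "x \<in> times_C K" for i x
  proof -
    have "times_C K \<subseteq> {x. copy_at i x \<in> times_C (copies m K)}"
      by (rule times_C_minimal[OF subspace_preimage[OF copy_at_linear subspace_times_C]])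
        (simp add: rmult_copy_at[symmetric] rmult_in_times_C copy_at_copies[OF that(1) _ K])
    with that show ?thesis by blast
  qed
  show "copies m (times_C K) \<subseteq> times_C (copies m K)"
  proof
    fix z assume z: "z \<in> copies m (times_C K)"
    then have "(\<lambda>j. z (i # j)) \<in> times_C K" if "i < m" for i using that by (simp add: copies_def)
    then have "(\<Sum>i<m. copy_at i (\<lambda>j. z (i # j))) \<in> times_C (copies m K)"
      by (intro F.subspace_sum[OF subspace_times_C] *) auto
    then show "z \<in> times_C (copies m K)" using copies_eq_sum[OF z] by simp
  qed
qed

lemma submod_copies:
  assumes "submod K" shows "submod (copies m K)"
  unfolding submod_def
  using subspace_copies[OF submodD(1)[OF assms]] dim_copies[OF submodD(1,2)[OF assms]]
    rmult_copies[of K _ K] submodD(5)[OF assms] copies_values[of _ m K A] submodD(3)[OF assms] subspace_0[OF A(1)]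
  by auto

section \<open>Twisting submodules\<close>

lemma twist_twist:
  assumes T: "\<And>i l. i < n \<Longrightarrow> l < n \<Longrightarrow> Vector_Spaces.linear scale scale (T i l)"
    and inv: "\<And>i l x. i < n \<Longrightarrow> l < n \<Longrightarrow> x \<in> C \<Longrightarrow> (\<Sum>r<n. T i r (T' r l x)) = (if i = l then x else 0)"
    and z: "z \<in> copies n K" and K: "K \<subseteq> vals C"
  shows "twist T (twist T' z) = z"
proof (rule list_fun_eqI)
  show "twist T (twist T' z) [] = z []" using z by (simp add: copies_def)
  fix i j
  have zC: "z w \<in> C" for w by (rule copies_values[OF z subspace_0[OF C(1)] K])
  show "twist T (twist T' z) (i # j) = z (i # j)"
  proof (cases "i < n")
    case True
    have "twist T (twist T' z) (i # j) = (\<Sum>r<n. T i r (\<Sum>l<n. T' r l (z (l # j))))"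
      using True by simp
    also have "\<dots> = (\<Sum>r<n. \<Sum>l<n. T i r (T' r l (z (l # j))))"
      by (rule sum.cong) (use True in \<open>auto simp: linear_sum[OF T]\<close>)
    also have "\<dots> = (\<Sum>l<n. \<Sum>r<n. T i r (T' r l (z (l # j))))" by (rule sum.swap)
    also have "\<dots> = (\<Sum>l<n. if i = l then z (l # j) else 0)"
      by (rule sum.cong) (use True in \<open>auto simp: inv zC\<close>)
    also have "\<dots> = z (i # j)" using True by (simp add: sum.delta)
    finally show ?thesis .
  next
    case False then show ?thesis using z by (simp add: copies_def)
  qed
qed

lemma D_twist_E:
  assumes "z \<in> copies n K" "K \<subseteq> vals C"
  shows "twist D (twist E z) = z"
  by (rule twist_twist[OF D_linear D_E assms])

text \<open>
  \<open>E\<close> is multiplicative and \<open>D\<close> is its inverse, so \<open>E(x) y = E(x) E(D(y)) = E(x D(y))\<close>.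
\<close>

lemma E_mult_D:
  assumes "i < n" "l < n" "x \<in> C" "y \<in> C"
  shows "(\<Sum>r<n. E i r (x \<cdot> D r l y)) = E i l x \<cdot> y"
proof -
  have "(\<Sum>r<n. E i r (x \<cdot> D r l y)) = (\<Sum>r<n. \<Sum>s<n. E i s x \<cdot> E s r (D r l y))"
    by (rule sum.cong) (use assms in \<open>auto simp: E_mult D_C\<close>)
  also have "\<dots> = (\<Sum>s<n. E i s x \<cdot> (\<Sum>r<n. E s r (D r l y)))"
    by (subst sum.swap) (simp add: mult_sum)
  also have "\<dots> = (\<Sum>s<n. if s = l then E i l x \<cdot> y else 0)"
    by (rule sum.cong) (use assms in \<open>auto simp: E_D mult_zero\<close>)
  also have "\<dots> = E i l x \<cdot> y" using assms by (simp add: sum.delta)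
  finally show ?thesis .
qed

text \<open>
  The right action that the twist turns into multiplication on the right. In the model it is the
  diagonal action on a tensor product with the Hopf algebra.
\<close>

definition dmult :: "(nat list \<Rightarrow> 'v) \<Rightarrow> 'v \<Rightarrow> nat list \<Rightarrow> 'v" where
  "dmult z h = (\<lambda>w. case w of [] \<Rightarrow> 0 | i # j \<Rightarrow> if i < n then (\<Sum>l<n. z (l # j) \<cdot> D i l h) else 0)"

lemma dmult_simps [simp]: "dmult z h [] = 0"
    "dmult z h (i # j) = (if i < n then (\<Sum>l<n. z (l # j) \<cdot> D i l h) else 0)"
  by (auto simp: dmult_def)

lemma rmult_twist:
  assumes zC: "\<And>w. z w \<in> C" and h: "h \<in> C"
  shows "rmult (twist E z) h = twist E (dmult z h)"
proof (rule list_fun_eqI)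
  show "rmult (twist E z) h [] = twist E (dmult z h) []" by (simp add: rmult_def zero_mult)
  fix i j
  show "rmult (twist E z) h (i # j) = twist E (dmult z h) (i # j)"
  proof (cases "i < n")
    case True
    have "twist E (dmult z h) (i # j) = (\<Sum>r<n. \<Sum>l<n. E i r (z (l # j) \<cdot> D r l h))"
      using True by (auto simp: linear_sum[OF E_linear] intro!: sum.cong)
    also have "\<dots> = (\<Sum>l<n. \<Sum>r<n. E i r (z (l # j) \<cdot> D r l h))" by (rule sum.swap)
    also have "\<dots> = (\<Sum>l<n. E i l (z (l # j)) \<cdot> h)"
      by (rule sum.cong) (use True in \<open>auto simp: E_mult_D zC h\<close>)
    finally show ?thesis using True by (simp add: rmult_def sum_mult)
  qed (simp add: rmult_def zero_mult)
qed

lemma dmult_copies: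
  assumes z: "z \<in> copies n K" and K': "F.subspace K'"
    and h: "\<And>f i l. f \<in> K \<Longrightarrow> i < n \<Longrightarrow> l < n \<Longrightarrow> rmult f (D i l h) \<in> K'"
  shows "dmult z h \<in> copies n K'"
proof -
  have "(\<lambda>j. dmult z h (i # j)) \<in> K'" if "i < n" for i
  proof -
    have "(\<lambda>j. dmult z h (i # j)) = (\<Sum>l<n. rmult (\<lambda>j. z (l # j)) (D i l h))"
      using that by (auto simp: fun_eq_iff sum_fun_apply rmult_def)
    also have "\<dots> \<in> K'"
      by (rule F.subspace_sum[OF K']) (use z that h in \<open>auto simp: copies_def\<close>)
    finally show ?thesis .
  qed
  then show ?thesis by (auto simp: copies_def)
qed

abbreviation twisted_copies :: "(nat list \<Rightarrow> 'v) set \<Rightarrow> (nat list \<Rightarrow> 'v) set" where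
  "twisted_copies K \<equiv> twist E ` copies n K"

lemma linear_twist_E: "Vector_Spaces.linear fscale fscale (twist E)"
  by (rule twist_linear[OF E_linear])

lemma subspace_twisted_copies: "F.subspace K \<Longrightarrow> F.subspace (twisted_copies K)"
  by (rule module_hom.subspace_image[OF linear_twist_E[unfolded linear_iff_module_hom] subspace_copies])

lemma dim_twisted_copies:
  assumes "F.subspace K" "fin_dim fscale K" and K: "K \<subseteq> vals C"
  shows "F.dim (twisted_copies K) = n * F.dim K"
proof -
  have "F.dim (twisted_copies K) = F.dim (copies n K)"
  proof (rule FF.dim_image_inj[OF linear_twist_E subspace_copies[OF assms(1)]])
    show "fin_dim fscale (copies n K)" using dim_copies[OF assms(1,2)] by simp
    fix z assume z: "z \<in> copies n K" "twist E z = 0"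
    have "z = twist D (twist E z)" by (rule D_twist_E[OF z(1) K, symmetric])
    also have "\<dots> = 0" by (simp add: z(2) linear_0[OF twist_linear[OF D_linear]])
    finally show "z = 0" .
  qed
  then show ?thesis using dim_copies[OF assms(1,2)] by simp
qed

lemma twist_values:
  assumes "\<And>w. z w \<in> A" shows "twist E z w \<in> A"
  by (cases w) (auto simp: assms E_A subspace_0[OF A(1)] intro!: subspace_sum[OF A(1)])

lemma submod_twisted_copies:
  assumes K: "submod K" shows "submod (twisted_copies K)"
  unfolding submod_def
proof (intro conjI ballI allI)
  show "F.subspace (twisted_copies K)" by (rule subspace_twisted_copies[OF submodD(1)[OF K]])
  show "fin_dim fscale (twisted_copies K)"
    by (rule FF.dim_image_kernel(2)[OF linear_twist_E subspace_copies[OF submodD(1)[OF K]]])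
      (use dim_copies[OF submodD(1,2)[OF K]] in simp)
  fix f assume "f \<in> twisted_copies K"
  then obtain z where z: "f = twist E z" "z \<in> copies n K" by (rule imageE)
  have zA: "z w \<in> A" for w
    by (rule copies_values[OF z(2) subspace_0[OF A(1)] submodD(3)[OF K]])
  show "f j \<in> A" for j unfolding z(1) by (rule twist_values[OF zA])
  fix a assume a: "a \<in> A"
  have "rmult f a = twist E (dmult z a)"
    unfolding z(1) by (rule rmult_twist) (use zA a A(2) in auto)
  moreover have "dmult z a \<in> copies n K"
    by (rule dmult_copies[OF z(2) submodD(1)[OF K]]) (auto intro: submodD(5)[OF K] D_A a)
  ultimately show "rmult f a \<in> twisted_copies K" by simp
qed

text \<open>
  By this lemma and \<open>dim_twisted_copies\<close> a twist multiplies the dimensions of \<open>K\<close> and of \<open>KC\<close> by the same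
  number \<open>n\<close>. The first inclusion moves the right multiplication inside with \<open>D\<close>, the second one moves it
  outside by the multiplicativity of \<open>E\<close>.
\<close>

lemma times_C_twisted_copies:
  assumes K: "submod K"
  shows "times_C (twisted_copies K) = twisted_copies (times_C K)"
proof
  note Ks = submodD(1)[OF K]
  show "times_C (twisted_copies K) \<subseteq> twisted_copies (times_C K)"
  proof (rule times_C_minimal[OF subspace_twisted_copies[OF subspace_times_C]])
    fix f h assume "f \<in> twisted_copies K" and h: "h \<in> C"
    then obtain z where z: "f = twist E z" "z \<in> copies n K" by (auto elim: imageE)
    have zC: "z w \<in> C" for w
      by (rule copies_values[OF z(2) subspace_0[OF C(1)] submodD(4)[OF K]])
    have "dmult z h \<in> copies n (times_C K)"
      by (rule dmult_copies[OF z(2) subspace_times_C]) (auto intro: rmult_in_times_C D_C h)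
    then show "rmult f h \<in> twisted_copies (times_C K)" unfolding z(1) rmult_twist[OF zC h] by simp
  qed
  have "times_C (copies n K) \<subseteq> {z. twist E z \<in> times_C (twisted_copies K)}"
  proof (rule times_C_minimal[OF subspace_preimage[OF linear_twist_E subspace_times_C]])
    fix z h assume z: "z \<in> copies n K" and h: "h \<in> C"
    have zC: "z w \<in> C" for w
      by (rule copies_values[OF z subspace_0[OF C(1)] submodD(4)[OF K]])
    let ?c = "\<lambda>r l. twist E (copy_at r (\<lambda>j. z (l # j)))"
    have "twist E (rmult z h) = (\<Sum>l<n. \<Sum>r<n. rmult (?c r l) (E r l h))"
    proof (rule list_fun_eqI)
      show "twist E (rmult z h) [] = (\<Sum>l<n. \<Sum>r<n. rmult (?c r l) (E r l h)) []"
        by (simp add: sum_fun_apply rmult_def zero_mult)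
      fix i j
      have c: "?c r l (i # j) = (if i < n then E i r (z (l # j)) else 0)" if "r < n" for r l
      proof -
        have "(\<Sum>s<n. E i s (copy_at r (\<lambda>j. z (l # j)) (s # j))) = (\<Sum>s<n. if s = r then E i r (z (l # j)) else 0)" if "i < n"
          by (rule sum.cong) (auto simp: linear_0[OF E_linear] that)
        then show ?thesis using that by (simp add: sum.delta)
      qed
      have "twist E (rmult z h) (i # j) = (if i < n then \<Sum>l<n. \<Sum>r<n. E i r (z (l # j)) \<cdot> E r l h else 0)"
        by (simp add: rmult_def E_mult zC h)
      moreover have "(\<Sum>l<n. \<Sum>r<n. rmult (?c r l) (E r l h)) (i # j) =
          (if i < n then \<Sum>l<n. \<Sum>r<n. E i r (z (l # j)) \<cdot> E r l h else 0)"
        by (simp add: sum_fun_apply rmult_def c zero_mult del: twist_simps(2))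
      ultimately show "twist E (rmult z h) (i # j) = (\<Sum>l<n. \<Sum>r<n. rmult (?c r l) (E r l h)) (i # j)"
        by (simp only:)
    qed
    also have "\<dots> \<in> times_C (twisted_copies K)"
      using z by (intro F.subspace_sum[OF subspace_times_C] rmult_in_times_C E_C h imageI copy_at_copies[OF _ _ Ks])
        (auto simp: copies_def)
    finally show "rmult z h \<in> {z. twist E z \<in> times_C (twisted_copies K)}" by simp
  qed
  then show "twisted_copies (times_C K) \<subseteq> times_C (twisted_copies K)"
    unfolding times_C_copies[OF Ks, symmetric] by auto
qed

section \<open>The slope inequality\<close>

definition adjoin :: "(nat list \<Rightarrow> 'v) set \<Rightarrow> (nat list \<Rightarrow> 'v) \<Rightarrow> (nat list \<Rightarrow> 'v) set" where
  "adjoin K f = {u + rmult f a |u a. u \<in> K \<and> a \<in> A}"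

lemma subspace_plus_rmult:
  assumes "F.subspace U" "subspace W"
  shows "F.subspace {u + rmult f w |u w. u \<in> U \<and> w \<in> W}"
proof -
  have "{u + rmult f w |u w. u \<in> U \<and> w \<in> W} = {x + y |x y. x \<in> U \<and> y \<in> rmult f ` W}" by blast
  then show ?thesis
    using F.subspace_sums[OF assms(1)
      module_hom.subspace_image[OF rmult_linear2[unfolded linear_iff_module_hom] assms(2)]] by simp
qed

lemma submod_adjoin:
  assumes K: "submod K" and f: "f \<in> vals A"
  shows "submod (adjoin K f)"
  unfolding submod_def
proof (intro conjI ballI allI)
  show "F.subspace (adjoin K f)"
    unfolding adjoin_def by (rule subspace_plus_rmult[OF submodD(1)[OF K] A(1)])
  show "fin_dim fscale (adjoin K f)"
    unfolding adjoin_def by (rule SF.dim_plus_image(2)[OF rmult_linear2 A(1) A_fin_dim submodD(1,2)[OF K]])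
  fix g assume "g \<in> adjoin K f"
  then obtain u a where g: "g = u + rmult f a" "u \<in> K" "a \<in> A" unfolding adjoin_def by blast
  show "g j \<in> A" for j
    using g f submodD(3)[OF K] by (auto simp: rmult_def intro!: subspace_add[OF A(1)] A_mult)
  fix b assume b: "b \<in> A"
  have "rmult g b = rmult u b + rmult f (a \<cdot> b)"
    using g by (simp add: linear_add[OF rmult_linear] rmult_assoc)
  then show "rmult g b \<in> adjoin K f"
    unfolding adjoin_def using submodD(5)[OF K g(2) b] A_mult[OF g(3) b] by blast
qed

lemma adjoin_superset: "K \<subseteq> adjoin K f"
proof
  fix u assume "u \<in> K"
  moreover have "u = u + rmult f 0" by simp
  ultimately show "u \<in> adjoin K f" unfolding adjoin_def using subspace_0[OF A(1)] by blast
qed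

lemma in_adjoin:
  assumes "submod K" "f \<in> vals A" shows "f \<in> adjoin K f"
proof -
  have "f j \<in> C" for j using assms(2) A(2) by auto
  then have "f = 0 + rmult f e" using rmult_e[of f] by simp
  then show ?thesis unfolding adjoin_def using F.subspace_0[OF submodD(1)[OF assms(1)]] e_A by blast
qed

lemma adjoin_minimal:
  assumes "submod K" "submod K'" "K \<subseteq> K'" "f \<in> K'" shows "adjoin K f \<subseteq> K'"
  unfolding adjoin_def using assms submodD(5)[OF assms(2,4)] F.subspace_add[OF submodD(1)[OF assms(2)]]
  by auto

lemma dim_adjoin:
  assumes "submod K"
  shows "F.dim (adjoin K f) + dim {a \<in> A. rmult f a \<in> K} = F.dim K + dim A"
  unfolding adjoin_def by (rule SF.dim_plus_image(1)[OF rmult_linear2 A(1) A_fin_dim submodD(1,2)[OF assms]])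

lemma dim_times_C_adjoin:
  assumes K: "submod K" and f: "f \<in> vals A"
  shows "F.dim (times_C (adjoin K f)) + dim {h \<in> C. rmult f h \<in> times_C K} = F.dim (times_C K) + dim C"
proof -
  have "times_C (adjoin K f) = {u + rmult f h |u h. u \<in> times_C K \<and> h \<in> C}" (is "_ = ?R")
  proof
    show "times_C (adjoin K f) \<subseteq> ?R"
    proof (rule times_C_minimal[OF subspace_plus_rmult[OF subspace_times_C C(1)]])
      fix g h assume "g \<in> adjoin K f" and h: "h \<in> C"
      then obtain u a where g: "g = u + rmult f a" "u \<in> K" "a \<in> A" unfolding adjoin_def by blast
      have "rmult g h = rmult u h + rmult f (a \<cdot> h)"
        using g by (simp add: linear_add[OF rmult_linear] rmult_assoc)
      moreover have "a \<cdot> h \<in> C" using g A(2) h C_mult by blast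
      ultimately show "rmult g h \<in> ?R" using rmult_in_times_C[OF g(2) h] by blast
    qed
    show "?R \<subseteq> times_C (adjoin K f)"
      using times_C_mono[OF adjoin_superset[of K f]] rmult_in_times_C[OF in_adjoin[OF K f]]
        F.subspace_add[OF subspace_times_C] by blast
  qed
  then show ?thesis
    using SF.dim_plus_image(1)[OF rmult_linear2 C subspace_times_C fin_dim_times_C[OF submodD(1,2)[OF K]]] by simp
qed

text \<open>
  Numerators and denominators of the slopes of the cyclic extensions. Both are bounded, so a
  maximal slope exists.
\<close>

definition slopes :: "(nat \<times> nat) set" where
  "slopes = {(F.dim (times_C (adjoin K f)) - F.dim (times_C K), F.dim (adjoin K f) - F.dim K) |K f.
     submod K \<and> f \<in> vals A \<and> f \<notin> K}"

text \<open>
  The slope of a pair is at most \<open>fst s / snd s\<close> when the potential does not increase from the smaller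
  to the larger module. In contrast to slopes, differences of potentials add up along chains.
\<close>

definition potential :: "nat \<times> nat \<Rightarrow> (nat list \<Rightarrow> 'v) set \<Rightarrow> int" where
  "potential s K = int (snd s * F.dim (times_C K)) - int (fst s * F.dim K)"

lemma dim_times_C_mono:
  assumes "submod K" "submod K'" "K \<subseteq> K'" shows "F.dim (times_C K) \<le> F.dim (times_C K')"
  by (rule F.dim_mono_subspace[OF subspace_times_C fin_dim_times_C[OF submodD(1,2)[OF assms(2)]] subspace_times_C
        times_C_mono[OF assms(3)]])

lemma dim_strict_mono:
  assumes "submod K" "submod K'" "K \<subseteq> K'" "K \<noteq> K'" shows "F.dim K < F.dim K'"
  using F.subspace_eq_if_dim_le[OF submodD(1,2)[OF assms(2)] submodD(1)[OF assms(1)] assms(3)] assms(4)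
  by linarith

text \<open>
  Every extension is a chain of cyclic ones.
\<close>

lemma potential_antimono:
  assumes max: "\<And>p q. (p, q) \<in> slopes \<Longrightarrow> p * snd s \<le> fst s * q"
    and K: "submod K" and K': "submod K'" and "K \<subseteq> K'"
  shows "potential s K' \<le> potential s K"
  using K \<open>K \<subseteq> K'\<close>
proof (induction "F.dim K' - F.dim K" arbitrary: K rule: less_induct)
  case less
  show ?case
  proof (cases "K = K'")
    case False
    then obtain f where f: "f \<in> K'" "f \<notin> K" using less.prems(2) by blast
    have fA: "f \<in> vals A" using f(1) submodD(3)[OF K'] by blast
    note sm = submod_adjoin[OF less.prems(1) fA]
    have sub: "adjoin K f \<subseteq> K'" by (rule adjoin_minimal[OF less.prems(1) K' less.prems(2) f(1)])
    have ne: "K \<noteq> adjoin K f" using in_adjoin[OF less.prems(1) fA] f(2) by blast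
    have lt: "F.dim K < F.dim (adjoin K f)"
      by (rule dim_strict_mono[OF less.prems(1) sm adjoin_superset ne])
    have le: "F.dim (adjoin K f) \<le> F.dim K'"
      by (rule F.dim_mono_subspace[OF submodD(1,2)[OF K'] submodD(1)[OF sm] sub])
    have "F.dim K' - F.dim (adjoin K f) < F.dim K' - F.dim K" using lt le by linarith
    then have IH: "potential s K' \<le> potential s (adjoin K f)" using less.hyps sm sub by blast
    have il: "F.dim (times_C K) \<le> F.dim (times_C (adjoin K f))"
      by (rule dim_times_C_mono[OF less.prems(1) sm adjoin_superset])
    have "(F.dim (times_C (adjoin K f)) - F.dim (times_C K), F.dim (adjoin K f) - F.dim K) \<in> slopes"
      unfolding slopes_def using less.prems(1) fA f(2) by blast
    from max[OF this]
    have "(F.dim (times_C (adjoin K f)) - F.dim (times_C K)) * snd s \<le> fst s * (F.dim (adjoin K f) - F.dim K)" .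
    then have "int ((F.dim (times_C (adjoin K f)) - F.dim (times_C K)) * snd s) \<le> int (fst s * (F.dim (adjoin K f) - F.dim K))"
      by (simp only: of_nat_le_iff)
    then have "potential s (adjoin K f) \<le> potential s K"
      unfolding potential_def using lt il by (simp add: of_nat_diff algebra_simps)
    with IH show ?thesis by simp
  qed simp
qed

lemma slope_bounds: "(p, q) \<in> slopes \<Longrightarrow> p \<le> dim C \<and> q \<le> dim A \<and> 0 < q"
proof -
  assume "(p, q) \<in> slopes"
  then obtain K f where K: "submod K" "f \<in> vals A" "f \<notin> K"
    and pq: "p = F.dim (times_C (adjoin K f)) - F.dim (times_C K)" "q = F.dim (adjoin K f) - F.dim K"
    unfolding slopes_def by blast
  have "K \<noteq> adjoin K f" using in_adjoin[OF K(1,2)] K(3) by blast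
  then have "F.dim K < F.dim (adjoin K f)"
    by (rule dim_strict_mono[OF K(1) submod_adjoin[OF K(1,2)] adjoin_superset])
  then show ?thesis using dim_adjoin[OF K(1), of f] dim_times_C_adjoin[OF K(1,2)] pq by linarith
qed

lemma submod_0: "submod {0}"
  unfolding submod_def using subspace_0[OF A(1)] by (auto simp: fin_dim_def intro: exI[of _ "{}"])

lemma times_C_0: "times_C {0} = {0}"
proof -
  have "{rmult f h |f h. f \<in> {0} \<and> h \<in> C} = {0}" using e_C by auto
  then show ?thesis unfolding times_C_def by simp
qed

text \<open>
  The embedding of \<open>C\<close> as the power with a single factor.
\<close>

definition point :: "'v \<Rightarrow> nat list \<Rightarrow> 'v" where
  "point x = (\<lambda>w. if w = [] then x else 0)"

lemma point_linear: "Vector_Spaces.linear scale fscale point"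
  by (rule SF_linearI) (auto simp: point_def fun_eq_iff)

lemma rmult_point: "rmult (point x) h = point (x \<cdot> h)"
  by (auto simp: rmult_def point_def fun_eq_iff zero_mult)

lemma point_eq_0: "point x = 0 \<Longrightarrow> x = 0"
  by (metis point_def zero_fun_apply)

lemma dim_point: "subspace S \<Longrightarrow> fin_dim scale S \<Longrightarrow> F.dim (point ` S) = dim S"
  by (rule SF.dim_image_inj[OF point_linear]) (auto dest: point_eq_0)

lemma subspace_point: "subspace S \<Longrightarrow> F.subspace (point ` S)"
  by (rule module_hom.subspace_image[OF point_linear[unfolded linear_iff_module_hom]])

lemma submod_point:
  assumes "subspace S" "S \<subseteq> A" "\<And>x a. x \<in> S \<Longrightarrow> a \<in> A \<Longrightarrow> x \<cdot> a \<in> S"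
  shows "submod (point ` S)"
  unfolding submod_def
  using subspace_point[OF assms(1)] SF.dim_image_kernel(2)[OF point_linear assms(1) fin_dim_subset[OF A_fin_dim assms(2)]]
    assms(2,3) subspace_0[OF A(1)]
  by (auto simp: rmult_point) (auto simp: point_def)

lemma times_C_point_A: "times_C (point ` A) = point ` C"
proof
  show "times_C (point ` A) \<subseteq> point ` C"
    by (rule times_C_minimal[OF subspace_point[OF C(1)]]) (use C_mult A(2) in \<open>auto simp: rmult_point\<close>)
  show "point ` C \<subseteq> times_C (point ` A)"
  proof (rule image_subsetI)
    fix x assume x: "x \<in> C"
    have "point x = rmult (point e) x" by (simp add: rmult_point e_left x)
    then show "point x \<in> times_C (point ` A)" using rmult_in_times_C[OF imageI[OF e_A] x] by simp
  qed
qed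

lemma e_not_0: "point e \<noteq> 0"
  using e_nonzero point_eq_0 by blast

lemma base_slope: "(dim C, dim A) \<in> slopes"
proof -
  have f: "point e \<in> vals A" using e_A subspace_0[OF A(1)] by (auto simp: point_def)
  have 1: "{a \<in> A. rmult (point e) a \<in> {0}} = {0}" 
    using A(2) subspace_0[OF A(1)] e_left
    by (auto simp: rmult_point mult_zero linear_0[OF point_linear] dest!: point_eq_0)
  have 2: "{a \<in> C. rmult (point e) a \<in> times_C {0}} = {0}"
    unfolding times_C_0 using subspace_0[OF C(1)] e_left
    by (auto simp: rmult_point mult_zero linear_0[OF point_linear] dest!: point_eq_0)
  have "F.dim (adjoin {0} (point e)) = dim A"
    using dim_adjoin[OF submod_0, of "point e"] unfolding 1 by (simp add: dim_zero_space F.dim_zero_space)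
  moreover have "F.dim (times_C (adjoin {0} (point e))) = dim C"
    using dim_times_C_adjoin[OF submod_0 f] unfolding 2 by (simp add: dim_zero_space F.dim_zero_space times_C_0)
  ultimately have "(dim C, dim A) = (F.dim (times_C (adjoin {0} (point e))) - F.dim (times_C {0}), F.dim (adjoin {0} (point e)) - F.dim {0})"
    by (simp add: times_C_0 F.dim_zero_space)
  then show ?thesis unfolding slopes_def using submod_0 f e_not_0 by blast
qed

lemma dim_pos: "0 < dim A" "0 < dim C"
proof -
  show "0 < dim A" using slope_bounds[OF base_slope] by blast
  moreover have "dim A \<le> dim C" by (rule dim_mono_subspace[OF C A])
  ultimately show "0 < dim C" by linarith
qed

lemma potential_copies: "submod K \<Longrightarrow> potential s (copies m K) = int m * potential s K"
  unfolding potential_def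
  using dim_copies[OF submodD(1,2), of K m] dim_copies[OF subspace_times_C fin_dim_times_C[OF submodD(1,2)], of K m]
  by (simp add: times_C_copies submodD(1) algebra_simps)

lemma potential_twisted_copies: "submod K \<Longrightarrow> potential s (twisted_copies K) = int n * potential s K"
  unfolding potential_def
  using dim_twisted_copies[OF submodD(1,2,4), of K] dim_twisted_copies[OF subspace_times_C fin_dim_times_C[OF submodD(1,2)], of K]
    times_C_values[OF submodD(4)[of K]]
  by (simp add: times_C_twisted_copies algebra_simps subset_iff)

text \<open>
  If \<open>a\<close> annihilates the twisted quotient, then all entries \<open>D i l a\<close> map \<open>K'\<close> into \<open>K\<close>. For nonzero \<open>a\<close>
  these entries span the unit over \<open>C\<close>, so that \<open>K'C = KC\<close>.
\<close>

lemma twisted_faithful: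
  assumes K: "submod K" and K': "submod K'" and nK: "\<not> times_C K' \<subseteq> times_C K"
    and a: "a \<in> A" "\<And>z. z \<in> twisted_copies K' \<Longrightarrow> rmult z a \<in> twisted_copies K"
  shows "a = 0"
proof (rule ccontr)
  assume "a \<noteq> 0"
  have aC: "a \<in> C" using a(1) A(2) by blast
  have ann: "rmult f (D i l a) \<in> K" if f: "f \<in> K'" and il: "i < n" "l < n" for f i l
  proof -
    have fC: "f j \<in> C" for j using submodD(4)[OF K'] f by blast
    let ?z = "copy_at l f"
    have z: "?z \<in> copies n K'" by (rule copy_at_copies[OF il(2) f submodD(1)[OF K']])
    have zC: "?z w \<in> C" for w by (rule copies_values[OF z subspace_0[OF C(1)] submodD(4)[OF K']])
    have d: "dmult ?z a \<in> copies n K'"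
      by (rule dmult_copies[OF z submodD(1)[OF K']]) (auto intro: submodD(5)[OF K'] D_A a(1))
    have "twist E (dmult ?z a) \<in> twisted_copies K"
      using a(2)[OF imageI[OF z]] unfolding rmult_twist[OF zC aC] .
    then obtain y where y: "twist E (dmult ?z a) = twist E y" "y \<in> copies n K" by (auto elim: imageE)
    have "dmult ?z a = twist D (twist E (dmult ?z a))"
      by (rule D_twist_E[OF d submodD(4)[OF K'], symmetric])
    also have "\<dots> = y" unfolding y(1) by (rule D_twist_E[OF y(2) submodD(4)[OF K]])
    finally have "dmult ?z a \<in> copies n K" using y(2) by simp
    then have "(\<lambda>j. dmult ?z a (i # j)) \<in> K" using il by (simp add: copies_def)
    moreover have "(\<lambda>j. dmult ?z a (i # j)) = rmult f (D i l a)"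
    proof
      fix j
      have "(\<Sum>m<n. ?z (m # j) \<cdot> D i m a) = (\<Sum>m<n. if m = l then f j \<cdot> D i l a else 0)"
        by (rule sum.cong) (auto simp: zero_mult)
      then show "dmult ?z a (i # j) = rmult f (D i l a) j"
        using il by (simp add: rmult_def sum.delta)
    qed
    ultimately show ?thesis by simp
  qed
  have "rmult f h \<in> times_C K" if f: "f \<in> K'" and h: "h \<in> C" for f h
  proof -
    have lin: "Vector_Spaces.linear scale fscale (\<lambda>x. rmult f (x \<cdot> h))"
      by (rule SF_linearI) (auto simp: rmult_def fun_eq_iff add_mult mult_add scale_mult mult_scale)
    have "span {D i l a \<cdot> c |i l c. i < n \<and> l < n \<and> c \<in> C} \<subseteq> {x. rmult f (x \<cdot> h) \<in> times_C K}"
    proof (rule span_minimal[OF _ subspace_preimage2[OF lin subspace_times_C]], clarify)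
      fix i l c assume il: "i < n" "l < n" and c: "c \<in> C"
      have "rmult f (D i l a \<cdot> c \<cdot> h) = rmult (rmult f (D i l a)) (c \<cdot> h)"
        by (simp add: rmult_assoc mult_assoc)
      then show "rmult f (D i l a \<cdot> c \<cdot> h) \<in> times_C K"
        using rmult_in_times_C[OF ann[OF f il] C_mult[OF c h]] by simp
    qed
    with unit_in_span[OF a(1) \<open>a \<noteq> 0\<close>] have "rmult f (e \<cdot> h) \<in> times_C K" by blast
    then show ?thesis by (simp add: e_left h)
  qed
  then have "times_C K' \<subseteq> times_C K" by (intro times_C_minimal subspace_times_C)
  with nK show False by contradiction
qed

text \<open>
  The maximal slope \<open>p0/q0\<close> is attained by a pair \<open>K \<subseteq> K'\<close>, and its twist has the same slope. A power of
  the twisted quotient contains a copy of \<open>A\<close>, generated by the tuple \<open>\<mu>\<close> of all elements of a basis.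
  The corresponding powers \<open>L\<close> and \<open>L'\<close> of the twists of \<open>K\<close> and \<open>K'\<close> have the same potential, so it is
  constant in between, and the copy of \<open>A\<close> has slope \<open>p0/q0\<close>; the numerator of this slope is at most \<open>dim C\<close>.
\<close>

theorem slope_le: 
  assumes "(p, q) \<in> slopes"
  shows "p * dim A \<le> dim C * q"
proof -
  define ratio where "ratio s = real (fst s) / real (snd s)" for s :: "nat \<times> nat"
  have "slopes \<subseteq> {..dim C} \<times> {..dim A}" using slope_bounds by auto
  then have fin: "finite slopes" by (rule finite_subset) simp
  have "Max (ratio ` slopes) \<in> ratio ` slopes" by (rule Max_in) (use fin base_slope in auto)
  then obtain s where s0: "Max (ratio ` slopes) = ratio s" and s1: "s \<in> slopes" by (rule imageE)
  have s2: "ratio t \<le> ratio s" if "t \<in> slopes" for t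
    unfolding s0[symmetric] by (rule Max_ge) (use fin that in auto)
  note s = s1 s2
  obtain p0 q0 where pq0: "s = (p0, q0)" by (cases s)
  have q0: "0 < q0" using slope_bounds s(1) pq0 by blast
  have max: "p * snd s \<le> fst s * q" if "(p, q) \<in> slopes" for p q
  proof -
    have "0 < q" using slope_bounds[OF that] by blast
    moreover have "real p / real q \<le> real p0 / real q0" using s(2)[OF that] pq0 by (simp add: ratio_def)
    ultimately have "real (p * q0) \<le> real (p0 * q)" using q0 by (simp add: field_simps)
    then show ?thesis using pq0 by (simp only: of_nat_le_iff) simp
  qed
  have p0: "0 < p0"
    using max[OF base_slope] dim_pos(2) q0 pq0 by (cases "p0 = 0") auto
  obtain K f where K: "submod K" and f: "f \<in> vals A" "f \<notin> K"
    and pq: "p0 = F.dim (times_C (adjoin K f)) - F.dim (times_C K)" "q0 = F.dim (adjoin K f) - F.dim K"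
    using s(1) unfolding slopes_def pq0 by blast
  define K' where "K' = adjoin K f"
  have K': "submod K'" unfolding K'_def by (rule submod_adjoin[OF K f(1)])
  have KK': "K \<subseteq> K'" unfolding K'_def by (rule adjoin_superset)
  have pot: "potential s K' = potential s K"
  proof -
    have "F.dim (times_C K') = p0 + F.dim (times_C K)" "F.dim K' = q0 + F.dim K"
      using pq p0 q0 unfolding K'_def by linarith+
    then show ?thesis unfolding potential_def pq0 by (simp add: algebra_simps)
  qed
  have nK: "\<not> times_C K' \<subseteq> times_C K"
  proof
    assume "times_C K' \<subseteq> times_C K"
    then have "F.dim (times_C K') \<le> F.dim (times_C K)"
      by (rule F.dim_mono_subspace[OF subspace_times_C fin_dim_times_C[OF submodD(1,2)[OF K]] subspace_times_C])
    then show False using pq(1) p0 unfolding K'_def by linarith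
  qed
  note tK = submod_twisted_copies[OF K] and tK' = submod_twisted_copies[OF K']
  obtain B where B: "finite B" "B \<subseteq> twisted_copies K'" "\<not> F.dependent B" "F.span B = twisted_copies K'" "card B = F.dim (twisted_copies K')"
    by (rule F.fin_dim_basis[OF submodD(1,2)[OF tK']])
  obtain bs where bs: "set bs = B" using finite_list[OF B(1)] by blast
  define N where "N = length bs"
  define L where "L = copies N (twisted_copies K)"
  define L' where "L' = copies N (twisted_copies K')"
  define \<mu> where "\<mu> = (\<lambda>w. case w of [] \<Rightarrow> 0 | i # j \<Rightarrow> if i < N then (bs ! i) j else 0)"
  have \<mu>_simps: "\<mu> [] = 0" "\<mu> (i # j) = (if i < N then (bs ! i) j else 0)" for i j
    by (auto simp: \<mu>_def)
  have bsi: "bs ! i \<in> twisted_copies K'" if "i < N" for i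
    using that bs B(2) N_def nth_mem by blast
  have \<mu>L: "\<mu> \<in> L'"
    unfolding L'_def copies_def[of N "twisted_copies K'"] using bsi by (simp add: \<mu>_simps del: image_iff)
  have L: "submod L" and L': "submod L'"
    unfolding L_def L'_def by (rule submod_copies[OF tK], rule submod_copies[OF tK'])
  have copies_mono: "copies m S \<subseteq> copies m S'" if "S \<subseteq> S'" for m S S'
    using that by (auto simp: copies_def)
  have LL': "L \<subseteq> L'" unfolding L_def L'_def by (intro copies_mono image_mono KK')
  have \<mu>A: "\<mu> \<in> vals A" using submodD(3)[OF L'] \<mu>L by blast
  have potL: "potential s L' = potential s L"
    unfolding L_def L'_def by (simp add: potential_copies tK tK' potential_twisted_copies K K' pot)
  have M: "submod (adjoin L \<mu>)" by (rule submod_adjoin[OF L \<mu>A])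
  have "potential s (adjoin L \<mu>) \<le> potential s L"
    by (rule potential_antimono[OF max L M adjoin_superset])
  moreover have "potential s L' \<le> potential s (adjoin L \<mu>)"
    by (rule potential_antimono[OF max M L' adjoin_minimal[OF L L' LL' \<mu>L]])
  ultimately have potM: "potential s (adjoin L \<mu>) = potential s L" using potL by linarith
  have faithful: "{a \<in> A. rmult \<mu> a \<in> L} = {0}"
  proof -
    have "a = 0" if a: "a \<in> A" "rmult \<mu> a \<in> L" for a
    proof (rule twisted_faithful[OF K K' nK a(1)])
      have "B \<subseteq> {z. rmult z a \<in> twisted_copies K}"
      proof
        fix b assume "b \<in> B"
        then obtain i where i: "i < N" "b = bs ! i" using bs N_def by (metis in_set_conv_nth)
        have "rmult b a = (\<lambda>j. rmult \<mu> a (i # j))" using i by (simp add: rmult_def \<mu>_simps)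
        also have "\<dots> \<in> twisted_copies K" using a(2) i unfolding L_def copies_def by blast
        finally show "b \<in> {z. rmult z a \<in> twisted_copies K}" by simp
      qed
      then have "twisted_copies K' \<subseteq> {z. rmult z a \<in> twisted_copies K}"
        using F.span_minimal[OF _ subspace_preimage[OF rmult_linear submodD(1)[OF tK]]] B(4) by blast
      then show "rmult z a \<in> twisted_copies K" if "z \<in> twisted_copies K'" for z using that by blast
    qed
    then show ?thesis using F.subspace_0[OF submodD(1)[OF L]] subspace_0[OF A(1)] by auto
  qed
  have d1: "F.dim (adjoin L \<mu>) = F.dim L + dim A"
    using dim_adjoin[OF L, of \<mu>] unfolding faithful by (simp add: dim_zero_space)
  have d2: "F.dim (times_C (adjoin L \<mu>)) \<le> F.dim (times_C L) + dim C"
    using dim_times_C_adjoin[OF L \<mu>A] by linarith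
  have "int q0 * int (F.dim (times_C (adjoin L \<mu>))) = int q0 * int (F.dim (times_C L)) + int p0 * int (dim A)"
    using potM unfolding potential_def pq0 d1 by (simp add: algebra_simps)
  moreover have "int q0 * int (F.dim (times_C (adjoin L \<mu>))) \<le> int q0 * (int (F.dim (times_C L)) + int (dim C))"
    by (rule mult_left_mono) (use d2 in linarith, simp)
  ultimately have "int p0 * int (dim A) \<le> int q0 * int (dim C)" by (simp add: algebra_simps)
  then have le: "p0 * dim A \<le> q0 * dim C" by (simp only: of_nat_mult[symmetric] of_nat_le_iff)
  have "p * q0 * dim A \<le> p0 * q * dim A" using max[OF assms] pq0 by (intro mult_right_mono) auto
  also have "\<dots> \<le> q0 * dim C * q" using mult_right_mono[OF le, of q] by (simp add: ac_simps)
  finally have "q0 * (p * dim A) \<le> q0 * (dim C * q)" by (simp add: ac_simps)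
  then show ?thesis using q0 by simp
qed

lemma dim_times_C_bound:
  assumes "submod K" "submod K'" "K \<subseteq> K'"
  shows "F.dim (times_C K') * dim A + dim C * F.dim K \<le> F.dim (times_C K) * dim A + dim C * F.dim K'"
proof -
  have "potential (dim C, dim A) K' \<le> potential (dim C, dim A) K"
    by (rule potential_antimono[OF _ assms]) (use slope_le in simp)
  then have "int (F.dim (times_C K') * dim A + dim C * F.dim K) \<le> int (F.dim (times_C K) * dim A + dim C * F.dim K')"
    unfolding potential_def by (simp add: algebra_simps)
  then show ?thesis by (simp only: of_nat_le_iff)
qed

text \<open>
  Let \<open>f\<close> be the tuple of a basis of \<open>A\<^sup>+\<close>, and let \<open>I\<close> and \<open>J\<close> be the annihilators of \<open>f\<close> in \<open>A\<close> and in \<open>C\<close>.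
  The inequality for the cyclic module \<open>fA\<close> bounds \<open>dim J\<close> from above, the inequality for \<open>I\<close> bounds
  \<open>dim IC\<close> from below, and together they give \<open>J = IC\<close>. As \<open>\<Lambda>\<close> lies in \<open>J\<close> and has counit 1, the counit
  does not vanish on \<open>I\<close>.
\<close>

theorem left_integral_exists:
  fixes \<epsilon> :: "'v \<Rightarrow> 'k"
  assumes \<epsilon>_add: "\<And>x y. \<epsilon> (x + y) = \<epsilon> x + \<epsilon> y" and \<epsilon>_scale: "\<And>c x. \<epsilon> (scale c x) = c * \<epsilon> x"
    and \<epsilon>_mult: "\<And>x y. x \<in> C \<Longrightarrow> y \<in> C \<Longrightarrow> \<epsilon> (x \<cdot> y) = \<epsilon> x * \<epsilon> y" and \<epsilon>_e: "\<epsilon> e = 1"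
    and \<Lambda>: "\<Lambda> \<in> C" "\<epsilon> \<Lambda> = 1" "\<And>a. a \<in> A \<Longrightarrow> a \<cdot> \<Lambda> = scale (\<epsilon> a) \<Lambda>"
  shows "\<exists>l\<in>A. \<epsilon> l = 1 \<and> (\<forall>a\<in>A. a \<cdot> l = scale (\<epsilon> a) l)"
proof -
  have \<epsilon>0: "\<epsilon> 0 = 0" using \<epsilon>_scale[of 0 0] by simp
  define Ap where "Ap = {a \<in> A. \<epsilon> a = 0}"
  have Ap: "subspace Ap" unfolding subspace_def Ap_def
    using subspace_0[OF A(1)] subspace_add[OF A(1)] subspace_scale[OF A(1)]
    by (simp add: \<epsilon>0 \<epsilon>_add \<epsilon>_scale)
  have ApA: "Ap \<subseteq> A" unfolding Ap_def by blast
  obtain B where B: "finite B" "B \<subseteq> Ap" "\<not> dependent B" "span B = Ap" "card B = dim Ap"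
    by (rule fin_dim_basis[OF Ap fin_dim_subset[OF A_fin_dim ApA]])
  obtain bs where bs: "set bs = B" using finite_list[OF B(1)] by blast
  define N where "N = length bs"
  define P where "P = point ` A"
  have P: "submod P" unfolding P_def by (rule submod_point) (use A A_mult in auto)
  define f where "f = (\<lambda>w. case w of [] \<Rightarrow> 0 | i # j \<Rightarrow> if i < N then point (bs ! i) j else 0)"
  have f_simps: "f [] = 0" "f (i # j) = (if i < N then point (bs ! i) j else 0)" for i j
    by (auto simp: f_def)
  have bsi: "bs ! i \<in> A" "\<epsilon> (bs ! i) = 0" if "i < N" for i
    using that bs B(2) N_def nth_mem unfolding Ap_def by blast+
  have fP: "f \<in> copies N P"
    unfolding P_def copies_def using bsi by (auto simp: f_simps)
  have PN: "submod (copies N P)" by (rule submod_copies[OF P])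
  have fA: "f \<in> vals A" using submodD(3)[OF PN] fP by blast
  have f0: "rmult f b = 0 \<longleftrightarrow> (\<forall>i<N. bs ! i \<cdot> b = 0)" for b
  proof
    assume *: "rmult f b = 0"
    show "\<forall>i<N. bs ! i \<cdot> b = 0"
    proof (intro allI impI)
      fix i assume "i < N"
      then show "bs ! i \<cdot> b = 0" using fun_cong[OF *, of "[i]"] by (simp add: rmult_def f_simps point_def)
    qed
  next
    assume *: "\<forall>i<N. bs ! i \<cdot> b = 0"
    show "rmult f b = 0"
      by (rule list_fun_eqI) (use * in \<open>auto simp: rmult_def f_simps point_def zero_mult\<close>)
  qed
  define I where "I = {b \<in> A. rmult f b \<in> {0}}"
  define J where "J = {h \<in> C. rmult f h \<in> times_C {0}}"
  have preI: "subspace I" and preJ: "subspace J"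
    unfolding I_def J_def using subspace_inter[OF A(1) subspace_preimage2[OF rmult_linear2 F.subspace_single_0, of f]]
      subspace_inter[OF C(1) subspace_preimage2[OF rmult_linear2 subspace_times_C, of f]]
    by (simp_all add: Collect_conj_eq)
  have IA: "I \<subseteq> A" and JC: "J \<subseteq> C" unfolding I_def J_def by auto
  define PI where "PI = point ` I"
  have PI: "submod PI" unfolding PI_def
  proof (rule submod_point[OF preI IA])
    fix x a assume "x \<in> I" "a \<in> A"
    then show "x \<cdot> a \<in> I"
      unfolding I_def using A_mult rmult_assoc[of f x a] by auto
  qed
  have dI: "F.dim PI = dim I"
    unfolding PI_def by (rule dim_point[OF preI fin_dim_subset[OF A_fin_dim IA]])
  have dP: "F.dim P = dim A" unfolding P_def by (rule dim_point[OF A(1) A_fin_dim])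
  have dPC: "F.dim (times_C P) = dim C" unfolding P_def times_C_point_A by (rule dim_point[OF C])
  define K where "K = adjoin {0} f"
  have K: "submod K" unfolding K_def by (rule submod_adjoin[OF submod_0 fA])
  have dK: "F.dim K + dim I = dim A"
    using dim_adjoin[OF submod_0, of f] unfolding K_def I_def by (simp add: F.dim_zero_space)
  have dKC: "F.dim (times_C K) + dim J = dim C"
    using dim_times_C_adjoin[OF submod_0 fA] unfolding K_def J_def by (simp add: times_C_0 F.dim_zero_space)
  have KP: "K \<subseteq> copies N P" unfolding K_def
    by (rule adjoin_minimal[OF submod_0 PN _ fP]) (simp add: F.subspace_0[OF submodD(1)[OF PN]])
  have dN: "F.dim (copies N P) = N * dim A" "F.dim (times_C (copies N P)) = N * dim C"
    using dim_copies[OF submodD(1,2)[OF P], of N] dim_copies[OF subspace_times_C fin_dim_times_C[OF submodD(1,2)[OF P]], of N]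
    by (simp_all add: times_C_copies[OF submodD(1)[OF P]] dP dPC)
  have "dim C * F.dim K \<le> F.dim (times_C K) * dim A"
    using dim_times_C_bound[OF K PN KP] unfolding dN by (simp add: ac_simps)
  moreover have "PI \<subseteq> P" unfolding PI_def P_def using IA by blast
  then have "dim C * dim I \<le> F.dim (times_C PI) * dim A"
    using dim_times_C_bound[OF PI P] unfolding dP dPC dI by (simp add: ac_simps)
  ultimately have "dim J * dim A \<le> F.dim (times_C PI) * dim A"
  proof -
    assume 1: "dim C * F.dim K \<le> F.dim (times_C K) * dim A" and 2: "dim C * dim I \<le> F.dim (times_C PI) * dim A"
    have "dim C * (F.dim K + dim I) = (F.dim (times_C K) + dim J) * dim A" unfolding dK dKC by simp
    then have "dim C * F.dim K + dim C * dim I = F.dim (times_C K) * dim A + dim J * dim A"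
      by (simp only: add_mult_distrib add_mult_distrib2)
    with 1 2 show ?thesis by linarith
  qed
  then have dJ: "F.dim (point ` J) \<le> F.dim (times_C PI)"
    using dim_pos(1) dim_point[OF preJ fin_dim_subset[OF C(2) JC]] by simp
  have "times_C PI \<subseteq> point ` J"
  proof (rule times_C_minimal[OF subspace_point[OF preJ]])
    fix g h assume "g \<in> PI" and h: "h \<in> C"
    then obtain b where b: "g = point b" "b \<in> I" unfolding PI_def by blast
    have "rmult f (b \<cdot> h) = rmult (rmult f b) h" by (simp add: rmult_assoc)
    then have "b \<cdot> h \<in> J" using b(2) h IA A(2) C_mult unfolding I_def J_def times_C_0 by auto
    then show "rmult g h \<in> point ` J" unfolding b(1) rmult_point by blast
  qed
  then have eq: "times_C PI = point ` J"
    by (rule F.subspace_eq_if_dim_le[OF subspace_point[OF preJ]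
          SF.dim_image_kernel(2)[OF point_linear preJ fin_dim_subset[OF C(2) JC]] subspace_times_C _ dJ])
  have "\<Lambda> \<in> J" unfolding J_def times_C_0 using \<Lambda> bsi by (auto simp: f0)
  then have mem: "point \<Lambda> \<in> times_C PI" unfolding eq by blast
  have "\<exists>b\<in>I. \<epsilon> b \<noteq> 0"
  proof (rule ccontr)
    assume no: "\<not> (\<exists>b\<in>I. \<epsilon> b \<noteq> 0)"
    have "F.subspace {g. \<epsilon> (g []) = 0}" unfolding F.subspace_def by (simp add: \<epsilon>0 \<epsilon>_add \<epsilon>_scale)
    then have "times_C PI \<subseteq> {g. \<epsilon> (g []) = 0}"
    proof (rule times_C_minimal)
      fix g h assume "g \<in> PI" and h: "h \<in> C"
      then obtain b where b: "g = point b" "b \<in> I" unfolding PI_def by blast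
      have "\<epsilon> (b \<cdot> h) = 0" using no b(2) h IA A(2) by (auto simp: \<epsilon>_mult)
      then show "rmult g h \<in> {g. \<epsilon> (g []) = 0}" unfolding b(1) rmult_point by (simp add: point_def)
    qed
    with mem \<Lambda>(2) show False by (auto simp: point_def)
  qed
  then obtain b where b: "b \<in> I" "\<epsilon> b \<noteq> 0" by blast
  have bA: "b \<in> A" and b0: "\<forall>i<N. bs ! i \<cdot> b = 0" using b(1) f0 unfolding I_def by auto
  have lin: "Vector_Spaces.linear scale scale (\<lambda>x. x \<cdot> b)"
    by (simp add: Vector_Spaces.linear_iff vector_space_axioms add_mult scale_mult)
  have "Ap \<subseteq> {x. x \<cdot> b \<in> {0}}" unfolding B(4)[symmetric]
  proof (rule span_minimal)
    show "subspace {x. x \<cdot> b \<in> {0}}"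
      by (rule module_hom.subspace_linear_preimage[OF lin[unfolded linear_iff_module_hom] subspace_single_0])
    show "B \<subseteq> {x. x \<cdot> b \<in> {0}}" unfolding bs[symmetric]
      using b0 by (auto simp: in_set_conv_nth N_def)
  qed
  then have Apb: "x \<cdot> b = 0" if "x \<in> Ap" for x using that by blast
  have ab: "a \<cdot> b = scale (\<epsilon> a) b" if a: "a \<in> A" for a
  proof -
    have 1: "a + scale (- \<epsilon> a) e \<in> A"
      by (rule subspace_add[OF A(1) a subspace_scale[OF A(1) e_A]])
    have 2: "\<epsilon> (a + scale (- \<epsilon> a) e) = 0" unfolding \<epsilon>_add \<epsilon>_scale \<epsilon>_e by simp
    have "(a + scale (- \<epsilon> a) e) \<cdot> b = 0" by (rule Apb) (use 1 2 in \<open>unfold Ap_def, blast\<close>)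
    moreover have "e \<cdot> b = b" using e_left bA A(2) by blast
    ultimately show ?thesis unfolding add_mult scale_mult by simp
  qed
  show ?thesis
  proof (intro bexI[of _ "scale (1 / \<epsilon> b) b"] conjI ballI)
    show "scale (1 / \<epsilon> b) b \<in> A" by (rule subspace_scale[OF A(1) bA])
    show "\<epsilon> (scale (1 / \<epsilon> b) b) = 1" using b(2) by (simp add: \<epsilon>_scale)
    show "a \<cdot> scale (1 / \<epsilon> b) b = scale (\<epsilon> a) (scale (1 / \<epsilon> b) b)" if "a \<in> A" for a
      by (simp add: mult_scale ab[OF that] mult.commute)
  qed
qed

end

section \<open>Formal sums and multilinear forms\<close>

definition extend_form :: "('a \<Rightarrow> 'k::field) \<Rightarrow> ('a \<Rightarrow>\<^sub>0 'k) \<Rightarrow> 'k" where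
  "extend_form g p = (\<Sum>u\<in>Poly_Mapping.keys p. Poly_Mapping.lookup p u * g u)"

lemma extend_form_superset:
  assumes "finite S" "Poly_Mapping.keys p \<subseteq> S"
  shows "extend_form g p = (\<Sum>u\<in>S. Poly_Mapping.lookup p u * g u)"
  unfolding extend_form_def
  by (rule sum.mono_neutral_left[OF assms]) (auto simp: in_keys_iff)

lemma lookup_scale: "Poly_Mapping.lookup (Poly_Mapping.map ((*) c) p) u = c * Poly_Mapping.lookup p u"
  for c :: "'k::field"
  by (simp add: Poly_Mapping.map.rep_eq when_def)

lemma keys_scale: "Poly_Mapping.keys (Poly_Mapping.map ((*) (c::'k::field)) p) \<subseteq> Poly_Mapping.keys p"
  by (auto simp: in_keys_iff lookup_scale)

lemma extend_form_zero [simp]: "extend_form g 0 = 0"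
  by (simp add: extend_form_def)

lemma extend_form_add: "extend_form g (p + q) = extend_form g p + extend_form g q"
proof -
  let ?S = "Poly_Mapping.keys p \<union> Poly_Mapping.keys q"
  have "Poly_Mapping.keys (p + q) \<subseteq> ?S" by (rule keys_add)
  then show ?thesis
    by (simp add: extend_form_superset[of ?S] lookup_add distrib_right sum.distrib)
qed

lemma extend_form_scale: "extend_form g (Poly_Mapping.map ((*) c) p) = c * extend_form g p"
  using extend_form_superset[OF finite_keys keys_scale, of g c p]
  by (simp add: lookup_scale sum_distrib_left extend_form_def mult.assoc)

lemma extend_form_uminus: "extend_form g (- p) = - extend_form g p"
  using extend_form_add[of g p "- p"] by (simp add: eq_neg_iff_add_eq_0 add.commute)

lemma extend_form_diff: "extend_form g (p - q) = extend_form g p - extend_form g q"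
  using extend_form_add[of g p "- q"] by (simp add: extend_form_uminus)

lemma extend_form_single [simp]: "extend_form g (Poly_Mapping.single u c) = c * g u"
  by (simp add: extend_form_def)

lemma extend_form_sum: "extend_form g (\<Sum>i\<in>I. p i) = (\<Sum>i\<in>I. extend_form g (p i))"
  by (induction I rule: infinite_finite_induct) (auto simp: extend_form_add)

lemma extend_form_formal_extend: "extend_form g (formal_extend f p) = extend_form (\<lambda>u. extend_form g (f u)) p"
  unfolding formal_extend_def extend_form_sum extend_form_scale by (simp add: extend_form_def)

definition dual :: "('k::field, 'h, 'm) module_scheme \<Rightarrow> ('h \<Rightarrow> 'k) set" where
  "dual M = {\<phi>. (\<forall>x\<in>carrier M. \<forall>y\<in>carrier M. \<phi> (x \<oplus>\<^bsub>M\<^esub> y) = \<phi> x + \<phi> y) \<and>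
     (\<forall>x\<in>carrier M. \<forall>c. \<phi> (c \<odot>\<^bsub>M\<^esub> x) = c * \<phi> x)}"

definition bilinear_form :: "('k::field, 'h, 'm) module_scheme \<Rightarrow> ('h \<Rightarrow> 'h \<Rightarrow> 'k) \<Rightarrow> bool" where
  "bilinear_form M g \<longleftrightarrow> (\<forall>b\<in>carrier M. (\<lambda>a. g a b) \<in> dual M) \<and> (\<forall>a\<in>carrier M. g a \<in> dual M)"

definition trilinear_form :: "('k::field, 'h, 'm) module_scheme \<Rightarrow> ('h \<Rightarrow> 'h \<Rightarrow> 'h \<Rightarrow> 'k) \<Rightarrow> bool" where
  "trilinear_form M g \<longleftrightarrow> (\<forall>y\<in>carrier M. \<forall>z\<in>carrier M. (\<lambda>x. g x y z) \<in> dual M) \<and>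
     (\<forall>x\<in>carrier M. bilinear_form M (g x))"

lemma dualD:
  assumes "\<phi> \<in> dual M"
  shows "x \<in> carrier M \<Longrightarrow> y \<in> carrier M \<Longrightarrow> \<phi> (x \<oplus>\<^bsub>M\<^esub> y) = \<phi> x + \<phi> y"
    "x \<in> carrier M \<Longrightarrow> \<phi> (c \<odot>\<^bsub>M\<^esub> x) = c * \<phi> x"
  using assms by (auto simp: dual_def)

lemma dualI:
  assumes "\<And>x y. x \<in> carrier M \<Longrightarrow> y \<in> carrier M \<Longrightarrow> \<phi> (x \<oplus>\<^bsub>M\<^esub> y) = \<phi> x + \<phi> y"
    "\<And>c x. x \<in> carrier M \<Longrightarrow> \<phi> (c \<odot>\<^bsub>M\<^esub> x) = c * \<phi> x"
  shows "\<phi> \<in> dual M"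
  using assms by (auto simp: dual_def)

lemma bilinear_formI:
  assumes "\<And>b. b \<in> carrier M \<Longrightarrow> (\<lambda>a. g a b) \<in> dual M" "\<And>a. a \<in> carrier M \<Longrightarrow> (\<lambda>b. g a b) \<in> dual M"
  shows "bilinear_form M g"
  using assms unfolding bilinear_form_def by auto

lemma bilinear_formD:
  assumes "bilinear_form M g"
  shows "b \<in> carrier M \<Longrightarrow> (\<lambda>a. g a b) \<in> dual M" "a \<in> carrier M \<Longrightarrow> g a \<in> dual M"
  using assms unfolding bilinear_form_def by auto

lemma trilinear_formI:
  assumes "\<And>y z. y \<in> carrier M \<Longrightarrow> z \<in> carrier M \<Longrightarrow> (\<lambda>x. g x y z) \<in> dual M"
    "\<And>x z. x \<in> carrier M \<Longrightarrow> z \<in> carrier M \<Longrightarrow> (\<lambda>y. g x y z) \<in> dual M"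
    "\<And>x y. x \<in> carrier M \<Longrightarrow> y \<in> carrier M \<Longrightarrow> (\<lambda>z. g x y z) \<in> dual M"
  shows "trilinear_form M g"
  using assms unfolding trilinear_form_def bilinear_form_def by auto

text \<open>
  Classes in tensor powers are inspected through multilinear forms with values in the field: a form
  sees only the class of a formal sum.
\<close>

lemma extend_form_tensor_null:
  fixes M :: "('k::field, 'h, 'm) module_scheme"
  assumes "bilinear_form M g" "p \<in> tensor_null M"
  shows "extend_form (case_prod g) p = 0"
  using assms(2)
proof induction
  case (add_fst a a' b c)
  with dualD(1)[OF bilinear_formD(1)[OF assms(1), of b], of a a'] show ?case
    by (simp add: extend_form_diff extend_form_add algebra_simps)
next
  case (add_snd a b b' c)
  with dualD(1)[OF bilinear_formD(2)[OF assms(1), of a], of b b'] show ?case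
    by (simp add: extend_form_diff extend_form_add algebra_simps)
next
  case (smult_fst a b d c)
  with dualD(2)[OF bilinear_formD(1)[OF assms(1), of b], of a d] show ?case by (simp add: extend_form_diff)
next
  case (smult_snd a b d c)
  with dualD(2)[OF bilinear_formD(2)[OF assms(1), of a], of b d] show ?case by (simp add: extend_form_diff)
qed (auto simp: extend_form_add)

lemma extend_form_tensor_null3:
  fixes M :: "('k::field, 'h, 'm) module_scheme"
  assumes g: "trilinear_form M g" and "p \<in> tensor_null3 M"
  shows "extend_form (\<lambda>(x, y, z). g x y z) p = 0"
  using assms(2)
proof induction
  case (add_1 x x' y z c)
  then have "(\<lambda>x. g x y z) \<in> dual M" using g by (auto simp: trilinear_form_def)
  from dualD(1)[OF this add_1(1,2)] show ?case by (simp add: extend_form_diff extend_form_add algebra_simps)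
next
  case (add_2 x y y' z c)
  then have "(\<lambda>y. g x y z) \<in> dual M" using g by (auto simp: trilinear_form_def bilinear_form_def)
  from dualD(1)[OF this add_2(2,3)] show ?case by (simp add: extend_form_diff extend_form_add algebra_simps)
next
  case (add_3 x y z z' c)
  then have "(\<lambda>z. g x y z) \<in> dual M" using g by (auto simp: trilinear_form_def bilinear_form_def)
  from dualD(1)[OF this add_3(3,4)] show ?case by (simp add: extend_form_diff extend_form_add algebra_simps)
next
  case (smult_1 x y z d c)
  then have "(\<lambda>x. g x y z) \<in> dual M" using g by (auto simp: trilinear_form_def)
  from dualD(2)[OF this smult_1(1)] show ?case by (simp add: extend_form_diff)
next
  case (smult_2 x y z d c)
  then have "(\<lambda>y. g x y z) \<in> dual M" using g by (auto simp: trilinear_form_def bilinear_form_def)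
  from dualD(2)[OF this smult_2(2)] show ?case by (simp add: extend_form_diff)
next
  case (smult_3 x y z d c)
  then have "(\<lambda>z. g x y z) \<in> dual M" using g by (auto simp: trilinear_form_def bilinear_form_def)
  from dualD(2)[OF this smult_3(3)] show ?case by (simp add: extend_form_diff)
qed (auto simp: extend_form_add)

lemma (in abelian_monoid) additive_finsum:
  fixes \<psi> :: "'a \<Rightarrow> 'k::field"
  assumes "\<And>x y. x \<in> carrier G \<Longrightarrow> y \<in> carrier G \<Longrightarrow> \<psi> (x \<oplus> y) = \<psi> x + \<psi> y" "\<psi> \<zero> = 0"
    "finite I" "f \<in> I \<rightarrow> carrier G"
  shows "\<psi> (\<Oplus>i\<in>I. f i) = (\<Sum>i\<in>I. \<psi> (f i))"
  using assms(3,4)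
proof (induction I rule: finite_induct)
  case (insert i I)
  then have "f \<in> I \<rightarrow> carrier G" "f i \<in> carrier G" by auto
  with insert assms(1) show ?case by (simp add: finsum_closed)
qed (simp add: assms(2))

section \<open>Sweedler calculus\<close>

text \<open>
  The Sweedler sum \<open>\<Sum> g x\<^sub>1 x\<^sub>2\<close> of a scalar-valued form. Elements of \<open>H\<close> are compared through linear
  functionals, so scalar-valued forms suffice for all calculations.
\<close>

definition sweedler_form :: "('k::field, 'h, 'm) hopf_scheme \<Rightarrow> ('h \<Rightarrow> 'h \<Rightarrow> 'k) \<Rightarrow> 'h \<Rightarrow> 'k" where
  "sweedler_form H g x = extend_form (case_prod g) (sweedler H x)"

context hopf_algebra
begin

lemma smult_in [simp, intro]: "x \<in> carrier H \<Longrightarrow> c \<odot> x \<in> carrier H"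
  using smult_closed[of c x] by (simp add: ring_of_type_algebra_def)

lemma smult_simps:
  "x \<in> carrier H \<Longrightarrow> (c + d) \<odot> x = c \<odot> x \<oplus> d \<odot> x"
  "x \<in> carrier H \<Longrightarrow> y \<in> carrier H \<Longrightarrow> c \<odot> (x \<oplus> y) = c \<odot> x \<oplus> c \<odot> y"
  "x \<in> carrier H \<Longrightarrow> (c * d) \<odot> x = c \<odot> (d \<odot> x)"
  "x \<in> carrier H \<Longrightarrow> 1 \<odot> x = x"
  using smult_l_distr[where a = c and b = d and x = x] smult_r_distr[where a = c and x = x and y = y]
    smult_assoc1[where a = c and b = d and x = x] smult_one[where x = x]
  by (simp_all add: ring_of_type_algebra_def)

lemma smult_zero [simp]: "x \<in> carrier H \<Longrightarrow> 0 \<odot> x = \<zero>"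
proof -
  assume x: "x \<in> carrier H"
  then have "0 \<odot> x = 0 \<odot> x \<oplus> 0 \<odot> x" using smult_simps(1)[of x 0 0] by simp
  then show ?thesis using x by (metis smult_in add.r_cancel_one')
qed

lemma smult_minus_one: "x \<in> carrier H \<Longrightarrow> (- 1) \<odot> x = \<ominus> x"
proof -
  assume x: "x \<in> carrier H"
  have "(- 1) \<odot> x \<oplus> x = (- 1 + 1) \<odot> x" using x smult_simps(1)[of x "-1" 1] smult_simps(4)[of x] by simp
  then have "(- 1) \<odot> x \<oplus> x = \<zero>" using x by simp
  then show ?thesis using x by (metis smult_in minus_equality)
qed

abbreviation S :: "'h \<Rightarrow> 'h" where "S \<equiv> antipode H"
abbreviation \<epsilon> :: "'h \<Rightarrow> 'k" where "\<epsilon> \<equiv> counit H"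
abbreviation Sw :: "('h \<Rightarrow> 'h \<Rightarrow> 'k) \<Rightarrow> 'h \<Rightarrow> 'k" where "Sw \<equiv> sweedler_form H"

lemma dual_zero: "\<phi> \<in> dual H \<Longrightarrow> \<phi> \<zero> = 0"
  using dualD(2)[of \<phi> H \<zero> 0] by simp

lemma dual_minus: "\<phi> \<in> dual H \<Longrightarrow> x \<in> carrier H \<Longrightarrow> \<phi> (\<ominus> x) = - \<phi> x"
  using dualD(2)[of \<phi> H x "-1"] smult_minus_one[of x] by simp

lemma dual_finsum:
  "\<phi> \<in> dual H \<Longrightarrow> finite I \<Longrightarrow> f \<in> I \<rightarrow> carrier H \<Longrightarrow> \<phi> (\<Oplus>i\<in>I. f i) = (\<Sum>i\<in>I. \<phi> (f i))"
  by (rule additive_finsum) (auto simp: dualD dual_zero)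

lemma comult_class:
  assumes "x \<in> carrier H"
  obtains p where "comult H x = tensor_class H p" "Poly_Mapping.keys p \<subseteq> carrier H \<times> carrier H"
  using comult_closed[OF assms] unfolding tensor_carrier_def by blast

lemma sweedler_comult:
  assumes "x \<in> carrier H"
  shows "sweedler H x \<in> comult H x" "Poly_Mapping.keys (sweedler H x) \<subseteq> carrier H \<times> carrier H"
proof -
  obtain p where p: "comult H x = tensor_class H p" "Poly_Mapping.keys p \<subseteq> carrier H \<times> carrier H"
    by (rule comult_class[OF assms])
  have "p \<in> comult H x" unfolding p(1) tensor_class_def by (simp add: tensor_null.zero)
  then have "p \<in> comult H x \<and> Poly_Mapping.keys p \<subseteq> carrier H \<times> carrier H" using p(2) by simp
  from someI[of "\<lambda>p. p \<in> comult H x \<and> Poly_Mapping.keys p \<subseteq> carrier H \<times> carrier H", OF this]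
  show "sweedler H x \<in> comult H x" "Poly_Mapping.keys (sweedler H x) \<subseteq> carrier H \<times> carrier H"
    unfolding sweedler_def by auto
qed

lemma extend_form_comult:
  assumes "x \<in> carrier H" "q \<in> comult H x" "bilinear_form H g"
  shows "extend_form (case_prod g) q = Sw g x"
proof -
  obtain p where p: "comult H x = tensor_class H p" by (rule comult_class[OF assms(1)])
  have "extend_form (case_prod g) (r - p) = 0" if "r \<in> comult H x" for r
    by (rule extend_form_tensor_null[OF assms(3)]) (use that p in \<open>simp add: tensor_class_def\<close>)
  from this[OF assms(2)] this[OF sweedler_comult(1)[OF assms(1)]] show ?thesis
    by (simp add: extend_form_diff sweedler_form_def)
qed

lemma sw_class:
  assumes "x \<in> carrier H" "comult H x = tensor_class H p" "bilinear_form H g"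
  shows "Sw g x = extend_form (case_prod g) p"
  using extend_form_comult[OF assms(1) _ assms(3), of p] assms(2)
  by (simp add: tensor_class_def tensor_null.zero)

lemma sw_cong:
  assumes "x \<in> carrier H" "\<And>a b. a \<in> carrier H \<Longrightarrow> b \<in> carrier H \<Longrightarrow> g a b = g' a b"
  shows "Sw g x = Sw g' x"
  unfolding sweedler_form_def extend_form_def
  by (rule sum.cong) (use sweedler_comult(2)[OF assms(1)] assms(2) in auto)

lemma sw_add: "x \<in> carrier H \<Longrightarrow> y \<in> carrier H \<Longrightarrow> bilinear_form H g \<Longrightarrow> Sw g (x \<oplus> y) = Sw g x + Sw g y"
  using sw_class[OF _ comult_add[of x y], of g] by (simp add: extend_form_add sweedler_form_def)

lemma sw_smult: "x \<in> carrier H \<Longrightarrow> bilinear_form H g \<Longrightarrow> Sw g (c \<odot> x) = c * Sw g x"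
  using sw_class[OF _ comult_smult[of x c], of g] by (simp add: extend_form_scale sweedler_form_def)

lemma sw_one: "bilinear_form H g \<Longrightarrow> Sw g \<one> = g \<one> \<one>"
  using sw_class[OF _ comult_one, of g] by simp

lemma sw_mult:
  assumes "x \<in> carrier H" "y \<in> carrier H" "bilinear_form H g"
  shows "Sw g (x \<otimes> y) = Sw (\<lambda>a b. Sw (\<lambda>a' b'. g (a \<otimes> a') (b \<otimes> b')) y) x"
  using sw_class[OF _ comult_mult[OF assms(1,2)] assms(3)] assms(1,2)
  by (simp add: extend_form_formal_extend sweedler_form_def case_prod_beta')

lemma sw_coassoc:
  assumes "x \<in> carrier H" "trilinear_form H g"
  shows "Sw (\<lambda>a b. Sw (\<lambda>p q. g p q b) a) x = Sw (\<lambda>a b. Sw (\<lambda>p q. g a p q) b) x"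
  using extend_form_tensor_null3[OF assms(2) coassoc[OF assms(1)]]
  by (simp add: extend_form_diff extend_form_formal_extend sweedler_form_def case_prod_beta')

lemma sw_swap:
  "Sw (\<lambda>a b. Sw (\<lambda>c d. g a b c d) y) x = Sw (\<lambda>c d. Sw (\<lambda>a b. g a b c d) x) y"
  unfolding sweedler_form_def extend_form_def case_prod_beta'
  by (simp add: sum_distrib_left, subst sum.swap) (simp add: ac_simps)

lemma sw_plus: "Sw (\<lambda>a b. g a b + h a b) x = Sw g x + Sw h x"
  by (simp add: sweedler_form_def extend_form_def case_prod_beta' distrib_left sum.distrib)

lemma sw_cmult: "Sw (\<lambda>a b. c * g a b) x = c * Sw g x" "Sw (\<lambda>a b. g a b * c) x = Sw g x * c"
  by (simp_all add: sweedler_form_def extend_form_def case_prod_beta' sum_distrib_left sum_distrib_right ac_simps)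

lemma sw_sum: "Sw (\<lambda>a b. \<Sum>i\<in>I. g i a b) x = (\<Sum>i\<in>I. Sw (g i) x)"
  unfolding sweedler_form_def extend_form_def case_prod_beta' by (simp add: sum_distrib_left) (rule sum.swap)

lemma sw_zero: "Sw (\<lambda>a b. 0) x = 0"
  by (simp add: sweedler_form_def extend_form_def)

lemma sweedler_sum_closed:
  assumes "x \<in> carrier H" "\<And>a b. a \<in> carrier H \<Longrightarrow> b \<in> carrier H \<Longrightarrow> f a b \<in> carrier H"
  shows "sweedler_sum H f x \<in> carrier H"
  unfolding sweedler_sum_def
  by (rule finsum_closed) (use sweedler_comult(2)[OF assms(1)] assms(2) in auto)

lemma dual_sweedler_sum:
  assumes "\<phi> \<in> dual H" "x \<in> carrier H" "\<And>a b. a \<in> carrier H \<Longrightarrow> b \<in> carrier H \<Longrightarrow> f a b \<in> carrier H"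
  shows "\<phi> (sweedler_sum H f x) = Sw (\<lambda>a b. \<phi> (f a b)) x"
proof -
  have *: "f (fst u) (snd u) \<in> carrier H" if "u \<in> Poly_Mapping.keys (sweedler H x)" for u
    using that sweedler_comult(2)[OF assms(2)] assms(3) by auto
  show ?thesis
    unfolding sweedler_sum_def sweedler_form_def extend_form_def case_prod_beta'
    by (subst dual_finsum[OF assms(1)]) (use * in \<open>auto simp: dualD(2)[OF assms(1)]\<close>)
qed

lemma sw_counit_left: "x \<in> carrier H \<Longrightarrow> \<phi> \<in> dual H \<Longrightarrow> Sw (\<lambda>a b. \<epsilon> a * \<phi> b) x = \<phi> x"
  using dual_sweedler_sum[of \<phi> x "\<lambda>a b. \<epsilon> a \<odot> b"] sw_cong[of x "\<lambda>a b. \<epsilon> a * \<phi> b" "\<lambda>a b. \<phi> (\<epsilon> a \<odot> b)"]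
  by (simp add: counit_left dualD(2))

lemma sw_counit_right: "x \<in> carrier H \<Longrightarrow> \<phi> \<in> dual H \<Longrightarrow> Sw (\<lambda>a b. \<epsilon> b * \<phi> a) x = \<phi> x"
  using dual_sweedler_sum[of \<phi> x "\<lambda>a b. \<epsilon> b \<odot> a"] sw_cong[of x "\<lambda>a b. \<epsilon> b * \<phi> a" "\<lambda>a b. \<phi> (\<epsilon> b \<odot> a)"]
  by (simp add: counit_right dualD(2))

lemma sw_antipode_left: "x \<in> carrier H \<Longrightarrow> \<phi> \<in> dual H \<Longrightarrow> Sw (\<lambda>a b. \<phi> (S a \<otimes> b)) x = \<epsilon> x * \<phi> \<one>"
  using dual_sweedler_sum[of \<phi> x "\<lambda>a b. S a \<otimes> b"] by (simp add: antipode_left antipode_closed dualD(2))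

lemma sw_antipode_right: "x \<in> carrier H \<Longrightarrow> \<phi> \<in> dual H \<Longrightarrow> Sw (\<lambda>a b. \<phi> (a \<otimes> S b)) x = \<epsilon> x * \<phi> \<one>"
  using dual_sweedler_sum[of \<phi> x "\<lambda>a b. a \<otimes> S b"] by (simp add: antipode_right antipode_closed dualD(2))

definition endo :: "('h \<Rightarrow> 'h) set" where
  "endo = {L. (\<forall>x\<in>carrier H. L x \<in> carrier H) \<and>
     (\<forall>x\<in>carrier H. \<forall>y\<in>carrier H. L (x \<oplus> y) = L x \<oplus> L y) \<and> (\<forall>x\<in>carrier H. \<forall>c. L (c \<odot> x) = c \<odot> L x)}"

lemma endoD:
  assumes "L \<in> endo"
  shows "x \<in> carrier H \<Longrightarrow> L x \<in> carrier H"
    "x \<in> carrier H \<Longrightarrow> y \<in> carrier H \<Longrightarrow> L (x \<oplus> y) = L x \<oplus> L y" "x \<in> carrier H \<Longrightarrow> L (c \<odot> x) = c \<odot> L x"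
  using assms by (auto simp: endo_def)

lemma endo_id: "(\<lambda>x. x) \<in> endo" 
  by (simp add: endo_def)

lemma endo_S: "L \<in> endo \<Longrightarrow> (\<lambda>x. S (L x)) \<in> endo"
  by (simp add: endo_def antipode_closed antipode_add antipode_smult)

lemma endo_mult_left: "L \<in> endo \<Longrightarrow> c \<in> carrier H \<Longrightarrow> (\<lambda>x. L x \<otimes> c) \<in> endo"
  and endo_mult_right: "L \<in> endo \<Longrightarrow> c \<in> carrier H \<Longrightarrow> (\<lambda>x. c \<otimes> L x) \<in> endo"
  by (simp_all add: endo_def l_distr r_distr smult_mult_left smult_mult_right)

lemma dual_endo: "\<phi> \<in> dual H \<Longrightarrow> L \<in> endo \<Longrightarrow> (\<lambda>x. \<phi> (L x)) \<in> dual H"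
  by (rule dualI) (simp_all add: endoD dualD)

lemma dual_counit: "L \<in> endo \<Longrightarrow> (\<lambda>x. \<epsilon> (L x)) \<in> dual H"
  by (rule dualI) (simp_all add: endoD counit_add counit_smult)

lemma dual_times_left: "\<phi> \<in> dual H \<Longrightarrow> (\<lambda>x. \<phi> x * c) \<in> dual H"
  and dual_times_right: "\<phi> \<in> dual H \<Longrightarrow> (\<lambda>x. c * \<phi> x) \<in> dual H"
  by (rule dualI; simp add: dualD algebra_simps)+

lemma dual_diff: "\<phi> \<in> dual H \<Longrightarrow> \<psi> \<in> dual H \<Longrightarrow> (\<lambda>x. \<phi> x - \<psi> x) \<in> dual H"
  by (rule dualI) (simp_all add: dualD algebra_simps)

lemma dual_sw:
  assumes "\<And>a b. a \<in> carrier H \<Longrightarrow> b \<in> carrier H \<Longrightarrow> (\<lambda>x. g a b x) \<in> dual H" "y \<in> carrier H"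
  shows "(\<lambda>x. Sw (\<lambda>a b. g a b x) y) \<in> dual H"
proof (rule dualI)
  show "Sw (\<lambda>a b. g a b (x \<oplus> z)) y = Sw (\<lambda>a b. g a b x) y + Sw (\<lambda>a b. g a b z) y"
    if "x \<in> carrier H" "z \<in> carrier H" for x z
    using sw_cong[OF assms(2), of "\<lambda>a b. g a b (x \<oplus> z)" "\<lambda>a b. g a b x + g a b z"]
    by (simp add: dualD(1)[OF assms(1)] that sw_plus)
  show "Sw (\<lambda>a b. g a b (c \<odot> x)) y = c * Sw (\<lambda>a b. g a b x) y" if "x \<in> carrier H" for c x
    using sw_cong[OF assms(2), of "\<lambda>a b. g a b (c \<odot> x)" "\<lambda>a b. c * g a b x"]
    by (simp add: dualD(2)[OF assms(1)] that sw_cmult)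
qed

lemma dual_sw_arg:
  assumes "bilinear_form H g" "L \<in> endo"
  shows "(\<lambda>x. Sw g (L x)) \<in> dual H"
  by (rule dualI) (simp_all add: endoD[OF assms(2)] sw_add[OF _ _ assms(1)] sw_smult[OF _ assms(1)])

text \<open>
  These rules show that a form is multilinear by descending through its term.
\<close>

lemmas multilin_intros = bilinear_formI trilinear_formI dual_sw dual_sw_arg dual_times_left dual_times_right
  dual_counit endo_mult_left endo_mult_right endo_S endo_id m_closed antipode_closed

end

section \<open>Linear functionals and dual frames\<close>

lemma vector_space_formal: "vector_space (\<lambda>(c::'k::field) (p::'a \<Rightarrow>\<^sub>0 'k). Poly_Mapping.map ((*) c) p)"
  by unfold_locales (auto intro!: poly_mapping_eqI simp: lookup_scale lookup_add algebra_simps)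

lemma vector_space_field: "vector_space ((*) :: 'k::field \<Rightarrow> 'k \<Rightarrow> 'k)"
  by unfold_locales (auto simp: algebra_simps)

lemma keys_plus_subset:
  "Poly_Mapping.keys p \<subseteq> U \<Longrightarrow> Poly_Mapping.keys q \<subseteq> U \<Longrightarrow> Poly_Mapping.keys (p + q) \<subseteq> U"
  using keys_add[of p q] by blast

context hopf_algebra
begin

definition subsp :: "'h set \<Rightarrow> bool" where
  "subsp N \<longleftrightarrow> N \<subseteq> carrier H \<and> \<zero> \<in> N \<and> (\<forall>x\<in>N. \<forall>y\<in>N. x \<oplus> y \<in> N) \<and> (\<forall>c. \<forall>x\<in>N. c \<odot> x \<in> N)"

lemma subspD:
  assumes "subsp N"
  shows "N \<subseteq> carrier H" "\<zero> \<in> N" "x \<in> N \<Longrightarrow> y \<in> N \<Longrightarrow> x \<oplus> y \<in> N" "x \<in> N \<Longrightarrow> c \<odot> x \<in> N" "x \<in> N \<Longrightarrow> \<ominus> x \<in> N"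
proof -
  show "x \<in> N \<Longrightarrow> \<ominus> x \<in> N"
    using assms smult_minus_one[of x] unfolding subsp_def by (metis subsetD)
qed (use assms in \<open>auto simp: subsp_def\<close>)

lemma subsp_finsum:
  assumes "subsp N" "finite I" "\<And>i. i \<in> I \<Longrightarrow> f i \<in> N"
  shows "(\<Oplus>i\<in>I. f i) \<in> N"
  using assms(2,3)
proof (induction I rule: finite_induct)
  case (insert i I)
  then have "f \<in> I \<rightarrow> carrier H" "f i \<in> carrier H" using subspD(1)[OF assms(1)] by auto
  with insert show ?case by (simp add: subspD(3)[OF assms(1)])
qed (simp add: subspD(2)[OF assms(1)])

definition ev :: "('h \<Rightarrow>\<^sub>0 'k) \<Rightarrow> 'h" where
  "ev p = (\<Oplus>u\<in>Poly_Mapping.keys p. Poly_Mapping.lookup p u \<odot> u)"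

lemma ev_superset:
  assumes "finite U" "Poly_Mapping.keys p \<subseteq> U" "U \<subseteq> carrier H"
  shows "ev p = (\<Oplus>u\<in>U. Poly_Mapping.lookup p u \<odot> u)"
  unfolding ev_def
  by (rule add.finprod_mono_neutral_cong_left[OF assms(1,2)]) (use assms(3) in \<open>auto simp: in_keys_iff\<close>)

lemma ev_add:
  assumes "Poly_Mapping.keys p \<subseteq> carrier H" "Poly_Mapping.keys q \<subseteq> carrier H"
  shows "ev (p + q) = ev p \<oplus> ev q"
proof -
  let ?U = "Poly_Mapping.keys p \<union> Poly_Mapping.keys q"
  have U: "finite ?U" "?U \<subseteq> carrier H" using assms by auto
  have "ev (p + q) = (\<Oplus>u\<in>?U. Poly_Mapping.lookup p u \<odot> u \<oplus> Poly_Mapping.lookup q u \<odot> u)"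
    unfolding ev_superset[OF U(1) keys_add U(2)]
    by (rule add.finprod_cong') (use U(2) in \<open>auto simp: lookup_add smult_simps(1) intro!: a_closed\<close>)
  also have "\<dots> = (\<Oplus>u\<in>?U. Poly_Mapping.lookup p u \<odot> u) \<oplus> (\<Oplus>u\<in>?U. Poly_Mapping.lookup q u \<odot> u)"
    by (rule finsum_addf) (use U(2) in auto)
  finally show ?thesis using ev_superset[OF U(1) _ U(2)] by simp
qed

lemma ev_single: "x \<in> carrier H \<Longrightarrow> ev (Poly_Mapping.single x c) = c \<odot> x"
  by (cases "c = 0") (simp_all add: ev_def)

lemma finsum_smult:
  assumes "finite I" "f \<in> I \<rightarrow> carrier H" 
  shows "c \<odot> (\<Oplus>i\<in>I. f i) = (\<Oplus>i\<in>I. c \<odot> f i)"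
  using assms
proof (induction I rule: finite_induct)
  case empty
  show ?case using smult_simps(3)[of \<zero> c 0] by simp
next
  case (insert i I)
  then have "f \<in> I \<rightarrow> carrier H" "f i \<in> carrier H" by auto
  with insert show ?case by (simp add: smult_simps(2) Pi_def)
qed

lemma ev_scale:
  assumes "Poly_Mapping.keys p \<subseteq> carrier H"
  shows "ev (Poly_Mapping.map ((*) c) p) = c \<odot> ev p"
proof -
  have "ev (Poly_Mapping.map ((*) c) p) = (\<Oplus>u\<in>Poly_Mapping.keys p. c \<odot> (Poly_Mapping.lookup p u \<odot> u))"
    unfolding ev_superset[OF finite_keys keys_scale assms]
    by (rule add.finprod_cong') (use assms in \<open>auto simp: lookup_scale smult_simps(3)\<close>)
  also have "\<dots> = c \<odot> ev p"
    unfolding ev_def by (rule finsum_smult[symmetric]) (use assms in auto)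
  finally show ?thesis .
qed

text \<open>
  The module \<open>H\<close> is a quotient of the vector space of formal sums. A functional on formal sums descends
  to \<open>H\<close> and vanishes on \<open>N\<close> if it is zero on all sums whose value lies in \<open>N\<close>.
\<close>

lemma dual_separates_subsp:
  assumes N: "subsp N" and x: "x \<in> carrier H" "x \<notin> N"
  shows "\<exists>\<phi>\<in>dual H. (\<forall>n\<in>N. \<phi> n = 0) \<and> \<phi> x = 1"
proof -
  let ?s = "\<lambda>(c::'k) (p::'h \<Rightarrow>\<^sub>0 'k). Poly_Mapping.map ((*) c) p"
  interpret P: vector_space ?s by (rule vector_space_formal)
  interpret K: vector_space "(*) :: 'k \<Rightarrow> 'k \<Rightarrow> 'k" by (rule vector_space_field)
  interpret PK: vector_space_pair ?s "(*)" by unfold_locales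
  define Z where "Z = {p. Poly_Mapping.keys p \<subseteq> carrier H \<and> ev p \<in> N}"
  have Z: "P.subspace Z"
  proof (rule P.subspaceI)
    show "0 \<in> Z" by (simp add: Z_def ev_def subspD(2)[OF N])
    show "p + q \<in> Z" if "p \<in> Z" "q \<in> Z" for p q
      using that keys_add[of p q] by (auto simp: Z_def ev_add subspD(3)[OF N])
    show "?s c p \<in> Z" if "p \<in> Z" for c p
      using that keys_scale[of c p] by (auto simp: Z_def ev_scale subspD(4)[OF N])
  qed
  obtain B where B: "B \<subseteq> Z" "\<not> P.dependent B" "Z \<subseteq> P.span B"
    using P.maximal_independent_subset[of Z] by metis
  have sB: "P.span B = Z" by (rule P.span_subspace[OF B(1,3) Z])
  let ?x = "Poly_Mapping.single x (1::'k)"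
  have "?x \<notin> Z" using x by (simp add: Z_def ev_single smult_simps(4))
  then have "\<not> P.dependent (insert ?x B)" using P.independent_insertI[of ?x B] B(2) sB by simp
  from PK.linear_independent_extend[OF this, of "\<lambda>p. if p = ?x then 1 else 0"]
  obtain g where g: "Vector_Spaces.linear ?s (*) g" "\<forall>p\<in>insert ?x B. g p = (if p = ?x then 1 else 0)"
    by auto
  interpret g: Vector_Spaces.linear ?s "(*)" g by (rule g(1))
  have gB: "g p = 0" if "p \<in> B" for p
  proof -
    have "p \<noteq> ?x" using that B(1) \<open>?x \<notin> Z\<close> by auto
    then show ?thesis using g(2) that by simp
  qed
  have gZ: "g p = 0" if "p \<in> Z" for p
    by (rule g.eq_0_on_span[of B]) (use gB that sB in auto)
  define \<phi> where "\<phi> h = g (Poly_Mapping.single h 1)" for h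
  have "\<phi> \<in> dual H"
  proof (rule dualI)
    fix a b assume ab: "a \<in> carrier H" "b \<in> carrier H"
    let ?p = "Poly_Mapping.single (a \<oplus> b) (1::'k) + (Poly_Mapping.single a (-1) + Poly_Mapping.single b (-1))"
    have "Poly_Mapping.keys ?p \<subseteq> carrier H"
      using ab by (intro keys_plus_subset) (auto split: if_splits)
    moreover have "ev ?p = \<zero>"
    proof -
      have k: "Poly_Mapping.keys (Poly_Mapping.single a (-1::'k) + Poly_Mapping.single b (-1)) \<subseteq> carrier H"
        using ab by (intro keys_plus_subset) (auto split: if_splits)
      have "ev ?p = 1 \<odot> (a \<oplus> b) \<oplus> ((-1) \<odot> a \<oplus> (-1) \<odot> b)"
        using ab k by (simp add: ev_add ev_single)
      also have "\<dots> = \<zero>" using ab by (simp add: smult_simps(4) smult_minus_one minus_add[symmetric] r_neg)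
      finally show ?thesis .
    qed
    ultimately have "g ?p = 0" by (intro gZ) (simp add: Z_def subspD(2)[OF N])
    then have "g (Poly_Mapping.single (a \<oplus> b) 1) + (g (- Poly_Mapping.single a 1) + g (- Poly_Mapping.single b 1)) = 0"
      by (simp only: g.add single_uminus)
    then show "\<phi> (a \<oplus> b) = \<phi> a + \<phi> b" unfolding \<phi>_def g.neg by (simp add: algebra_simps)
  next
    fix c a assume a: "a \<in> carrier H"
    let ?p = "Poly_Mapping.single (c \<odot> a) (1::'k) + Poly_Mapping.single a (-c)"
    have "Poly_Mapping.keys ?p \<subseteq> carrier H"
      using a by (intro keys_plus_subset) (auto split: if_splits)
    moreover have "ev ?p = \<zero>"
    proof -
      have "ev ?p = 1 \<odot> (c \<odot> a) \<oplus> (-c) \<odot> a" using a by (simp add: ev_add ev_single)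
      also have "\<dots> = (c + (-c)) \<odot> a" using a by (simp only: smult_simps smult_in)
      finally show ?thesis using a by simp
    qed
    ultimately have "g ?p = 0" by (intro gZ) (simp add: Z_def subspD(2)[OF N])
    moreover have "Poly_Mapping.single a (-c) = ?s (-c) (Poly_Mapping.single a 1)"
      by (rule poly_mapping_eqI) (simp add: lookup_scale lookup_single when_def)
    ultimately have "g (Poly_Mapping.single (c \<odot> a) 1) + (-c) * g (Poly_Mapping.single a 1) = 0"
      by (simp only: g.add g.scale)
    then show "\<phi> (c \<odot> a) = c * \<phi> a" unfolding \<phi>_def by simp
  qed
  moreover have "\<phi> n = 0" if "n \<in> N" for n
    unfolding \<phi>_def by (rule gZ) (use that subspD(1)[OF N] in \<open>auto simp: Z_def ev_single smult_simps(4)\<close>)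
  moreover have "\<phi> x = 1" unfolding \<phi>_def using g(2) by simp
  ultimately show ?thesis by blast
qed

lemma subsp_zero: "subsp {\<zero>}"
  using smult_simps(3)[of \<zero> _ 0] by (auto simp: subsp_def)

lemma dual_eqI:
  assumes "x \<in> carrier H" "y \<in> carrier H" "\<And>\<phi>. \<phi> \<in> dual H \<Longrightarrow> \<phi> x = \<phi> y"
  shows "x = y"
proof (rule ccontr)
  assume "x \<noteq> y"
  then have "x \<ominus> y \<notin> {\<zero>}" using assms(1,2) by (simp add: r_right_minus_eq)
  then obtain \<phi> where "\<phi> \<in> dual H" "\<phi> (x \<ominus> y) = 1"
    using dual_separates_subsp[OF subsp_zero, of "x \<ominus> y"] assms(1,2) by auto
  then show False using assms(1,2) assms(3)[of \<phi>] by (simp add: minus_eq dualD dual_minus)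
qed

text \<open>
  The partial coproduct \<open>\<Sum> \<phi>(x\<^sub>1) x\<^sub>2\<close>. A subspace is a left coideal when it is stable under these
  maps for all functionals.
\<close>

definition delta :: "('h \<Rightarrow> 'k) \<Rightarrow> 'h \<Rightarrow> 'h" where
  "delta \<phi> x = sweedler_sum H (\<lambda>a b. \<phi> a \<odot> b) x"

lemma delta_closed [simp]: "x \<in> carrier H \<Longrightarrow> delta \<phi> x \<in> carrier H"
  unfolding delta_def by (rule sweedler_sum_closed) auto

lemma dual_delta: "\<psi> \<in> dual H \<Longrightarrow> x \<in> carrier H \<Longrightarrow> \<psi> (delta \<phi> x) = Sw (\<lambda>a b. \<phi> a * \<psi> b) x"
  unfolding delta_def
  by (subst dual_sweedler_sum) (auto intro!: sw_cong simp: dualD(2))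

lemma bilinear_mult: "\<phi> \<in> dual H \<Longrightarrow> \<psi> \<in> dual H \<Longrightarrow> bilinear_form H (\<lambda>a b. \<phi> a * \<psi> b)"
  by (intro bilinear_formI dual_times_left dual_times_right)

lemma endo_delta: "\<phi> \<in> dual H \<Longrightarrow> delta \<phi> \<in> endo"
  unfolding endo_def
  by (auto intro!: dual_eqI simp: dual_delta dualD sw_add sw_smult bilinear_mult)

definition frame :: "nat \<Rightarrow> (nat \<Rightarrow> 'h) \<Rightarrow> (nat \<Rightarrow> 'h \<Rightarrow> 'k) \<Rightarrow> bool" where
  "frame n u f \<longleftrightarrow> (\<forall>i<n. u i \<in> carrier H \<and> f i \<in> dual H) \<and>
     (\<forall>i<n. \<forall>l<n. f i (u l) = (if i = l then 1 else 0))"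

definition frame_span :: "nat \<Rightarrow> (nat \<Rightarrow> 'h) \<Rightarrow> (nat \<Rightarrow> 'h \<Rightarrow> 'k) \<Rightarrow> 'h set" where
  "frame_span n u f = {a \<in> carrier H. \<forall>\<phi>\<in>dual H. \<phi> a = (\<Sum>i<n. f i a * \<phi> (u i))}"

lemma frameD:
  assumes "frame n u f" "i < n"
  shows "u i \<in> carrier H" "f i \<in> dual H" "l < n \<Longrightarrow> f i (u l) = (if i = l then 1 else 0)"
  using assms by (auto simp: frame_def)

lemma frame_spanD: "a \<in> frame_span n u f \<Longrightarrow> \<phi> \<in> dual H \<Longrightarrow> \<phi> a = (\<Sum>i<n. f i a * \<phi> (u i))"
  by (auto simp: frame_span_def)

lemma subsp_frame_span:
  assumes "frame n u f" shows "subsp (frame_span n u f)"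
  unfolding subsp_def frame_span_def
  by (auto simp: dual_zero frameD[OF assms] dualD sum.distrib sum_distrib_left algebra_simps)

lemma frame_frame_span:
  assumes "frame n u f" "l < n" shows "u l \<in> frame_span n u f"
proof -
  have "(\<Sum>i<n. f i (u l) * \<phi> (u i)) = \<phi> (u l)" for \<phi>
  proof -
    have "(\<Sum>i<n. f i (u l) * \<phi> (u i)) = (\<Sum>i<n. if i = l then \<phi> (u i) else 0)"
      by (rule sum.cong) (use assms in \<open>auto simp: frameD\<close>)
    then show ?thesis using assms(2) by (simp add: sum.delta)
  qed
  then show ?thesis using frameD[OF assms] by (simp add: frame_span_def)
qed

text \<open>
  A vector outside the span of a frame is separated from the span by a functional. It joins the frame
  together with this functional, by which the older functionals are corrected to vanish on it.
\<close>

lemma frame_exists: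
  assumes "finite U" "U \<subseteq> carrier H"
  shows "\<exists>n u f. frame n u f \<and> U \<subseteq> frame_span n u f"
  using assms
proof (induction U rule: finite_induct)
  case empty
  have "frame 0 undefined undefined" by (simp add: frame_def)
  then show ?case by blast
next
  case (insert x U)
  then obtain n u f where F: "frame n u f" "U \<subseteq> frame_span n u f" by auto
  show ?case
  proof (cases "x \<in> frame_span n u f")
    case False
    then obtain \<phi> where \<phi>: "\<phi> \<in> dual H" "\<forall>a\<in>frame_span n u f. \<phi> a = 0" "\<phi> x = 1"
      using dual_separates_subsp[OF subsp_frame_span[OF F(1)]] insert.prems by blast
    define u' where "u' = u(n := x)"
    define f' where "f' i = (if i = n then \<phi> else (\<lambda>a. f i a - f i x * \<phi> a))" for i
    have \<phi>u: "\<phi> (u i) = 0" if "i < n" for i using \<phi>(2) frame_frame_span[OF F(1) that] by blast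
    have "frame (Suc n) u' f'"
      unfolding frame_def u'_def f'_def using F(1) \<phi> insert.prems \<phi>u
      by (auto simp: less_Suc_eq frameD intro!: dual_diff dual_times_right)
    moreover have "insert x U \<subseteq> frame_span (Suc n) u' f'"
    proof
      fix a assume a: "a \<in> insert x U"
      have sum: "(\<Sum>i<Suc n. f' i a * \<psi> (u' i)) = (\<Sum>i<n. (f i a - f i x * \<phi> a) * \<psi> (u i)) + \<phi> a * \<psi> x" for \<psi>
        by (simp add: f'_def u'_def)
      show "a \<in> frame_span (Suc n) u' f'"
      proof (cases "a = x")
        case True
        then show ?thesis using insert.prems sum \<phi>(3) by (simp add: frame_span_def)
      next
        case False
        then have "a \<in> frame_span n u f" using a F(2) by blast
        then show ?thesis unfolding frame_span_def using sum \<phi>(2) by (simp add: frame_span_def)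
      qed
    qed
    ultimately show ?thesis by blast
  qed (use F in blast)
qed

text \<open>
  The left legs of the coproduct are expanded in a frame.
\<close>

lemma sw_expand:
  assumes F: "frame n u f" and x: "x \<in> carrier H" and g: "bilinear_form H g"
    and k: "fst ` Poly_Mapping.keys (sweedler H x) \<subseteq> frame_span n u f"
  shows "Sw g x = (\<Sum>i<n. g (u i) (delta (f i) x))"
proof -
  have "Sw g x = Sw (\<lambda>a b. \<Sum>i<n. f i a * g (u i) b) x"
    unfolding sweedler_form_def extend_form_def
  proof (rule sum.cong[OF refl])
    fix p assume p: "p \<in> Poly_Mapping.keys (sweedler H x)"
    obtain a b where ab: "p = (a, b)" by (cases p)
    have "fst p \<in> frame_span n u f" using p k by blast
    moreover have "p \<in> carrier H \<times> carrier H" using p sweedler_comult(2)[OF x] by blast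
    ultimately have "b \<in> carrier H" "a \<in> frame_span n u f" using ab by auto
    from frame_spanD[OF this(2) bilinear_formD(1)[OF g this(1)]]
    show "Poly_Mapping.lookup (sweedler H x) p * (case p of (a, b) \<Rightarrow> g a b) =
        Poly_Mapping.lookup (sweedler H x) p * (case p of (a, b) \<Rightarrow> \<Sum>i<n. f i a * g (u i) b)"
      by (simp add: ab)
  qed
  also have "\<dots> = (\<Sum>i<n. g (u i) (delta (f i) x))"
    unfolding sw_sum by (rule sum.cong) (auto simp: dual_delta x bilinear_formD[OF g] frameD[OF F])
  finally show ?thesis .
qed

lemma sw_expand_exists:
  assumes x: "x \<in> carrier H"
  shows "\<exists>n u f. frame n u f \<and> (\<forall>g. bilinear_form H g \<longrightarrow> Sw g x = (\<Sum>i<n. g (u i) (delta (f i) x)))"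
proof -
  have "finite (fst ` Poly_Mapping.keys (sweedler H x))" "fst ` Poly_Mapping.keys (sweedler H x) \<subseteq> carrier H"
    using sweedler_comult(2)[OF x] by auto
  from frame_exists[OF this] obtain n u f
    where F: "frame n u f" "fst ` Poly_Mapping.keys (sweedler H x) \<subseteq> frame_span n u f"
    by blast
  with sw_expand[OF F(1) x _ F(2)] show ?thesis by blast
qed

end

context hopf_algebra
begin

lemma dual_bil1: "bilinear_form H g \<Longrightarrow> L \<in> endo \<Longrightarrow> y \<in> carrier H \<Longrightarrow> (\<lambda>x. g (L x) y) \<in> dual H"
  using dual_endo[OF bilinear_formD(1)] by blast

lemma dual_bil2: "bilinear_form H g \<Longrightarrow> L \<in> endo \<Longrightarrow> y \<in> carrier H \<Longrightarrow> (\<lambda>x. g y (L x)) \<in> dual H"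
  using dual_endo[OF bilinear_formD(2)] by blast

lemma antipode_one: "S \<one> = \<one>"
proof (rule dual_eqI)
  fix \<phi> assume \<phi>: "\<phi> \<in> dual H"
  have "bilinear_form H (\<lambda>a b. \<phi> (S a \<otimes> b))"
    by (intro multilin_intros dual_endo[OF \<phi>])
  from sw_one[OF this] sw_antipode_left[OF one_closed \<phi>] show "\<phi> (S \<one>) = \<phi> \<one>"
    by (simp add: counit_one antipode_closed)
qed (simp_all add: antipode_closed)

text \<open>
  Both sides are values of \<open>\<Sum> S(y\<^sub>1) S(x\<^sub>1) x\<^sub>2 y\<^sub>2 S(x\<^sub>3 y\<^sub>3)\<close>: the antipode cancels either
  on the first two legs of \<open>x\<close> and of \<open>y\<close>, or on the last two legs of their product.
\<close>

lemma antipode_mult: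
  assumes x: "x \<in> carrier H" and y: "y \<in> carrier H"
  shows "S (x \<otimes> y) = S y \<otimes> S x"
proof (rule dual_eqI)
  fix \<phi> assume \<phi>: "\<phi> \<in> dual H"
  note [simp] = antipode_closed x y
  note lin = multilin_intros dual_endo[OF \<phi>]
  define G where "G x1 x2 x3 y1 y2 y3 = \<phi> (S y1 \<otimes> (S x1 \<otimes> (x2 \<otimes> (y2 \<otimes> S (x3 \<otimes> y3)))))" for x1 x2 x3 y1 y2 y3
  have "Sw (\<lambda>x' x3. Sw (\<lambda>x1 x2. Sw (\<lambda>y' y3. Sw (\<lambda>y1 y2. G x1 x2 x3 y1 y2 y3) y') y) x') x = \<phi> (S (x \<otimes> y))"
  proof -
    have "Sw (\<lambda>x1 x2. Sw (\<lambda>y' y3. Sw (\<lambda>y1 y2. G x1 x2 x3 y1 y2 y3) y') y) x' = \<epsilon> x' * \<phi> (S (x3 \<otimes> y))"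
      if [simp]: "x' \<in> carrier H" "x3 \<in> carrier H" for x' x3
    proof -
      have "Sw (\<lambda>x1 x2. Sw (\<lambda>y' y3. Sw (\<lambda>y1 y2. G x1 x2 x3 y1 y2 y3) y') y) x'
          = Sw (\<lambda>y' y3. Sw (\<lambda>x1 x2. Sw (\<lambda>y1 y2. G x1 x2 x3 y1 y2 y3) y') x') y"
        by (rule sw_swap)
      also have "\<dots> = Sw (\<lambda>y' y3. Sw (\<lambda>y1 y2. Sw (\<lambda>x1 x2. G x1 x2 x3 y1 y2 y3) x') y') y"
        by (rule sw_cong[OF y]) (rule sw_swap)
      also have "\<dots> = Sw (\<lambda>y' y3. \<epsilon> y' * (\<epsilon> x' * \<phi> (S (x3 \<otimes> y3)))) y"
      proof (rule sw_cong[OF y])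
        fix y' y3 assume [simp]: "y' \<in> carrier H" "y3 \<in> carrier H"
        have "Sw (\<lambda>x1 x2. G x1 x2 x3 y1 y2 y3) x' = \<epsilon> x' * \<phi> (S y1 \<otimes> y2 \<otimes> S (x3 \<otimes> y3))"
          if [simp]: "y1 \<in> carrier H" "y2 \<in> carrier H" for y1 y2
        proof -
          have "(\<lambda>z. \<phi> (S y1 \<otimes> (z \<otimes> (y2 \<otimes> S (x3 \<otimes> y3))))) \<in> dual H"
            by (intro lin; simp)
          from sw_antipode_left[OF _ this, of x']
          have "Sw (\<lambda>a b. \<phi> (S y1 \<otimes> ((S a \<otimes> b) \<otimes> (y2 \<otimes> S (x3 \<otimes> y3))))) x' = \<epsilon> x' * \<phi> (S y1 \<otimes> y2 \<otimes> S (x3 \<otimes> y3))"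
            by (simp add: m_assoc)
          moreover have "Sw (\<lambda>x1 x2. G x1 x2 x3 y1 y2 y3) x' = Sw (\<lambda>a b. \<phi> (S y1 \<otimes> ((S a \<otimes> b) \<otimes> (y2 \<otimes> S (x3 \<otimes> y3))))) x'"
            unfolding G_def by (rule sw_cong) (simp_all add: m_assoc)
          ultimately show ?thesis by simp
        qed
        then have "Sw (\<lambda>y1 y2. Sw (\<lambda>x1 x2. G x1 x2 x3 y1 y2 y3) x') y' = Sw (\<lambda>y1 y2. \<epsilon> x' * \<phi> (S y1 \<otimes> y2 \<otimes> S (x3 \<otimes> y3))) y'"
          by (intro sw_cong) auto
        also have "\<dots> = \<epsilon> x' * (\<epsilon> y' * \<phi> (S (x3 \<otimes> y3)))"
        proof -
          have "(\<lambda>z. \<phi> (z \<otimes> S (x3 \<otimes> y3))) \<in> dual H" by (intro lin; simp)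
          from sw_antipode_left[OF _ this, of y'] show ?thesis by (simp add: sw_cmult)
        qed
        finally show "Sw (\<lambda>y1 y2. Sw (\<lambda>x1 x2. G x1 x2 x3 y1 y2 y3) x') y' = \<epsilon> y' * (\<epsilon> x' * \<phi> (S (x3 \<otimes> y3)))"
          by simp
      qed
      also have "\<dots> = \<epsilon> x' * \<phi> (S (x3 \<otimes> y))"
        by (rule sw_counit_left[OF y]) (intro lin; simp)
      finally show ?thesis .
    qed
    then have "Sw (\<lambda>x' x3. Sw (\<lambda>x1 x2. Sw (\<lambda>y' y3. Sw (\<lambda>y1 y2. G x1 x2 x3 y1 y2 y3) y') y) x') x
        = Sw (\<lambda>x' x3. \<epsilon> x' * \<phi> (S (x3 \<otimes> y))) x" by (intro sw_cong) auto
    also have "\<dots> = \<phi> (S (x \<otimes> y))" by (rule sw_counit_left[OF x]) (intro lin; simp)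
    finally show ?thesis .
  qed
  moreover have "Sw (\<lambda>x' x3. Sw (\<lambda>x1 x2. Sw (\<lambda>y' y3. Sw (\<lambda>y1 y2. G x1 x2 x3 y1 y2 y3) y') y) x') x = \<phi> (S y \<otimes> S x)"
  proof -
    have "Sw (\<lambda>x' x3. Sw (\<lambda>x1 x2. Sw (\<lambda>y' y3. Sw (\<lambda>y1 y2. G x1 x2 x3 y1 y2 y3) y') y) x') x
        = Sw (\<lambda>x1 x'. Sw (\<lambda>x2 x3. Sw (\<lambda>y' y3. Sw (\<lambda>y1 y2. G x1 x2 x3 y1 y2 y3) y') y) x') x"
      by (rule sw_coassoc[OF x]) (unfold G_def, intro lin; simp)
    also have "\<dots> = Sw (\<lambda>x1 x'. \<epsilon> x' * \<phi> (S y \<otimes> S x1)) x"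
    proof (rule sw_cong[OF x])
      fix x1 x' assume [simp]: "x1 \<in> carrier H" "x' \<in> carrier H"
      have "Sw (\<lambda>x2 x3. Sw (\<lambda>y' y3. Sw (\<lambda>y1 y2. G x1 x2 x3 y1 y2 y3) y') y) x'
          = Sw (\<lambda>x2 x3. Sw (\<lambda>y1 y'. Sw (\<lambda>y2 y3. G x1 x2 x3 y1 y2 y3) y') y) x'"
        by (rule sw_cong, simp, rule sw_coassoc[OF y]) (unfold G_def, intro lin; simp)
      also have "\<dots> = Sw (\<lambda>y1 y'. Sw (\<lambda>x2 x3. Sw (\<lambda>y2 y3. G x1 x2 x3 y1 y2 y3) y') x') y"
        by (rule sw_swap)
      also have "\<dots> = Sw (\<lambda>y1 y'. \<epsilon> y' * (\<epsilon> x' * \<phi> (S y1 \<otimes> S x1))) y"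
      proof (rule sw_cong[OF y])
        fix y1 y' assume [simp]: "y1 \<in> carrier H" "y' \<in> carrier H"
        have lf: "(\<lambda>z. \<phi> (S y1 \<otimes> (S x1 \<otimes> z))) \<in> dual H" by (intro lin; simp)
        have bl: "bilinear_form H (\<lambda>a b. \<phi> (S y1 \<otimes> (S x1 \<otimes> (a \<otimes> S b))))" by (intro lin; simp)
        have "Sw (\<lambda>x2 x3. Sw (\<lambda>y2 y3. G x1 x2 x3 y1 y2 y3) y') x'
            = Sw (\<lambda>x2 x3. Sw (\<lambda>y2 y3. \<phi> (S y1 \<otimes> (S x1 \<otimes> ((x2 \<otimes> y2) \<otimes> S (x3 \<otimes> y3))))) y') x'"
          unfolding G_def by (intro sw_cong) (auto simp: m_assoc)
        also have "\<dots> = Sw (\<lambda>a b. \<phi> (S y1 \<otimes> (S x1 \<otimes> (a \<otimes> S b)))) (x' \<otimes> y')"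
          by (rule sw_mult[symmetric, OF _ _ bl]) simp_all
        also have "\<dots> = \<epsilon> (x' \<otimes> y') * \<phi> (S y1 \<otimes> (S x1 \<otimes> \<one>))"
          by (rule sw_antipode_right[OF _ lf]) simp
        finally show "Sw (\<lambda>x2 x3. Sw (\<lambda>y2 y3. G x1 x2 x3 y1 y2 y3) y') x' = \<epsilon> y' * (\<epsilon> x' * \<phi> (S y1 \<otimes> S x1))"
          by (simp add: counit_mult)
      qed
      also have "\<dots> = \<epsilon> x' * \<phi> (S y \<otimes> S x1)"
        by (rule sw_counit_right[OF y]) (intro lin; simp)
      finally show "Sw (\<lambda>x2 x3. Sw (\<lambda>y' y3. Sw (\<lambda>y1 y2. G x1 x2 x3 y1 y2 y3) y') y) x' = \<epsilon> x' * \<phi> (S y \<otimes> S x1)" .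
    qed
    also have "\<dots> = \<phi> (S y \<otimes> S x)"
      by (rule sw_counit_right[OF x]) (intro lin; simp)
    finally show ?thesis .
  qed
  ultimately show "\<phi> (S (x \<otimes> y)) = \<phi> (S y \<otimes> S x)" by simp
qed (simp_all add: antipode_closed x y)

end

section \<open>Integrals of semisimple Hopf algebras\<close>

locale semisimple_hopf = hopf_algebra H for H :: "('k::field, 'h, 'm) hopf_scheme" (structure) +
  assumes semisimple: "semisimple_ring H"
begin

lemma left_idealI:
  assumes "I \<subseteq> carrier H" "\<zero> \<in> I" "\<And>x y. x \<in> I \<Longrightarrow> y \<in> I \<Longrightarrow> x \<oplus> y \<in> I"
    "\<And>r x. r \<in> carrier H \<Longrightarrow> x \<in> I \<Longrightarrow> r \<otimes> x \<in> I"
  shows "left_ideal I H"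
proof -
  have "\<ominus> x \<in> I" if "x \<in> I" for x
  proof -
    have x: "x \<in> carrier H" using that assms(1) by blast
    have "\<ominus> x = (\<ominus> \<one>) \<otimes> x" using x by (simp add: l_minus)
    then show ?thesis using assms(4)[of "\<ominus> \<one>" x] that by simp
  qed
  then have "additive_subgroup I H"
    using assms by (intro additive_subgroup.intro subgroup.intro) (auto simp flip: a_inv_def)
  then show ?thesis unfolding left_ideal_def using assms(4) by blast
qed

lemma left_ideal_complement:
  assumes "left_ideal I H"
  obtains J where "left_ideal J H" "I \<inter> J = {\<zero>}"
    "\<exists>i\<in>I. \<exists>j\<in>J. \<one> = i \<oplus> j"
proof -
  obtain J where J: "left_ideal J H" "I \<inter> J = {\<zero>}" "I <+> J = carrier H"
    using semisimple assms unfolding semisimple_ring_def by blast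
  have "\<one> \<in> I <+> J" unfolding J(3) by simp
  then have "\<exists>i\<in>I. \<exists>j\<in>J. \<one> = i \<oplus> j" unfolding set_add_def' by blast
  with J that show ?thesis by blast
qed

lemma left_idealD:
  assumes "left_ideal I H"
  shows "x \<in> I \<Longrightarrow> x \<in> carrier H" "x \<in> I \<Longrightarrow> y \<in> I \<Longrightarrow> x \<oplus> y \<in> I" "x \<in> I \<Longrightarrow> y \<in> I \<Longrightarrow> x \<ominus> y \<in> I"
    "r \<in> carrier H \<Longrightarrow> x \<in> I \<Longrightarrow> r \<otimes> x \<in> I"
proof -
  interpret additive_subgroup I H using assms by (simp add: left_ideal_def)
  show "x \<in> I \<Longrightarrow> x \<in> carrier H" using a_subset by blast
  show "x \<in> I \<Longrightarrow> y \<in> I \<Longrightarrow> x \<oplus> y \<in> I" by (rule a_closed)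
  show "x \<in> I \<Longrightarrow> y \<in> I \<Longrightarrow> x \<ominus> y \<in> I" by (simp add: minus_eq)
  show "r \<in> carrier H \<Longrightarrow> x \<in> I \<Longrightarrow> r \<otimes> x \<in> I" using assms by (simp add: left_ideal_def)
qed

text \<open>
  The left ideal \<open>Hy\<close> is a direct summand, so it has an idempotent generator \<open>hy\<close> and \<open>y = yhy\<close>.
\<close>

lemma semiprime:
  assumes y: "y \<in> carrier H" and nil: "\<And>h. h \<in> carrier H \<Longrightarrow> y \<otimes> h \<otimes> y = \<zero>"
  shows "y = \<zero>"
proof -
  define I where "I = (\<lambda>h. h \<otimes> y) ` carrier H"
  have "left_ideal I H"
  proof (rule left_idealI)
    show "\<zero> \<in> I" unfolding I_def using y by (intro image_eqI[of _ _ \<zero>]) auto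
    show "u \<oplus> v \<in> I" if uv: "u \<in> I" "v \<in> I" for u v
    proof -
      obtain a b where "u = a \<otimes> y" "v = b \<otimes> y" "a \<in> carrier H" "b \<in> carrier H" using uv unfolding I_def by blast
      then have "u \<oplus> v = (a \<oplus> b) \<otimes> y" "a \<oplus> b \<in> carrier H" using y by (auto simp: l_distr)
      then show ?thesis unfolding I_def by blast
    qed
    show "r \<otimes> u \<in> I" if r: "r \<in> carrier H" and u: "u \<in> I" for r u
    proof -
      obtain a where "u = a \<otimes> y" "a \<in> carrier H" using u unfolding I_def by blast
      then have "r \<otimes> u = (r \<otimes> a) \<otimes> y" "r \<otimes> a \<in> carrier H" using y r by (auto simp: m_assoc)
      then show ?thesis unfolding I_def by blast
    qed
  qed (use y in \<open>auto simp: I_def\<close>)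
  note I = left_idealD[OF this]
  obtain J where J': "left_ideal J H" "I \<inter> J = {\<zero>}" "\<exists>i\<in>I. \<exists>j\<in>J. \<one> = i \<oplus> j"
    by (rule left_ideal_complement[OF \<open>left_ideal I H\<close>])
  note J = left_idealD[OF J'(1)]
  obtain i j where ij: "i \<in> I" "j \<in> J" "\<one> = i \<oplus> j" using J'(3) by blast
  have c: "i \<in> carrier H" "j \<in> carrier H" using ij I J by auto
  have "y = y \<otimes> (i \<oplus> j)" using y by (simp flip: ij(3))
  then have s: "y = y \<otimes> i \<oplus> y \<otimes> j" using y c by (simp add: r_distr)
  have "y \<otimes> j = (y \<otimes> i \<oplus> y \<otimes> j) \<ominus> y \<otimes> i" using y c by algebra
  then have "y \<otimes> j = y \<ominus> y \<otimes> i" unfolding s[symmetric] .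
  moreover have "y \<in> I" unfolding I_def using y by (intro image_eqI[of _ _ \<one>]) auto
  ultimately have "y \<otimes> j \<in> I" using I(3,4) ij(1) y by simp
  then have "y \<otimes> j \<in> I \<inter> J" using J(4)[OF y ij(2)] by blast
  then have "y \<otimes> j = \<zero>" using J'(2) by blast
  then have yi: "y = y \<otimes> i" using s y c by simp
  obtain h where h: "h \<in> carrier H" "i = h \<otimes> y" using ij(1) unfolding I_def by blast
  have "y \<otimes> i = y \<otimes> h \<otimes> y" using h y by (simp add: m_assoc)
  then show ?thesis using yi nil[OF h(1)] by simp
qed

definition is_integral :: "'h \<Rightarrow> 'h set \<Rightarrow> bool" where
  "is_integral l N \<longleftrightarrow> l \<in> N \<and> \<epsilon> l = 1 \<and> (\<forall>n\<in>N. n \<otimes> l = \<epsilon> n \<odot> l \<and> l \<otimes> n = \<epsilon> n \<odot> l)"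

lemma counit_zero [simp]: "\<epsilon> \<zero> = 0"
  using counit_smult[of \<zero> 0] by simp

lemma counit_minus [simp]: "x \<in> carrier H \<Longrightarrow> \<epsilon> (\<ominus> x) = - \<epsilon> x"
  using counit_smult[of x "-1"] smult_minus_one[of x] by simp

text \<open>
  Let \<open>l\<close> be the component of the unit in a complement of the kernel of the counit. A left multiple of
  \<open>l\<close> by an element \<open>k\<close> of the kernel lies in both summands, so it is zero. Then \<open>lk\<close> is zero as well,
  because \<open>(lk) h (lk)\<close> is zero for all \<open>h\<close>.
\<close>

lemma integral_exists_carrier: "\<exists>l. is_integral l (carrier H)"
proof -
  define I where "I = {h \<in> carrier H. \<epsilon> h = 0}"
  have "left_ideal I H"
    by (rule left_idealI) (auto simp: I_def counit_add counit_mult)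
  then obtain J where J': "left_ideal J H" "I \<inter> J = {\<zero>}" "\<exists>i\<in>I. \<exists>j\<in>J. \<one> = i \<oplus> j"
    by (rule left_ideal_complement)
  note J = left_idealD[OF J'(1)]
  obtain i l where il: "i \<in> I" "l \<in> J" "\<one> = i \<oplus> l" using J'(3) by blast
  have c: "i \<in> carrier H" "l \<in> carrier H" "\<epsilon> i = 0" using il J unfolding I_def by auto
  have \<epsilon>l: "\<epsilon> l = 1" using counit_add[OF c(1,2)] il(3) c(3) counit_one by simp
  have kl: "k \<otimes> l = \<zero>" if "k \<in> I" for k
  proof -
    have "k \<in> carrier H" "\<epsilon> k = 0" using that unfolding I_def by auto
    then have "k \<otimes> l \<in> I \<inter> J" using J(4)[OF _ il(2)] c by (simp add: I_def counit_mult)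
    then show ?thesis using J'(2) by blast
  qed
  have lk: "l \<otimes> k = \<zero>" if k: "k \<in> I" for k
  proof (rule semiprime)
    have kc: "k \<in> carrier H" using k unfolding I_def by auto
    then show "l \<otimes> k \<in> carrier H" using c by simp
    fix h assume h: "h \<in> carrier H"
    then have "k \<otimes> h \<in> I" using k by (auto simp: I_def counit_mult)
    have "l \<otimes> k \<otimes> h \<otimes> (l \<otimes> k) = l \<otimes> (((k \<otimes> h) \<otimes> l) \<otimes> k)" using c kc h by (simp add: m_assoc)
    also have "\<dots> = \<zero>" using kl[OF \<open>k \<otimes> h \<in> I\<close>] c kc by simp
    finally show "l \<otimes> k \<otimes> h \<otimes> (l \<otimes> k) = \<zero>" .
  qed
  have "h \<otimes> l = \<epsilon> h \<odot> l \<and> l \<otimes> h = \<epsilon> h \<odot> l" if h: "h \<in> carrier H" for h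
  proof -
    define k where "k = h \<oplus> (- \<epsilon> h) \<odot> \<one>"
    have k: "k \<in> I" using h by (simp add: k_def I_def counit_add counit_smult counit_one)
    have kc: "k \<in> carrier H" using h by (simp add: k_def)
    have "k \<oplus> \<epsilon> h \<odot> \<one> = h \<oplus> ((- \<epsilon> h) \<odot> \<one> \<oplus> \<epsilon> h \<odot> \<one>)" using h by (simp add: k_def a_assoc)
    also have "(- \<epsilon> h) \<odot> \<one> \<oplus> \<epsilon> h \<odot> \<one> = (- \<epsilon> h + \<epsilon> h) \<odot> \<one>" by (simp only: smult_simps one_closed)
    finally have hk: "h = k \<oplus> \<epsilon> h \<odot> \<one>" using h by simp
    have "h \<otimes> l = k \<otimes> l \<oplus> \<epsilon> h \<odot> l" "l \<otimes> h = l \<otimes> k \<oplus> \<epsilon> h \<odot> l"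
      by (subst hk, simp add: l_distr r_distr kc c smult_mult_left smult_mult_right)+
    then show ?thesis using kl[OF k] lk[OF k] c by simp
  qed
  then have "is_integral l (carrier H)" unfolding is_integral_def using \<epsilon>l c by blast
  then show ?thesis by blast
qed

definition \<Lambda> :: 'h where "\<Lambda> = (SOME l. is_integral l (carrier H))"

lemma \<Lambda>_integral: "is_integral \<Lambda> (carrier H)"
  unfolding \<Lambda>_def by (rule someI_ex[OF integral_exists_carrier])

lemma \<Lambda>: "\<Lambda> \<in> carrier H" "\<epsilon> \<Lambda> = 1" "h \<in> carrier H \<Longrightarrow> h \<otimes> \<Lambda> = \<epsilon> h \<odot> \<Lambda>" "h \<in> carrier H \<Longrightarrow> \<Lambda> \<otimes> h = \<epsilon> h \<odot> \<Lambda>"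
  using \<Lambda>_integral unfolding is_integral_def by auto

text \<open>
  In tensors: \<open>\<Sum> \<Lambda>\<^sub>1 \<otimes> a\<Lambda>\<^sub>2 = \<Sum> S(a)\<Lambda>\<^sub>1 \<otimes> \<Lambda>\<^sub>2\<close>. The left-hand side is
  \<open>\<Sum> S(a\<^sub>1)a\<^sub>2\<Lambda>\<^sub>1 \<otimes> a\<^sub>3\<Lambda>\<^sub>2\<close>, where \<open>a\<^sub>2\<close> and \<open>a\<^sub>3\<close> are absorbed by \<open>\<Lambda>\<close>.
\<close>

lemma integral_shift:
  assumes a: "a \<in> carrier H" and g: "bilinear_form H g"
  shows "Sw (\<lambda>p q. g p (a \<otimes> q)) \<Lambda> = Sw (\<lambda>p q. g (S a \<otimes> p) q) \<Lambda>"
proof -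
  note [simp] = antipode_closed a \<Lambda>(1)
  note lin = multilin_intros dual_bil1[OF g] dual_bil2[OF g]
  define G where "G a1 b c = Sw (\<lambda>p q. g (S a1 \<otimes> (b \<otimes> p)) (c \<otimes> q)) \<Lambda>" for a1 b c
  have "Sw (\<lambda>a1 a'. Sw (\<lambda>b c. G a1 b c) a') a = Sw (\<lambda>a1 a'. \<epsilon> a' * Sw (\<lambda>p q. g (S a1 \<otimes> p) q) \<Lambda>) a"
  proof (rule sw_cong[OF a])
    fix a1 a' assume [simp]: "a1 \<in> carrier H" "a' \<in> carrier H"
    have bl: "bilinear_form H (\<lambda>p q. g (S a1 \<otimes> p) q)" by (intro lin; simp)
    have "Sw (\<lambda>b c. G a1 b c) a' = Sw (\<lambda>p q. g (S a1 \<otimes> p) q) (a' \<otimes> \<Lambda>)"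
      unfolding G_def by (rule sw_mult[symmetric, OF _ _ bl]) simp_all
    then show "Sw (\<lambda>b c. G a1 b c) a' = \<epsilon> a' * Sw (\<lambda>p q. g (S a1 \<otimes> p) q) \<Lambda>"
      by (simp add: \<Lambda>(3) sw_smult[OF _ bl])
  qed
  also have "\<dots> = Sw (\<lambda>p q. g (S a \<otimes> p) q) \<Lambda>"
    by (rule sw_counit_right[OF a]) (intro lin; simp)
  finally have 1: "Sw (\<lambda>a1 a'. Sw (\<lambda>b c. G a1 b c) a') a = Sw (\<lambda>p q. g (S a \<otimes> p) q) \<Lambda>" .
  have "Sw (\<lambda>a1 a'. Sw (\<lambda>b c. G a1 b c) a') a = Sw (\<lambda>a' c. Sw (\<lambda>a1 b. G a1 b c) a') a"
    by (rule sw_coassoc[OF a, symmetric]) (unfold G_def, intro lin; simp)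
  also have "\<dots> = Sw (\<lambda>a' c. \<epsilon> a' * Sw (\<lambda>p q. g p (c \<otimes> q)) \<Lambda>) a"
  proof (rule sw_cong[OF a])
    fix a' c assume [simp]: "a' \<in> carrier H" "c \<in> carrier H"
    have "Sw (\<lambda>a1 b. G a1 b c) a' = Sw (\<lambda>p q. Sw (\<lambda>a1 b. g (S a1 \<otimes> (b \<otimes> p)) (c \<otimes> q)) a') \<Lambda>"
      unfolding G_def by (rule sw_swap)
    also have "\<dots> = Sw (\<lambda>p q. \<epsilon> a' * g p (c \<otimes> q)) \<Lambda>"
    proof (rule sw_cong[OF \<Lambda>(1)])
      fix p q assume [simp]: "p \<in> carrier H" "q \<in> carrier H"
      have "(\<lambda>z. g (z \<otimes> p) (c \<otimes> q)) \<in> dual H" by (intro lin; simp)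
      from sw_antipode_left[OF _ this, of a']
      have "Sw (\<lambda>a1 b. g ((S a1 \<otimes> b) \<otimes> p) (c \<otimes> q)) a' = \<epsilon> a' * g p (c \<otimes> q)" by simp
      moreover have "Sw (\<lambda>a1 b. g (S a1 \<otimes> (b \<otimes> p)) (c \<otimes> q)) a' = Sw (\<lambda>a1 b. g ((S a1 \<otimes> b) \<otimes> p) (c \<otimes> q)) a'"
        by (rule sw_cong) (simp_all add: m_assoc)
      ultimately show "Sw (\<lambda>a1 b. g (S a1 \<otimes> (b \<otimes> p)) (c \<otimes> q)) a' = \<epsilon> a' * g p (c \<otimes> q)" by simp
    qed
    also have "\<dots> = \<epsilon> a' * Sw (\<lambda>p q. g p (c \<otimes> q)) \<Lambda>" by (rule sw_cmult)
    finally show "Sw (\<lambda>a1 b. G a1 b c) a' = \<epsilon> a' * Sw (\<lambda>p q. g p (c \<otimes> q)) \<Lambda>" .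
  qed
  also have "\<dots> = Sw (\<lambda>p q. g p (a \<otimes> q)) \<Lambda>"
    by (rule sw_counit_left[OF a]) (intro lin; simp)
  finally show ?thesis using 1 by simp
qed

text \<open>
  It follows that the right legs of \<open>\<Lambda>\<close> form a left ideal.
\<close>

lemma mult_delta_integral:
  assumes y: "y \<in> carrier H" and \<psi>: "\<psi> \<in> dual H"
  shows "y \<otimes> delta \<psi> \<Lambda> = delta (\<lambda>p. \<psi> (S y \<otimes> p)) \<Lambda>"
proof (rule dual_eqI)
  fix \<chi> assume \<chi>: "\<chi> \<in> dual H"
  have "(\<lambda>z. \<chi> (y \<otimes> z)) \<in> dual H" by (intro multilin_intros dual_endo[OF \<chi>] y)
  from dual_delta[OF this \<Lambda>(1), of \<psi>]
  have "\<chi> (y \<otimes> delta \<psi> \<Lambda>) = Sw (\<lambda>p q. \<psi> p * \<chi> (y \<otimes> q)) \<Lambda>" .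
  also have "\<dots> = Sw (\<lambda>p q. \<psi> (S y \<otimes> p) * \<chi> q) \<Lambda>"
    by (rule integral_shift[OF y bilinear_mult[OF \<psi> \<chi>]])
  also have "\<dots> = \<chi> (delta (\<lambda>p. \<psi> (S y \<otimes> p)) \<Lambda>)" by (rule dual_delta[OF \<chi> \<Lambda>(1), symmetric])
  finally show "\<chi> (y \<otimes> delta \<psi> \<Lambda>) = \<chi> (delta (\<lambda>p. \<psi> (S y \<otimes> p)) \<Lambda>)" .
qed (simp_all add: y \<Lambda>(1))

lemma dual_shift: "y \<in> carrier H \<Longrightarrow> \<psi> \<in> dual H \<Longrightarrow> (\<lambda>p. \<psi> (S y \<otimes> p)) \<in> dual H"
  by (rule dual_endo[OF _ endo_mult_right[OF endo_id antipode_closed]])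

text \<open>
  Since \<open>\<Sum> S(\<Lambda>\<^sub>1) \<Lambda>\<^sub>2 = \<one>\<close> and the right legs of \<open>\<Lambda>\<close> form a left ideal, every \<open>x\<close> is a combination
  of products of \<open>x\<close> with right legs of \<open>\<Lambda>\<close>.
\<close>

lemma dual_via_integral:
  assumes \<phi>: "\<phi> \<in> dual H" and x: "x \<in> carrier H"
    and van: "\<And>\<psi>. \<psi> \<in> dual H \<Longrightarrow> \<phi> (x \<otimes> delta \<psi> \<Lambda>) = 0"
  shows "\<phi> x = 0"
proof -
  note [simp] = antipode_closed x \<Lambda>(1)
  have lf: "(\<lambda>z. \<phi> (x \<otimes> z)) \<in> dual H" by (intro multilin_intros dual_endo[OF \<phi>] x)
  have "\<phi> x = Sw (\<lambda>p q. \<phi> (x \<otimes> (S p \<otimes> q))) \<Lambda>"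
    using sw_antipode_left[OF \<Lambda>(1) lf] by (simp add: \<Lambda>(2))
  also have bl: "bilinear_form H (\<lambda>p q. \<phi> (x \<otimes> (S p \<otimes> q)))"
    by (intro multilin_intros dual_endo[OF \<phi>]; simp)
  obtain n u f where F: "frame n u f"
    and ex: "\<forall>g. bilinear_form H g \<longrightarrow> Sw g \<Lambda> = (\<Sum>i<n. g (u i) (delta (f i) \<Lambda>))"
    using sw_expand_exists[OF \<Lambda>(1)] by auto
  have "Sw (\<lambda>p q. \<phi> (x \<otimes> (S p \<otimes> q))) \<Lambda> = (\<Sum>i<n. \<phi> (x \<otimes> (S (u i) \<otimes> delta (f i) \<Lambda>)))"
    by (rule ex[rule_format, OF bl])
  also have "\<dots> = 0"
  proof (rule sum.neutral, rule ballI)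
    fix i assume "i \<in> {..<n}"
    then have "u i \<in> carrier H" "f i \<in> dual H" using frameD[OF F] by auto
    then show "\<phi> (x \<otimes> (S (u i) \<otimes> delta (f i) \<Lambda>)) = 0"
      using mult_delta_integral[of "S (u i)" "f i"] van[OF dual_shift[of "S (u i)" "f i"]] by simp
  qed
  finally show ?thesis .
qed

text \<open>
  All of \<open>H\<close> lies in the span of the right legs of \<open>\<Lambda>\<close>.
\<close>

lemma finite_dimensional: "\<exists>n u f. frame n u f \<and> frame_span n u f = carrier H"
proof -
  have "finite (snd ` Poly_Mapping.keys (sweedler H \<Lambda>))" "snd ` Poly_Mapping.keys (sweedler H \<Lambda>) \<subseteq> carrier H"
    using sweedler_comult(2)[OF \<Lambda>(1)] by auto
  from frame_exists[OF this] obtain n u f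
    where F: "frame n u f" and k: "snd ` Poly_Mapping.keys (sweedler H \<Lambda>) \<subseteq> frame_span n u f" by blast
  note R = subsp_frame_span[OF F]
  have d: "delta \<psi> \<Lambda> \<in> frame_span n u f" for \<psi>
    unfolding delta_def sweedler_sum_def
    by (rule subsp_finsum[OF R]) (use k in \<open>auto intro!: subspD(4)[OF R]\<close>)
  have "x \<in> frame_span n u f" if x: "x \<in> carrier H" for x
  proof (rule ccontr)
    assume "x \<notin> frame_span n u f"
    then obtain \<phi> where \<phi>: "\<phi> \<in> dual H" "\<forall>a\<in>frame_span n u f. \<phi> a = 0" "\<phi> x = 1"
      using dual_separates_subsp[OF R x] by blast
    have "\<phi> x = 0"
      by (rule dual_via_integral[OF \<phi>(1) x]) (simp add: mult_delta_integral x \<phi>(2) d)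
    with \<phi>(3) show False by simp
  qed
  then have "frame_span n u f = carrier H" using subspD(1)[OF R] by blast
  with F show ?thesis by blast
qed

text \<open>
  If \<open>S a = \<zero>\<close>, then \<open>a\<close> annihilates the right legs of \<open>\<Lambda>\<close> by \<open>mult_delta_integral\<close>.
\<close>

lemma antipode_inj:
  assumes a: "a \<in> carrier H" and "S a = \<zero>" shows "a = \<zero>"
proof (rule dual_eqI[OF a zero_closed])
  fix \<phi> assume \<phi>: "\<phi> \<in> dual H"
  have "\<phi> a = 0"
  proof (rule dual_via_integral[OF \<phi> a])
    fix \<psi> assume \<psi>: "\<psi> \<in> dual H"
    have "\<phi> (a \<otimes> delta \<psi> \<Lambda>) = Sw (\<lambda>p q. \<psi> (S a \<otimes> p) * \<phi> q) \<Lambda>"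
      by (simp add: mult_delta_integral[OF a \<psi>] dual_delta[OF \<phi> \<Lambda>(1)])
    also have "\<dots> = Sw (\<lambda>p q. 0) \<Lambda>"
      by (rule sw_cong[OF \<Lambda>(1)]) (simp add: assms(2) dual_zero[OF \<psi>])
    finally show "\<phi> (a \<otimes> delta \<psi> \<Lambda>) = 0" by (simp add: sw_zero)
  qed
  then show "\<phi> a = \<phi> \<zero>" by (simp add: dual_zero[OF \<phi>])
qed

end

context hopf_algebra
begin

lemma dual_conv: "\<phi> \<in> dual H \<Longrightarrow> \<psi> \<in> dual H \<Longrightarrow> (\<lambda>p. Sw (\<lambda>s t. \<phi> s * \<psi> t) p) \<in> dual H"
  by (rule dual_sw_arg[OF bilinear_mult endo_id])

text \<open>
  Coassociativity: iterating partial coproducts is convolution of functionals.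
\<close>

lemma delta_delta:
  assumes \<phi>: "\<phi> \<in> dual H" and \<psi>: "\<psi> \<in> dual H" and x: "x \<in> carrier H"
  shows "delta \<psi> (delta \<phi> x) = delta (\<lambda>p. Sw (\<lambda>s t. \<phi> s * \<psi> t) p) x"
proof (rule dual_eqI)
  fix \<chi> assume \<chi>: "\<chi> \<in> dual H"
  have "\<chi> (delta \<psi> (delta \<phi> x)) = Sw (\<lambda>a b. \<psi> a * \<chi> b) (delta \<phi> x)"
    by (simp add: dual_delta \<chi> x)
  also have "\<dots> = Sw (\<lambda>s u. \<phi> s * Sw (\<lambda>a b. \<psi> a * \<chi> b) u) x"
    by (rule dual_delta[OF dual_conv[OF \<psi> \<chi>] x])
  also have "\<dots> = Sw (\<lambda>s u. Sw (\<lambda>a b. \<phi> s * (\<psi> a * \<chi> b)) u) x"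
    by (simp add: sw_cmult)
  also have "\<dots> = Sw (\<lambda>u b. Sw (\<lambda>s a. \<phi> s * (\<psi> a * \<chi> b)) u) x"
    by (rule sw_coassoc[OF x, symmetric]) (intro trilinear_formI dual_times_left dual_times_right \<phi> \<psi> \<chi>)
  also have "\<dots> = Sw (\<lambda>u b. Sw (\<lambda>s a. \<phi> s * \<psi> a) u * \<chi> b) x"
    by (simp add: sw_cmult(2)[symmetric] mult.assoc)
  also have "\<dots> = \<chi> (delta (\<lambda>p. Sw (\<lambda>s t. \<phi> s * \<psi> t) p) x)"
    by (rule dual_delta[OF \<chi> x, symmetric])
  finally show "\<chi> (delta \<psi> (delta \<phi> x)) = \<chi> (delta (\<lambda>p. Sw (\<lambda>s t. \<phi> s * \<psi> t) p) x)" .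
qed (simp_all add: x)

lemma counit_delta: "\<phi> \<in> dual H \<Longrightarrow> x \<in> carrier H \<Longrightarrow> \<epsilon> (delta \<phi> x) = \<phi> x"
proof -
  assume *: "\<phi> \<in> dual H" "x \<in> carrier H"
  have "\<epsilon> \<in> dual H" using dual_counit[OF endo_id] by simp
  from dual_delta[OF this *(2), of \<phi>] show ?thesis
    using sw_counit_right[OF *(2,1)] by (simp add: mult.commute)
qed

end

section \<open>Coordinates and the inverse of the antipode\<close>

text \<open>
  A frame that spans \<open>H\<close> is a basis. Its coordinates carry \<open>H\<close> to a subspace of a space of functions, on
  which dimensions and the results on twisted subalgebras are available.
\<close>

locale framed_hopf = semisimple_hopf H for H :: "('k::field, 'h, 'm) hopf_scheme" (structure) +
  fixes n :: nat and b :: "nat \<Rightarrow> 'h" and f :: "nat \<Rightarrow> 'h \<Rightarrow> 'k"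
  assumes frame: "frame n b f" and frame_span: "frame_span n b f = carrier H"
begin

lemma b_closed [simp]: "i < n \<Longrightarrow> b i \<in> carrier H" and f_dual: "i < n \<Longrightarrow> f i \<in> dual H"
  and f_b: "i < n \<Longrightarrow> l < n \<Longrightarrow> f i (b l) = (if i = l then 1 else 0)"
  using frameD[OF frame] by auto

lemma dual_expand: "x \<in> carrier H \<Longrightarrow> \<phi> \<in> dual H \<Longrightarrow> \<phi> x = (\<Sum>i<n. f i x * \<phi> (b i))"
  using frame_spanD[of x n b f] frame_span by blast

definition coords :: "'h \<Rightarrow> nat \<Rightarrow> 'k" where
  "coords x = (\<lambda>i. if i < n then f i x else 0)"

definition of_coords :: "(nat \<Rightarrow> 'k) \<Rightarrow> 'h" where
  "of_coords c = (\<Oplus>i\<in>{..<n}. c i \<odot> b i)"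

abbreviation sc :: "'k \<Rightarrow> (nat \<Rightarrow> 'k) \<Rightarrow> nat \<Rightarrow> 'k" where
  "sc \<equiv> \<lambda>c v i. c * v i"

lemma vs: "vector_space sc"
  by (rule vector_space_fun[OF vector_space_field])

lemma of_coords_closed [simp]: "of_coords c \<in> carrier H"
  unfolding of_coords_def by (rule finsum_closed) auto

lemma dual_of_coords: "\<phi> \<in> dual H \<Longrightarrow> \<phi> (of_coords c) = (\<Sum>i<n. c i * \<phi> (b i))"
  unfolding of_coords_def by (subst dual_finsum) (auto simp: dualD)

lemma of_coords_coords [simp]: "x \<in> carrier H \<Longrightarrow> of_coords (coords x) = x"
  by (rule dual_eqI) (simp_all add: dual_of_coords coords_def dual_expand[of x, symmetric])

lemma coords_add: "x \<in> carrier H \<Longrightarrow> y \<in> carrier H \<Longrightarrow> coords (x \<oplus> y) = coords x + coords y"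
  by (auto simp: coords_def fun_eq_iff dualD[OF f_dual])

lemma coords_smult: "x \<in> carrier H \<Longrightarrow> coords (c \<odot> x) = sc c (coords x)"
  by (auto simp: coords_def fun_eq_iff dualD[OF f_dual])

lemma coords_zero: "coords \<zero> = 0"
  by (auto simp: coords_def fun_eq_iff dual_zero[OF f_dual])

lemma of_coords_add: "of_coords (v + w) = of_coords v \<oplus> of_coords w"
  by (rule dual_eqI) (auto simp: dual_of_coords dualD sum.distrib algebra_simps)

lemma of_coords_smult: "of_coords (sc c v) = c \<odot> of_coords v"
  by (rule dual_eqI) (auto simp: dual_of_coords dualD sum_distrib_left algebra_simps)

lemma coords_inj: "x \<in> carrier H \<Longrightarrow> y \<in> carrier H \<Longrightarrow> coords x = coords y \<Longrightarrow> x = y"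
  by (metis of_coords_coords)

lemma coords_finsum:
  assumes "finite I" "g \<in> I \<rightarrow> carrier H" shows "coords (\<Oplus>i\<in>I. g i) = (\<Sum>i\<in>I. coords (g i))"
  using assms
proof (induction I rule: finite_induct)
  case (insert i I)
  then have "g \<in> I \<rightarrow> carrier H" "g i \<in> carrier H" by auto
  with insert show ?case by (simp add: coords_add finsum_closed)
qed (simp add: coords_zero)

lemma linear_transfer:
  assumes "L \<in> endo" shows "Vector_Spaces.linear sc sc (\<lambda>v. coords (L (of_coords v)))"
  unfolding Vector_Spaces.linear_iff
  by (simp add: vs of_coords_add of_coords_smult endoD[OF assms] coords_add coords_smult)

lemma subspace_coords:
  assumes "subsp N" shows "Modules.module.subspace sc (coords ` N)"
proof -
  interpret V: vector_space sc by (rule vs)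
  note N = subspD[OF assms]
  have c: "x \<in> carrier H" if "x \<in> N" for x using N(1) that by blast
  show ?thesis
  proof (rule V.subspaceI)
    show "0 \<in> coords ` N" using N(2) coords_zero by (intro image_eqI[of _ _ \<zero>]) auto
    show "v + w \<in> coords ` N" if "v \<in> coords ` N" "w \<in> coords ` N" for v w
    proof -
      from that obtain x y where "v = coords x" "x \<in> N" "w = coords y" "y \<in> N" by (elim imageE)
      then show ?thesis using N(3)[of x y] c by (intro image_eqI[of _ _ "x \<oplus> y"]) (auto simp: coords_add)
    qed
    show "sc a v \<in> coords ` N" if "v \<in> coords ` N" for a v
    proof -
      from that obtain x where "v = coords x" "x \<in> N" by (elim imageE)
      then show ?thesis using N(4)[of x a] c by (intro image_eqI[of _ _ "a \<odot> x"]) (auto simp: coords_smult)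
    qed
  qed
qed

lemma subsp_carrier: "subsp (carrier H)"
  by (auto simp: subsp_def)

lemma fin_dim_coords: "fin_dim sc (coords ` carrier H)"
  unfolding fin_dim_def
proof (intro exI[of _ "(\<lambda>i. coords (b i)) ` {..<n}"] conjI image_subsetI)
  interpret V: vector_space sc by (rule vs)
  fix x assume x: "x \<in> carrier H"
  have "coords x = (\<Sum>i<n. sc (f i x) (coords (b i)))"
  proof
    fix j
    have "(\<Sum>i\<in>I. sc (f i x) (coords (b i))) j = (\<Sum>i\<in>I. f i x * coords (b i) j)" for I
      by (induction I rule: infinite_finite_induct) auto
    then show "coords x j = (\<Sum>i<n. sc (f i x) (coords (b i))) j"
      using dual_expand[OF x f_dual, of j] by (auto simp: coords_def)
  qed
  also have "\<dots> \<in> V.span ((\<lambda>i. coords (b i)) ` {..<n})"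
    by (intro V.span_sum V.span_scale V.span_base) auto
  finally show "coords x \<in> V.span ((\<lambda>i. coords (b i)) ` {..<n})" .
qed simp

lemma antipode_surj: "S ` carrier H = carrier H"
proof
  show "S ` carrier H \<subseteq> carrier H" using antipode_closed by blast
  interpret V: vector_space sc by (rule vs)
  interpret VV: vector_space_pair sc sc by unfold_locales
  let ?g = "\<lambda>v. coords (S (of_coords v))"
  let ?C = "coords ` carrier H"
  have lin: "Vector_Spaces.linear sc sc ?g" by (rule linear_transfer[OF endo_S[OF endo_id]])
  have C: "V.subspace ?C" "fin_dim sc ?C" by (rule subspace_coords[OF subsp_carrier], rule fin_dim_coords)
  have d: "V.dim (?g ` ?C) = V.dim ?C"
  proof (rule VV.dim_image_inj[OF lin C])
    fix v assume "v \<in> ?C" and 0: "?g v = 0"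
    then obtain x where x: "v = coords x" "x \<in> carrier H" by blast
    have "S x = \<zero>" using 0 x by (intro coords_inj) (auto simp: coords_zero antipode_closed)
    then show "v = 0" using antipode_inj[OF x(2)] x(1) by (simp add: coords_zero)
  qed
  have sub: "?g ` ?C \<subseteq> ?C" by (intro image_subsetI imageI antipode_closed of_coords_closed)
  have "?g ` ?C = ?C"
    by (rule V.subspace_eq_if_dim_le[OF C
          module_hom.subspace_image[OF lin[unfolded linear_iff_module_hom] C(1)] sub]) (simp only: d)
  show "carrier H \<subseteq> S ` carrier H"
  proof
    fix y assume y: "y \<in> carrier H"
    then have "coords y \<in> ?g ` ?C" unfolding \<open>?g ` ?C = ?C\<close> by blast
    then obtain x where x: "x \<in> carrier H" "coords y = coords (S x)" by auto
    then have "y = S x" using y by (intro coords_inj) (auto simp: antipode_closed)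
    with x show "y \<in> S ` carrier H" by blast
  qed
qed

definition S_inv :: "'h \<Rightarrow> 'h" where "S_inv = inv_into (carrier H) S"

lemma S_inv_closed [simp]: "x \<in> carrier H \<Longrightarrow> S_inv x \<in> carrier H"
  and S_S_inv [simp]: "x \<in> carrier H \<Longrightarrow> S (S_inv x) = x"
  unfolding S_inv_def using inv_into_into[of x S "carrier H"] f_inv_into_f[of x S "carrier H"]
  by (simp_all add: antipode_surj)

lemma S_eqI: "x \<in> carrier H \<Longrightarrow> y \<in> carrier H \<Longrightarrow> S x = S y \<Longrightarrow> x = y"
proof -
  assume *: "x \<in> carrier H" "y \<in> carrier H" "S x = S y"
  have "S (x \<oplus> (- 1) \<odot> y) = S x \<oplus> (- 1) \<odot> S y"
    by (simp only: antipode_add[OF *(1) smult_in[OF *(2)]] antipode_smult[OF *(2)])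
  also have "\<dots> = S y \<oplus> \<ominus> S y"
    by (simp only: smult_minus_one[OF antipode_closed[OF *(2)]] *(3))
  also have "\<dots> = \<zero>" by (rule r_neg[OF antipode_closed[OF *(2)]])
  finally have "S (x \<ominus> y) = \<zero>" by (simp only: smult_minus_one[OF *(2)] minus_eq)
  then have "x \<ominus> y = \<zero>" by (rule antipode_inj[OF minus_closed[OF *(1,2)]])
  then show ?thesis using r_right_minus_eq[OF *(1,2)] by simp
qed

lemma endo_S_inv: "L \<in> endo \<Longrightarrow> (\<lambda>x. S_inv (L x)) \<in> endo"
  unfolding endo_def
  by (simp, intro conjI ballI allI; rule S_eqI) (simp_all add: antipode_add antipode_smult)

lemma S_inv_mult: "x \<in> carrier H \<Longrightarrow> y \<in> carrier H \<Longrightarrow> S_inv (x \<otimes> y) = S_inv y \<otimes> S_inv x"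
  by (rule S_eqI) (simp_all add: antipode_mult)

text \<open>
  The antipode is injective and turns the Sweedler sum into one of the antipode axioms.
\<close>

lemma sw_S_inv_left:
  assumes x: "x \<in> carrier H" and \<phi>: "\<phi> \<in> dual H"
  shows "Sw (\<lambda>p q. \<phi> (S_inv q \<otimes> p)) x = \<epsilon> x * \<phi> \<one>"
proof -
  let ?z = "sweedler_sum H (\<lambda>p q. S_inv q \<otimes> p) x"
  have z: "?z \<in> carrier H" by (rule sweedler_sum_closed[OF x]) auto
  have "?z = \<epsilon> x \<odot> \<one>"
  proof (rule S_eqI[OF z])
    show "S ?z = S (\<epsilon> x \<odot> \<one>)"
    proof (rule dual_eqI)
      fix \<chi> assume \<chi>: "\<chi> \<in> dual H"
      have "\<chi> (S ?z) = Sw (\<lambda>p q. \<chi> (S (S_inv q \<otimes> p))) x"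
        by (rule dual_sweedler_sum[OF dual_endo[OF \<chi> endo_S[OF endo_id]] x]) simp
      also have "\<dots> = Sw (\<lambda>p q. \<chi> (S p \<otimes> q)) x"
        by (rule sw_cong[OF x]) (simp add: antipode_mult)
      finally show "\<chi> (S ?z) = \<chi> (S (\<epsilon> x \<odot> \<one>))"
        by (simp add: sw_antipode_left[OF x \<chi>] antipode_smult antipode_one dualD(2)[OF \<chi>])
    qed (simp_all add: antipode_closed z)
  qed simp
  then show ?thesis
    using dual_sweedler_sum[OF \<phi> x, of "\<lambda>p q. S_inv q \<otimes> p"] by (simp add: dualD(2)[OF \<phi>])
qed

lemma sw_S_inv_right:
  assumes x: "x \<in> carrier H" and \<phi>: "\<phi> \<in> dual H"
  shows "Sw (\<lambda>p q. \<phi> (q \<otimes> S_inv p)) x = \<epsilon> x * \<phi> \<one>"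
proof -
  let ?z = "sweedler_sum H (\<lambda>p q. q \<otimes> S_inv p) x"
  have z: "?z \<in> carrier H" by (rule sweedler_sum_closed[OF x]) auto
  have "?z = \<epsilon> x \<odot> \<one>"
  proof (rule S_eqI[OF z])
    show "S ?z = S (\<epsilon> x \<odot> \<one>)"
    proof (rule dual_eqI)
      fix \<chi> assume \<chi>: "\<chi> \<in> dual H"
      have "\<chi> (S ?z) = Sw (\<lambda>p q. \<chi> (S (q \<otimes> S_inv p))) x"
        by (rule dual_sweedler_sum[OF dual_endo[OF \<chi> endo_S[OF endo_id]] x]) simp
      also have "\<dots> = Sw (\<lambda>p q. \<chi> (p \<otimes> S q)) x"
        by (rule sw_cong[OF x]) (simp add: antipode_mult)
      finally show "\<chi> (S ?z) = \<chi> (S (\<epsilon> x \<odot> \<one>))"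
        by (simp add: sw_antipode_right[OF x \<chi>] antipode_smult antipode_one dualD(2)[OF \<chi>])
    qed (simp_all add: antipode_closed z)
  qed simp
  then show ?thesis
    using dual_sweedler_sum[OF \<phi> x, of "\<lambda>p q. q \<otimes> S_inv p"] by (simp add: dualD(2)[OF \<phi>])
qed

lemma subsp_closed_finsum_smult:
  assumes "subsp M" "\<And>j. j < n \<Longrightarrow> x j \<in> M" shows "(\<Oplus>j\<in>{..<n}. c j \<odot> x j) \<in> M"
  by (rule subsp_finsum[OF assms(1)]) (use assms subspD(4)[OF assms(1)] in auto)

lemma delta_expand:
  assumes M: "subsp M" "\<And>j. j < n \<Longrightarrow> delta (\<theta> j) x \<in> M" and x: "x \<in> carrier H"
    and \<psi>: "\<And>p. p \<in> carrier H \<Longrightarrow> \<psi> p = (\<Sum>j<n. c j * \<theta> j p)"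
  shows "delta \<psi> x \<in> M"
proof -
  have "delta \<psi> x = (\<Oplus>j\<in>{..<n}. c j \<odot> delta (\<theta> j) x)"
  proof (rule dual_eqI)
    fix \<chi> assume \<chi>: "\<chi> \<in> dual H"
    have "\<chi> (delta \<psi> x) = Sw (\<lambda>p q. \<Sum>j<n. c j * (\<theta> j p * \<chi> q)) x"
      unfolding dual_delta[OF \<chi> x]
      by (rule sw_cong[OF x]) (simp add: \<psi> sum_distrib_right mult.assoc)
    also have "\<dots> = (\<Sum>j<n. c j * \<chi> (delta (\<theta> j) x))"
      unfolding sw_sum sw_cmult by (simp add: dual_delta[OF \<chi> x])
    also have "\<dots> = \<chi> (\<Oplus>j\<in>{..<n}. c j \<odot> delta (\<theta> j) x)"
      by (subst dual_finsum[OF \<chi>]) (auto simp: x dualD(2)[OF \<chi>])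
    finally show "\<chi> (delta \<psi> x) = \<chi> (\<Oplus>j\<in>{..<n}. c j \<odot> delta (\<theta> j) x)" .
  qed (auto simp: x intro!: finsum_closed)
  then show ?thesis using subsp_closed_finsum_smult[OF M(1), of "\<lambda>j. delta (\<theta> j) x"] M(2) by simp
qed

end

section \<open>Left coideal subalgebras\<close>

context hopf_algebra
begin

text \<open>
  Left coideals are described by functionals here. The description by representatives of coproducts is
  equivalent, by \<open>left_coideal_imp_coideal_subalgebra\<close> and \<open>coideal_subalgebra_imp_left_coideal\<close>.
\<close>

definition coideal_subalgebra :: "'h set \<Rightarrow> bool" where
  "coideal_subalgebra A \<longleftrightarrow> subsp A \<and> \<one> \<in> A \<and> (\<forall>x\<in>A. \<forall>y\<in>A. x \<otimes> y \<in> A) \<and>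
     (\<forall>\<phi>\<in>dual H. \<forall>a\<in>A. delta \<phi> a \<in> A)"

lemma coideal_subalgebraD:
  assumes "coideal_subalgebra A"
  shows "subsp A" "\<one> \<in> A" "x \<in> A \<Longrightarrow> y \<in> A \<Longrightarrow> x \<otimes> y \<in> A" "\<phi> \<in> dual H \<Longrightarrow> x \<in> A \<Longrightarrow> delta \<phi> x \<in> A"
    "x \<in> A \<Longrightarrow> x \<in> carrier H"
  using assms subspD(1)[of A] unfolding coideal_subalgebra_def by blast+

lemma left_coideal_imp_coideal_subalgebra:
  assumes "left_coideal_subalgebra H N"
  shows "coideal_subalgebra N"
proof -
  have N: "subring N H" "\<And>c x. x \<in> N \<Longrightarrow> c \<odot> x \<in> N"
    and cm: "\<And>x. x \<in> N \<Longrightarrow> \<exists>p\<in>comult H x. Poly_Mapping.keys p \<subseteq> carrier H \<times> N"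
    using assms unfolding left_coideal_subalgebra_def by auto
  have s: "subsp N"
    unfolding subsp_def using subringE(1,2,7)[OF N(1)] N(2) by blast
  have d: "delta \<phi> x \<in> N" if \<phi>: "\<phi> \<in> dual H" and x: "x \<in> N" for \<phi> x
  proof (rule ccontr)
    have xc: "x \<in> carrier H" using x subspD(1)[OF s] by blast
    assume "delta \<phi> x \<notin> N"
    then obtain \<psi> where \<psi>: "\<psi> \<in> dual H" "\<forall>n\<in>N. \<psi> n = 0" "\<psi> (delta \<phi> x) = 1"
      using dual_separates_subsp[OF s delta_closed[OF xc]] by blast
    obtain p where p: "p \<in> comult H x" "Poly_Mapping.keys p \<subseteq> carrier H \<times> N" using cm[OF x] by blast
    have "\<psi> (delta \<phi> x) = extend_form (case_prod (\<lambda>a b. \<phi> a * \<psi> b)) p"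
      using extend_form_comult[OF xc p(1) bilinear_mult[OF \<phi> \<psi>(1)]] by (simp add: dual_delta[OF \<psi>(1) xc])
    also have "\<dots> = 0" unfolding extend_form_def by (rule sum.neutral) (use p(2) \<psi>(2) in auto)
    finally show False using \<psi>(3) by simp
  qed
  show ?thesis
    unfolding coideal_subalgebra_def using s d subringE(3,6)[OF N(1)] by blast
qed

lemma tensor_null_uminus: "p \<in> tensor_null H \<Longrightarrow> - p \<in> tensor_null H"
proof (induction rule: tensor_null.induct)
  case (plus p q)
  then show ?case using tensor_null.plus[of "- p" H "- q"] by simp
next
  case (add_fst a a' y c)
  then show ?case using tensor_null.add_fst[of a H a' y "- c"] by (simp add: single_uminus algebra_simps)
next
  case (add_snd a y y' c)
  then show ?case using tensor_null.add_snd[of a H y y' "- c"] by (simp add: single_uminus algebra_simps)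
next
  case (smult_fst a y d c)
  then show ?case using tensor_null.smult_fst[of a H y d "- c"] by (simp add: single_uminus algebra_simps)
next
  case (smult_snd a y d c)
  then show ?case using tensor_null.smult_snd[of a H y d "- c"] by (simp add: single_uminus algebra_simps)
qed (simp add: tensor_null.zero)

definition teq :: "(('h \<times> 'h) \<Rightarrow>\<^sub>0 'k) \<Rightarrow> (('h \<times> 'h) \<Rightarrow>\<^sub>0 'k) \<Rightarrow> bool" (infix "\<approx>\<^sub>T" 50) where
  "p \<approx>\<^sub>T q \<longleftrightarrow> p - q \<in> tensor_null H"

lemma teq_refl [simp]: "p \<approx>\<^sub>T p"
  by (simp add: teq_def tensor_null.zero)

lemma teq_sym: "p \<approx>\<^sub>T q \<Longrightarrow> q \<approx>\<^sub>T p"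
  unfolding teq_def using tensor_null_uminus[of "p - q"] by simp

lemma teq_trans [trans]: "p \<approx>\<^sub>T q \<Longrightarrow> q \<approx>\<^sub>T r \<Longrightarrow> p \<approx>\<^sub>T r"
  unfolding teq_def using tensor_null.plus[of "p - q" H "q - r"] by simp

lemma teq_add: "p \<approx>\<^sub>T q \<Longrightarrow> p' \<approx>\<^sub>T q' \<Longrightarrow> p + p' \<approx>\<^sub>T q + q'"
  unfolding teq_def using tensor_null.plus[of "p - q" H "p' - q'"] by (simp add: algebra_simps)

lemma teq_sum: "(\<And>i. i \<in> I \<Longrightarrow> p i \<approx>\<^sub>T q i) \<Longrightarrow> (\<Sum>i\<in>I. p i) \<approx>\<^sub>T (\<Sum>i\<in>I. q i)"
  by (induction I rule: infinite_finite_induct) (auto intro: teq_add)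

lemma teq_add_fst:
  "a \<in> carrier H \<Longrightarrow> a' \<in> carrier H \<Longrightarrow> y \<in> carrier H \<Longrightarrow>
    Poly_Mapping.single (a \<oplus> a', y) c \<approx>\<^sub>T Poly_Mapping.single (a, y) c + Poly_Mapping.single (a', y) c"
  unfolding teq_def using tensor_null.add_fst[of a H a' y c] by (simp add: diff_diff_eq)

lemma teq_add_snd:
  "a \<in> carrier H \<Longrightarrow> y \<in> carrier H \<Longrightarrow> y' \<in> carrier H \<Longrightarrow>
    Poly_Mapping.single (a, y \<oplus> y') c \<approx>\<^sub>T Poly_Mapping.single (a, y) c + Poly_Mapping.single (a, y') c"
  unfolding teq_def using tensor_null.add_snd[of a H y y' c] by (simp add: diff_diff_eq)

lemma teq_smult_fst: "a \<in> carrier H \<Longrightarrow> y \<in> carrier H \<Longrightarrow>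
    Poly_Mapping.single (d \<odot> a, y) c \<approx>\<^sub>T Poly_Mapping.single (a, y) (c * d)"
  unfolding teq_def by (rule tensor_null.smult_fst)

lemma teq_smult_snd: "a \<in> carrier H \<Longrightarrow> y \<in> carrier H \<Longrightarrow>
    Poly_Mapping.single (a, d \<odot> y) c \<approx>\<^sub>T Poly_Mapping.single (a, y) (c * d)"
  unfolding teq_def by (rule tensor_null.smult_snd)

lemma teq_finsum_fst:
  assumes y: "y \<in> carrier H" and "finite I" "x \<in> I \<rightarrow> carrier H"
  shows "Poly_Mapping.single (\<Oplus>i\<in>I. x i, y) c \<approx>\<^sub>T (\<Sum>i\<in>I. Poly_Mapping.single (x i, y) c)"
  using assms(2,3)
proof (induction I rule: finite_induct)
  case empty
  show ?case using teq_smult_fst[OF zero_closed y, of 0 c] by simp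
next
  case (insert i I)
  then have xi: "x \<in> I \<rightarrow> carrier H" "x i \<in> carrier H" by auto
  have "Poly_Mapping.single (\<Oplus>i\<in>insert i I. x i, y) c \<approx>\<^sub>T
      Poly_Mapping.single (x i, y) c + Poly_Mapping.single (\<Oplus>i\<in>I. x i, y) c"
    using teq_add_fst[OF xi(2) finsum_closed[OF xi(1)] y] insert xi by simp
  also have "\<dots> \<approx>\<^sub>T Poly_Mapping.single (x i, y) c + (\<Sum>i\<in>I. Poly_Mapping.single (x i, y) c)"
    by (rule teq_add[OF teq_refl insert.IH[OF xi(1)]])
  finally show ?case using insert by simp
qed

lemma teq_finsum_snd:
  assumes y: "y \<in> carrier H" and "finite I" "x \<in> I \<rightarrow> carrier H"
  shows "Poly_Mapping.single (y, \<Oplus>i\<in>I. x i) c \<approx>\<^sub>T (\<Sum>i\<in>I. Poly_Mapping.single (y, x i) c)"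
  using assms(2,3)
proof (induction I rule: finite_induct)
  case empty
  show ?case using teq_smult_snd[OF y zero_closed, of 0 c] by simp
next
  case (insert i I)
  then have xi: "x \<in> I \<rightarrow> carrier H" "x i \<in> carrier H" by auto
  have "Poly_Mapping.single (y, \<Oplus>i\<in>insert i I. x i) c \<approx>\<^sub>T
      Poly_Mapping.single (y, x i) c + Poly_Mapping.single (y, \<Oplus>i\<in>I. x i) c"
    using teq_add_snd[OF y xi(2) finsum_closed[OF xi(1)]] insert xi by simp
  also have "\<dots> \<approx>\<^sub>T Poly_Mapping.single (y, x i) c + (\<Sum>i\<in>I. Poly_Mapping.single (y, x i) c)"
    by (rule teq_add[OF teq_refl insert.IH[OF xi(1)]])
  finally show ?case using insert by simp
qed

lemma formal_sum_eq: "p = (\<Sum>k\<in>Poly_Mapping.keys p. Poly_Mapping.single k (Poly_Mapping.lookup p k))"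
proof (rule poly_mapping_eqI)
  fix u
  have "Poly_Mapping.lookup (\<Sum>k\<in>Poly_Mapping.keys p. Poly_Mapping.single k (Poly_Mapping.lookup p k)) u
      = (\<Sum>k\<in>Poly_Mapping.keys p. if k = u then Poly_Mapping.lookup p k else 0)"
    by (simp add: lookup_sum lookup_single when_def)
  then show "Poly_Mapping.lookup p u = Poly_Mapping.lookup (\<Sum>k\<in>Poly_Mapping.keys p. Poly_Mapping.single k (Poly_Mapping.lookup p k)) u"
    by (simp add: sum.delta in_keys_iff)
qed

lemma keys_sum_subset: "(\<And>i. i \<in> I \<Longrightarrow> Poly_Mapping.keys (p i) \<subseteq> U) \<Longrightarrow> Poly_Mapping.keys (\<Sum>i\<in>I. p i) \<subseteq> U"
  by (induction I rule: infinite_finite_induct) (simp_all add: keys_plus_subset)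

text \<open>
  Expanding the left legs of the coproduct of \<open>m\<close> in a frame gives a representative whose right legs are
  partial coproducts of \<open>m\<close>.
\<close>

lemma comult_representative:
  assumes m: "m \<in> carrier H" and d: "\<And>\<phi>. \<phi> \<in> dual H \<Longrightarrow> delta \<phi> m \<in> N"
  shows "\<exists>p\<in>comult H m. Poly_Mapping.keys p \<subseteq> carrier H \<times> N"
proof -
  let ?K = "Poly_Mapping.keys (sweedler H m)"
  let ?w = "Poly_Mapping.lookup (sweedler H m)"
  note kc = sweedler_comult(2)[OF m]
  have "finite (fst ` ?K)" "fst ` ?K \<subseteq> carrier H" using kc by auto
  from frame_exists[OF this] obtain n u f where F: "frame n u f" and k: "fst ` ?K \<subseteq> frame_span n u f" by blast
  note uf = frameD[OF F]
  define p where "p = (\<Sum>i<n. Poly_Mapping.single (u i, delta (f i) m) (1::'k))"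
  have "sweedler H m = (\<Sum>k\<in>?K. Poly_Mapping.single k (?w k))" by (rule formal_sum_eq)
  also have "\<dots> \<approx>\<^sub>T (\<Sum>k\<in>?K. \<Sum>i<n. Poly_Mapping.single (u i, ?w k \<odot> (f i (fst k) \<odot> snd k)) 1)"
  proof (rule teq_sum)
    fix k assume kK: "k \<in> ?K"
    obtain a c where ac: "k = (a, c)" by (cases k)
    have c: "c \<in> carrier H" "a \<in> carrier H" "a \<in> frame_span n u f" using kK kc k ac by (auto dest!: subsetD)
    have a: "a = (\<Oplus>i\<in>{..<n}. f i a \<odot> u i)"
    proof (rule dual_eqI[OF c(2)])
      fix \<chi> assume \<chi>: "\<chi> \<in> dual H"
      show "\<chi> a = \<chi> (\<Oplus>i\<in>{..<n}. f i a \<odot> u i)"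
        by (subst dual_finsum[OF \<chi>]) (auto simp: uf dualD(2)[OF \<chi>] frame_spanD[OF c(3) \<chi>])
    qed (auto simp: uf intro!: finsum_closed)
    have "Poly_Mapping.single (\<Oplus>i\<in>{..<n}. f i a \<odot> u i, c) (?w k)
        \<approx>\<^sub>T (\<Sum>i<n. Poly_Mapping.single (f i a \<odot> u i, c) (?w k))"
      by (rule teq_finsum_fst[OF c(1)]) (auto simp: uf)
    also have "\<dots> \<approx>\<^sub>T (\<Sum>i<n. Poly_Mapping.single (u i, ?w k \<odot> (f i a \<odot> c)) 1)"
    proof (rule teq_sum)
      fix i assume "i \<in> {..<n}"
      then have ui: "u i \<in> carrier H" by (simp add: uf)
      have "Poly_Mapping.single (f i a \<odot> u i, c) (?w k) \<approx>\<^sub>T Poly_Mapping.single (u i, c) (?w k * f i a)"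
        by (rule teq_smult_fst[OF ui c(1)])
      also have "\<dots> \<approx>\<^sub>T Poly_Mapping.single (u i, (?w k * f i a) \<odot> c) 1"
        using teq_sym[OF teq_smult_snd[OF ui c(1), of "?w k * f i a" 1]] by simp
      finally show "Poly_Mapping.single (f i a \<odot> u i, c) (?w k) \<approx>\<^sub>T Poly_Mapping.single (u i, ?w k \<odot> (f i a \<odot> c)) 1"
        by (simp add: smult_simps(3) c)
    qed
    finally show "Poly_Mapping.single k (?w k) \<approx>\<^sub>T (\<Sum>i<n. Poly_Mapping.single (u i, ?w k \<odot> (f i (fst k) \<odot> snd k)) 1)"
      using a ac by simp
  qed
  also have "\<dots> = (\<Sum>i<n. \<Sum>k\<in>?K. Poly_Mapping.single (u i, ?w k \<odot> (f i (fst k) \<odot> snd k)) 1)"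
    by (rule sum.swap)
  also have "\<dots> \<approx>\<^sub>T p"
    unfolding p_def
  proof (rule teq_sum)
    fix i assume "i \<in> {..<n}"
    then have ui: "u i \<in> carrier H" by (simp add: uf)
    show "(\<Sum>k\<in>?K. Poly_Mapping.single (u i, ?w k \<odot> (f i (fst k) \<odot> snd k)) 1)
        \<approx>\<^sub>T Poly_Mapping.single (u i, delta (f i) m) 1"
      unfolding delta_def sweedler_sum_def
      by (rule teq_sym[OF teq_finsum_snd[OF ui]]) (use kc in auto)
  qed
  finally have *: "sweedler H m \<approx>\<^sub>T p" .
  obtain q where q: "comult H m = tensor_class H q" by (rule comult_class[OF m])
  have "sweedler H m \<approx>\<^sub>T q" using sweedler_comult(1)[OF m] unfolding q teq_def tensor_class_def by simp
  then have "p \<approx>\<^sub>T q" using teq_trans[OF teq_sym[OF *]] by blast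
  then have "p \<in> comult H m" unfolding q teq_def tensor_class_def by simp
  moreover have "Poly_Mapping.keys p \<subseteq> carrier H \<times> N"
    unfolding p_def by (rule keys_sum_subset) (auto simp: uf d)
  ultimately show ?thesis by blast
qed

lemma coideal_subalgebra_imp_left_coideal:
  assumes "coideal_subalgebra N"
  shows "left_coideal_subalgebra H N"
proof -
  note N = coideal_subalgebraD[OF assms]
  note s = subspD[OF N(1)]
  have "subring N H"
    by (rule subringI) (use N s in auto)
  then show ?thesis
    unfolding left_coideal_subalgebra_def using s(4) comult_representative[of _ N] N(4,5) by blast
qed

end

context framed_hopf
begin

text \<open>
  Here \<open>P\<close> is the multiplication of \<open>H\<close> or its opposite, \<open>\<sigma>\<close> is the antipode for \<open>P\<close>, and \<open>\<tau>\<close> is the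
  inverse of \<open>\<sigma>\<close>. The matrices \<open>EE\<close> and \<open>DD\<close> consist of the functionals \<open>p \<mapsto> f\<^sub>i(b\<^sub>l \<sigma>(p))\<close> and
  \<open>p \<mapsto> f\<^sub>i(b\<^sub>l p)\<close> for the product \<open>P\<close>; their partial coproducts form a twist of \<open>A\<close>. They compose to
  identity matrices by the antipode axioms. A nonzero \<open>a\<close> has a partial coproduct \<open>a'\<close> of counit 1, and
  \<open>\<one> = \<Sum> a'\<^sub>2 \<tau>(a'\<^sub>1)\<close> writes the unit in terms of right legs of the coproduct of \<open>a\<close>.
\<close>

lemma one_sided_integral:
  fixes P :: "'h \<Rightarrow> 'h \<Rightarrow> 'h" and \<sigma> \<tau> :: "'h \<Rightarrow> 'h"
  assumes P_left: "\<And>y. y \<in> carrier H \<Longrightarrow> (\<lambda>x. P x y) \<in> endo"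
    and P_right: "\<And>x. x \<in> carrier H \<Longrightarrow> (\<lambda>y. P x y) \<in> endo"
    and P_assoc: "\<And>x y z. x \<in> carrier H \<Longrightarrow> y \<in> carrier H \<Longrightarrow> z \<in> carrier H \<Longrightarrow> P (P x y) z = P x (P y z)"
    and P_one: "\<And>x. x \<in> carrier H \<Longrightarrow> P \<one> x = x" "\<And>x. x \<in> carrier H \<Longrightarrow> P x \<one> = x"
    and P_counit: "\<And>x y. x \<in> carrier H \<Longrightarrow> y \<in> carrier H \<Longrightarrow> \<epsilon> (P x y) = \<epsilon> x * \<epsilon> y"
    and P_int: "\<And>x. x \<in> carrier H \<Longrightarrow> P x \<Lambda> = \<epsilon> x \<odot> \<Lambda>"
    and P_comult: "\<And>g x y. bilinear_form H g \<Longrightarrow> x \<in> carrier H \<Longrightarrow> y \<in> carrier H \<Longrightarrow>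
      Sw g (P x y) = Sw (\<lambda>p q. Sw (\<lambda>p' q'. g (P p p') (P q q')) y) x"
    and \<sigma>: "\<sigma> \<in> endo" and \<sigma>_mult: "\<And>x y. x \<in> carrier H \<Longrightarrow> y \<in> carrier H \<Longrightarrow> \<sigma> (P x y) = P (\<sigma> y) (\<sigma> x)"
    and \<sigma>_left: "\<And>\<phi> x. \<phi> \<in> dual H \<Longrightarrow> x \<in> carrier H \<Longrightarrow> Sw (\<lambda>p q. \<phi> (P (\<sigma> p) q)) x = \<epsilon> x * \<phi> \<one>"
    and \<sigma>_right: "\<And>\<phi> x. \<phi> \<in> dual H \<Longrightarrow> x \<in> carrier H \<Longrightarrow> Sw (\<lambda>p q. \<phi> (P p (\<sigma> q))) x = \<epsilon> x * \<phi> \<one>"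
    and \<tau>: "\<tau> \<in> endo"
    and \<tau>_twisted: "\<And>\<phi> x. \<phi> \<in> dual H \<Longrightarrow> x \<in> carrier H \<Longrightarrow> Sw (\<lambda>p q. \<phi> (P q (\<tau> p))) x = \<epsilon> x * \<phi> \<one>"
    and cs: "coideal_subalgebra A" and A_mult: "\<And>x y. x \<in> A \<Longrightarrow> y \<in> A \<Longrightarrow> P x y \<in> A"
  shows "\<exists>l\<in>A. \<epsilon> l = 1 \<and> (\<forall>a\<in>A. P a l = \<epsilon> a \<odot> l)"
proof -
  note A = coideal_subalgebraD(1,2)[OF cs] A_mult
  note A_coideal = coideal_subalgebraD(4)[OF cs]
  have Pc [simp]: "P x y \<in> carrier H" if "x \<in> carrier H" "y \<in> carrier H" for x y
    using endoD(1)[OF P_right[OF that(1)] that(2)] .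
  note \<sigma>c [simp] = endoD(1)[OF \<sigma>] and \<tau>c [simp] = endoD(1)[OF \<tau>]
  define EE where "EE i l p = f i (P (b l) (\<sigma> p))" for i l p
  define DD where "DD i l p = f i (P (b l) p)" for i l p
  have lf: "(\<lambda>z. \<phi> (P z c)) \<in> dual H" and rf: "(\<lambda>z. \<phi> (P c z)) \<in> dual H"
    if "\<phi> \<in> dual H" "c \<in> carrier H" for \<phi> c
    using dual_endo[OF that(1) P_left[OF that(2)]] dual_endo[OF that(1) P_right[OF that(2)]] .
  have ex: "(\<Sum>r<n. f r z * \<phi> (P (b r) c)) = \<phi> (P z c)"
    if "\<phi> \<in> dual H" "c \<in> carrier H" "z \<in> carrier H" for \<phi> c z
    using dual_expand[OF that(3) lf[OF that(1,2)]] by simp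
  have DD: "DD i l \<in> dual H" if "i < n" "l < n" for i l
    unfolding DD_def by (rule rf[OF f_dual[OF that(1)] b_closed[OF that(2)]])
  have EE: "EE i l \<in> dual H" if "i < n" "l < n" for i l
    unfolding EE_def by (rule dual_endo[OF rf[OF f_dual[OF that(1)] b_closed[OF that(2)]] \<sigma>])
  have EE_mult: "delta (EE i l) (P x y) = (\<Oplus>r\<in>{..<n}. P (delta (EE i r) x) (delta (EE r l) y))"
    if il: "i < n" "l < n" and x: "x \<in> carrier H" and y: "y \<in> carrier H" for i l x y
  proof (rule dual_eqI)
    fix \<chi> assume \<chi>: "\<chi> \<in> dual H"
    have prod: "\<chi> (P (delta \<alpha> x) (delta \<beta> y)) = Sw (\<lambda>p q. Sw (\<lambda>p' q'. \<alpha> p * (\<beta> p' * \<chi> (P q q'))) y) x" for \<alpha> \<beta>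
    proof -
      have "\<chi> (P (delta \<alpha> x) (delta \<beta> y)) = Sw (\<lambda>p q. \<alpha> p * \<chi> (P q (delta \<beta> y))) x"
        by (rule dual_delta[OF lf[OF \<chi> delta_closed[OF y]] x])
      also have "\<dots> = Sw (\<lambda>p q. Sw (\<lambda>p' q'. \<alpha> p * (\<beta> p' * \<chi> (P q q'))) y) x"
        by (rule sw_cong[OF x]) (simp add: dual_delta[OF rf[OF \<chi>] y] sw_cmult)
      finally show ?thesis .
    qed
    have "\<chi> (delta (EE i l) (P x y)) = Sw (\<lambda>p q. Sw (\<lambda>p' q'. EE i l (P p p') * \<chi> (P q q')) y) x"
      unfolding dual_delta[OF \<chi> Pc[OF x y]] by (rule P_comult[OF bilinear_mult[OF EE[OF il] \<chi>] x y])
    also have "\<dots> = Sw (\<lambda>p q. Sw (\<lambda>p' q'. \<Sum>r<n. EE i r p * (EE r l p' * \<chi> (P q q'))) y) x"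
    proof (intro sw_cong[OF x] sw_cong[OF y])
      fix p q p' q' assume c: "p \<in> carrier H" "p' \<in> carrier H"
      have "EE i l (P p p') = f i (P (P (b l) (\<sigma> p')) (\<sigma> p))"
        unfolding EE_def using c il by (simp add: \<sigma>_mult P_assoc)
      also have "\<dots> = (\<Sum>r<n. EE r l p' * EE i r p)"
        unfolding EE_def by (rule ex[symmetric]) (use c il f_dual in auto)
      finally show "EE i l (P p p') * \<chi> (P q q') = (\<Sum>r<n. EE i r p * (EE r l p' * \<chi> (P q q')))"
        by (simp add: sum_distrib_left sum_distrib_right mult_ac)
    qed
    also have "\<dots> = (\<Sum>r<n. \<chi> (P (delta (EE i r) x) (delta (EE r l) y)))" by (simp add: sw_sum prod)
    also have "\<dots> = \<chi> (\<Oplus>r\<in>{..<n}. P (delta (EE i r) x) (delta (EE r l) y))"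
      by (rule dual_finsum[OF \<chi>, symmetric]) (auto simp: x y)
    finally show "\<chi> (delta (EE i l) (P x y)) = \<chi> (\<Oplus>r\<in>{..<n}. P (delta (EE i r) x) (delta (EE r l) y))" .
  qed (auto simp: x y intro!: finsum_closed)
  have EE_DD: "Sw (\<lambda>p q. \<Sum>r<n. DD r l p * EE i r q) x = \<epsilon> x * (if i = l then 1 else 0)"
    if il: "i < n" "l < n" and x: "x \<in> carrier H" for i l x
  proof -
    have "Sw (\<lambda>p q. \<Sum>r<n. DD r l p * EE i r q) x = Sw (\<lambda>p q. f i (P (b l) (P p (\<sigma> q)))) x"
      unfolding DD_def EE_def by (rule sw_cong[OF x]) (use il in \<open>simp add: ex f_dual P_assoc\<close>)
    then show ?thesis using \<sigma>_right[OF rf[OF f_dual[OF il(1)] b_closed[OF il(2)]] x] il by (simp add: f_b P_one)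
  qed
  have DD_EE: "Sw (\<lambda>p q. \<Sum>r<n. EE r l p * DD i r q) x = \<epsilon> x * (if i = l then 1 else 0)"
    if il: "i < n" "l < n" and x: "x \<in> carrier H" for i l x
  proof -
    have "Sw (\<lambda>p q. \<Sum>r<n. EE r l p * DD i r q) x = Sw (\<lambda>p q. f i (P (b l) (P (\<sigma> p) q))) x"
      unfolding DD_def EE_def by (rule sw_cong[OF x]) (use il in \<open>simp add: ex f_dual P_assoc\<close>)
    then show ?thesis using \<sigma>_left[OF rf[OF f_dual[OF il(1)] b_closed[OF il(2)]] x] il by (simp add: f_b P_one)
  qed
  have DD_f: "f i p = (\<Sum>l<n. f l \<one> * DD i l p)" if "i < n" "p \<in> carrier H" for i p
    unfolding DD_def using ex[OF f_dual[OF that(1)] that(2) one_closed] that by (simp add: P_one)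
  have P_t: "(\<Oplus>i\<in>{..<n}. P (delta (f i) x) (\<tau> (b i))) = \<epsilon> x \<odot> \<one>" if x: "x \<in> carrier H" for x
  proof (rule dual_eqI)
    fix \<chi> assume \<chi>: "\<chi> \<in> dual H"
    have "\<chi> (\<Oplus>i\<in>{..<n}. P (delta (f i) x) (\<tau> (b i))) = (\<Sum>i<n. \<chi> (P (delta (f i) x) (\<tau> (b i))))"
      by (rule dual_finsum[OF \<chi>]) (auto simp: x)
    also have "\<dots> = Sw (\<lambda>p q. \<Sum>i<n. f i p * \<chi> (P q (\<tau> (b i)))) x"
      unfolding sw_sum by (rule sum.cong) (auto simp: dual_delta[OF lf[OF \<chi>] x])
    also have "\<dots> = Sw (\<lambda>p q. \<chi> (P q (\<tau> p))) x"
    proof (rule sw_cong[OF x])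
      fix p q assume "p \<in> carrier H" "q \<in> carrier H"
      from dual_expand[OF this(1) dual_endo[OF rf[OF \<chi> this(2)] \<tau>]]
      show "(\<Sum>i<n. f i p * \<chi> (P q (\<tau> (b i)))) = \<chi> (P q (\<tau> p))" by simp
    qed
    finally show "\<chi> (\<Oplus>i\<in>{..<n}. P (delta (f i) x) (\<tau> (b i))) = \<chi> (\<epsilon> x \<odot> \<one>)"
      by (simp add: \<tau>_twisted[OF \<chi> x] dualD(2)[OF \<chi>])
  qed (auto simp: x intro!: finsum_closed)
  interpret V: vector_space sc by (rule vs)
  let ?C = "coords ` carrier H"
  let ?A = "coords ` A"
  define mul where "mul v w = coords (P (of_coords v) (of_coords w))" for v w
  define E where "E i l v = coords (delta (EE i l) (of_coords v))" for i l v
  define DV where "DV i l v = coords (delta (DD i l) (of_coords v))" for i l v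
  have AC: "x \<in> carrier H" if "x \<in> A" for x using subspD(1)[OF A(1)] that by blast
  have conv: "(\<Sum>r<n. coords (delta (\<alpha> r) (of_coords (coords (delta (\<beta> r) x))))) = (if i = l then coords x else 0)"
    if x: "x \<in> carrier H" and ab: "\<And>r. r < n \<Longrightarrow> \<alpha> r \<in> dual H" "\<And>r. r < n \<Longrightarrow> \<beta> r \<in> dual H"
      and c: "\<And>x. x \<in> carrier H \<Longrightarrow> Sw (\<lambda>p q. \<Sum>r<n. \<beta> r p * \<alpha> r q) x = \<epsilon> x * (if i = l then 1 else 0)"
    for \<alpha> \<beta> :: "nat \<Rightarrow> 'h \<Rightarrow> 'k" and i l :: nat and x
  proof -
    have "(\<Oplus>r\<in>{..<n}. delta (\<alpha> r) (delta (\<beta> r) x)) = (if i = l then x else \<zero>)"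
    proof (rule dual_eqI)
      fix \<chi> assume \<chi>: "\<chi> \<in> dual H"
      have "\<chi> (\<Oplus>r\<in>{..<n}. delta (\<alpha> r) (delta (\<beta> r) x)) = (\<Sum>r<n. \<chi> (delta (\<alpha> r) (delta (\<beta> r) x)))"
        by (rule dual_finsum[OF \<chi>]) (auto simp: x)
      also have "\<dots> = (\<Sum>r<n. Sw (\<lambda>u q. Sw (\<lambda>s t. \<beta> r s * \<alpha> r t) u * \<chi> q) x)"
        by (rule sum.cong) (auto simp: delta_delta ab x dual_delta[OF \<chi> x])
      also have "\<dots> = Sw (\<lambda>u q. \<Sum>r<n. Sw (\<lambda>s t. \<beta> r s * \<alpha> r t) u * \<chi> q) x" by (rule sw_sum[symmetric])
      also have "\<dots> = Sw (\<lambda>u q. \<epsilon> u * (if i = l then \<chi> q else 0)) x"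
      proof (rule sw_cong[OF x])
        fix u q assume u: "u \<in> carrier H"
        show "(\<Sum>r<n. Sw (\<lambda>s t. \<beta> r s * \<alpha> r t) u * \<chi> q) = \<epsilon> u * (if i = l then \<chi> q else 0)"
          using c[OF u] by (simp add: sw_sum sum_distrib_right[symmetric])
      qed
      also have "\<dots> = \<chi> (if i = l then x else \<zero>)"
        using sw_counit_left[OF x \<chi>] by (simp add: sw_zero dual_zero[OF \<chi>])
      finally show "\<chi> (\<Oplus>r\<in>{..<n}. delta (\<alpha> r) (delta (\<beta> r) x)) = \<chi> (if i = l then x else \<zero>)" .
    qed (auto simp: x intro!: finsum_closed)
    then have "coords (\<Oplus>r\<in>{..<n}. delta (\<alpha> r) (delta (\<beta> r) x)) = (if i = l then coords x else 0)"
      by (simp add: coords_zero)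
    then show ?thesis using coords_finsum[of "{..<n}" "\<lambda>r. delta (\<alpha> r) (delta (\<beta> r) x)"] x by auto
  qed
  have unit_in_span: "coords \<one> \<in> V.span {mul (DV i l (coords a)) c |i l c. i < n \<and> l < n \<and> c \<in> ?C}"
    if a: "a \<in> A" "coords a \<noteq> 0" for a
  proof -
    let ?S = "{mul (DV i l (coords a)) c |i l c. i < n \<and> l < n \<and> c \<in> ?C}"
    note ac = AC[OF a(1)]
    define N where "N = {x \<in> carrier H. coords x \<in> V.span ?S}"
    have N: "subsp N" unfolding subsp_def N_def
      by (auto simp: coords_zero coords_add coords_smult V.span_zero V.span_add V.span_scale)
    define M where "M = {x \<in> carrier H. \<forall>c\<in>carrier H. P x c \<in> N}"
    have M: "subsp M" unfolding subsp_def
    proof (intro conjI ballI allI)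
      show "M \<subseteq> carrier H" unfolding M_def by blast
      show "\<zero> \<in> M" using endoD(3)[OF P_left, of _ \<zero> 0] subspD(2)[OF N] by (auto simp: M_def)
      show "x \<oplus> y \<in> M" if "x \<in> M" "y \<in> M" for x y
        using that endoD(2)[OF P_left, of _ x y] subspD(3)[OF N] by (auto simp: M_def)
      show "c \<odot> x \<in> M" if "x \<in> M" for c x
        using that endoD(3)[OF P_left, of _ x c] subspD(4)[OF N] by (auto simp: M_def)
    qed
    have 1: "delta (DD i l) a \<in> M" if "i < n" "l < n" for i l
    proof -
      have "coords (P (delta (DD i l) a) c) \<in> V.span ?S" if c: "c \<in> carrier H" for c
      proof (rule V.span_base)
        have "coords (P (delta (DD i l) a) c) = mul (DV i l (coords a)) (coords c)"
          by (simp add: mul_def DV_def ac c)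
        then show "coords (P (delta (DD i l) a) c) \<in> ?S" using \<open>i < n\<close> \<open>l < n\<close> c by blast
      qed
      then show ?thesis by (simp add: M_def N_def ac)
    qed
    have 2: "delta (f j) a \<in> M" if "j < n" for j
      by (rule delta_expand[OF M 1[OF that] ac DD_f[OF that]])
    have 3: "delta \<psi> a \<in> M" if "\<psi> \<in> dual H" for \<psi>
    proof (rule delta_expand[OF M 2 ac])
      show "\<psi> p = (\<Sum>j<n. \<psi> (b j) * f j p)" if "p \<in> carrier H" for p
        using dual_expand[OF that \<open>\<psi> \<in> dual H\<close>] by (simp add: mult.commute)
    qed
    have "a \<notin> {\<zero>}" using a(2) coords_zero by auto
    then obtain \<phi> where \<phi>: "\<phi> \<in> dual H" "\<phi> a = 1"
      using dual_separates_subsp[OF subsp_zero ac] by blast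
    have "(\<Oplus>i\<in>{..<n}. P (delta (f i) (delta \<phi> a)) (\<tau> (b i))) \<in> N"
    proof (rule subsp_finsum[OF N])
      fix i assume "i \<in> {..<n}"
      then show "P (delta (f i) (delta \<phi> a)) (\<tau> (b i)) \<in> N"
        using 3[OF dual_conv[OF \<phi>(1) f_dual]] by (simp add: delta_delta[OF \<phi>(1) f_dual ac] M_def)
    qed simp
    then have "\<one> \<in> N" using P_t[of "delta \<phi> a"] ac by (simp add: counit_delta[OF \<phi>(1) ac] \<phi>(2) smult_simps(4))
    then show ?thesis by (simp add: N_def)
  qed
  interpret twisted: twisted_subalgebra sc mul "coords \<one>" ?C ?A n E DV
  proof (intro twisted_subalgebra.intro twisted_subalgebra_axioms.intro)
    show "vector_space sc" by (rule vs)
    show "mul (x + y) z = mul x z + mul y z" for x y z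
      by (simp add: mul_def of_coords_add endoD(2)[OF P_left] coords_add)
    show "mul x (y + z) = mul x y + mul x z" for x y z
      by (simp add: mul_def of_coords_add endoD(2)[OF P_right] coords_add)
    show "mul (sc c x) y = sc c (mul x y)" for c x y
      by (simp add: mul_def of_coords_smult endoD(3)[OF P_left] coords_smult)
    show "mul x (sc c y) = sc c (mul x y)" for c x y
      by (simp add: mul_def of_coords_smult endoD(3)[OF P_right] coords_smult)
    show "mul (mul x y) z = mul x (mul y z)" for x y z
      by (simp add: mul_def P_assoc)
    show "V.subspace ?C" by (rule subspace_coords[OF subsp_carrier])
    show "fin_dim sc ?C" by (rule fin_dim_coords)
    show "mul x y \<in> ?C" for x y by (simp add: mul_def)
    show "V.subspace ?A" by (rule subspace_coords[OF A(1)])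
    show "?A \<subseteq> ?C" using AC by blast
    show "mul x y \<in> ?A" if "x \<in> ?A" "y \<in> ?A" for x y
      using that AC A(3) by (auto simp: mul_def)
    show "coords \<one> \<in> ?A" using A(2) by blast
    show "mul (coords \<one>) x = x" "mul x (coords \<one>) = x" if "x \<in> ?C" for x
      using that by (auto simp: mul_def P_one)
    show "coords \<one> \<noteq> 0"
    proof
      assume "coords \<one> = 0"
      then have "\<one> = \<zero>" by (intro coords_inj) (simp_all add: coords_zero)
      then show False using counit_one counit_zero by simp
    qed
    fix i l assume il: "i < n" "l < n"
    show "Vector_Spaces.linear sc sc (E i l)" "Vector_Spaces.linear sc sc (DV i l)"
      unfolding E_def DV_def by (rule linear_transfer[OF endo_delta[OF EE[OF il]]])
        (rule linear_transfer[OF endo_delta[OF DD[OF il]]])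
    show "E i l x \<in> ?C" "DV i l x \<in> ?C" for x by (auto simp: E_def DV_def)
    show "E i l x \<in> ?A" "DV i l x \<in> ?A" if "x \<in> ?A" for x
      using that AC A_coideal[OF EE[OF il]] A_coideal[OF DD[OF il]] by (auto simp: E_def DV_def)
    show "E i l (mul x y) = (\<Sum>r<n. mul (E i r x) (E r l y))" for x y
      using il coords_finsum[of "{..<n}" "\<lambda>r. P (delta (EE i r) (of_coords x)) (delta (EE r l) (of_coords y))"]
      by (auto simp: E_def mul_def EE_mult)
    show "(\<Sum>r<n. E i r (DV r l x)) = (if i = l then x else 0)" if "x \<in> ?C" for x
      using that conv[of _ "EE i" "\<lambda>r. DD r l" i l] il EE DD EE_DD by (auto simp: E_def DV_def)
    show "(\<Sum>r<n. DV i r (E r l x)) = (if i = l then x else 0)" if "x \<in> ?C" for x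
      using that conv[of _ "DD i" "\<lambda>r. EE r l" i l] il EE DD DD_EE by (auto simp: E_def DV_def)
  next
    show "coords \<one> \<in> V.span {mul (DV i l a) c |i l c. i < n \<and> l < n \<and> c \<in> ?C}" if "a \<in> ?A" "a \<noteq> 0" for a
      using that unit_in_span by blast
  qed
  have "\<exists>l\<in>?A. \<epsilon> (of_coords l) = 1 \<and> (\<forall>a\<in>?A. mul a l = sc (\<epsilon> (of_coords a)) l)"
  proof (rule twisted.left_integral_exists)
    show "\<epsilon> (of_coords (x + y)) = \<epsilon> (of_coords x) + \<epsilon> (of_coords y)" for x y by (simp add: of_coords_add counit_add)
    show "\<epsilon> (of_coords (sc c x)) = c * \<epsilon> (of_coords x)" for c x by (simp add: of_coords_smult counit_smult)
    show "\<epsilon> (of_coords (mul x y)) = \<epsilon> (of_coords x) * \<epsilon> (of_coords y)" for x y by (simp add: mul_def P_counit)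
    show "\<epsilon> (of_coords (coords \<one>)) = 1" by (simp add: counit_one)
    show "coords \<Lambda> \<in> ?C" using \<Lambda>(1) by blast
    show "\<epsilon> (of_coords (coords \<Lambda>)) = 1" using \<Lambda> by simp
    show "mul a (coords \<Lambda>) = sc (\<epsilon> (of_coords a)) (coords \<Lambda>)" for a
      by (simp add: mul_def \<Lambda>(1) P_int coords_smult)
  qed
  then obtain l where l: "l \<in> A" "\<epsilon> l = 1" "\<And>a. a \<in> A \<Longrightarrow> mul (coords a) (coords l) = sc (\<epsilon> a) (coords l)"
    using AC by auto
  have "P a l = \<epsilon> a \<odot> l" if "a \<in> A" for a
    using l(3)[OF that] AC[OF that] AC[OF l(1)] by (intro coords_inj) (auto simp: mul_def coords_smult)
  with l show ?thesis by blast
qed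

lemma left_integral:
  assumes A: "coideal_subalgebra A"
  shows "\<exists>l\<in>A. \<epsilon> l = 1 \<and> (\<forall>a\<in>A. a \<otimes> l = \<epsilon> a \<odot> l)"
  by (rule one_sided_integral[where P = "\<lambda>x y. x \<otimes> y" and \<sigma> = S and \<tau> = S_inv])
    (use endo_S[OF endo_id] endo_S_inv[OF endo_id] in \<open>simp_all add: m_assoc counit_mult \<Lambda> endo_mult_left
      endo_mult_right endo_id sw_mult antipode_mult sw_antipode_left sw_antipode_right sw_S_inv_right
      A coideal_subalgebraD(3)[OF A]\<close>)

lemma right_integral:
  assumes A: "coideal_subalgebra A"
  shows "\<exists>l\<in>A. \<epsilon> l = 1 \<and> (\<forall>a\<in>A. l \<otimes> a = \<epsilon> a \<odot> l)"
proof (rule one_sided_integral[where P = "\<lambda>x y. y \<otimes> x" and \<sigma> = S_inv and \<tau> = S])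
  show "Sw g (y \<otimes> x) = Sw (\<lambda>p q. Sw (\<lambda>p' q'. g (p' \<otimes> p) (q' \<otimes> q)) y) x"
    if "bilinear_form H g" "x \<in> carrier H" "y \<in> carrier H" for g x y
    unfolding sw_mult[OF that(3,2,1)] by (rule sw_swap)
qed (use endo_S[OF endo_id] endo_S_inv[OF endo_id] in \<open>simp_all add: m_assoc counit_mult mult.commute \<Lambda> endo_mult_left
      endo_mult_right endo_id S_inv_mult sw_S_inv_left sw_S_inv_right sw_antipode_left A coideal_subalgebraD(3)[OF A]\<close>)

end

context semisimple_hopf
begin

theorem integral_exists:
  assumes A: "coideal_subalgebra A"
  shows "\<exists>l. is_integral l A"
proof -
  obtain n b f where "frame n b f" "frame_span n b f = carrier H" using finite_dimensional by blast
  then interpret framed_hopf H n b f by unfold_locales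
  note AC = coideal_subalgebraD(5)[OF A]
  obtain l where l: "l \<in> A" "\<epsilon> l = 1" "\<forall>a\<in>A. a \<otimes> l = \<epsilon> a \<odot> l" using left_integral[OF A] by blast
  obtain r where r: "r \<in> A" "\<epsilon> r = 1" "\<forall>a\<in>A. r \<otimes> a = \<epsilon> a \<odot> r" using right_integral[OF A] by blast
  have "r \<otimes> l = \<epsilon> r \<odot> l" "r \<otimes> l = \<epsilon> l \<odot> r" using l r by blast+
  then have "r \<otimes> l = l" "r \<otimes> l = r" using l(1,2) r(1,2) AC by (simp_all add: smult_simps(4))
  then have "r = l" by simp
  then have "is_integral l A" unfolding is_integral_def using l r by blast
  then show ?thesis by blast
qed

lemma integral_of_eqI:
  assumes "is_integral l A" "A \<subseteq> carrier H"
  shows "integral_of H A = l"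
  unfolding integral_of_def
proof (rule the_equality)
  show "l \<in> A \<and> \<epsilon> l = 1 \<and> (\<forall>n\<in>A. n \<otimes> l = \<epsilon> n \<odot> l \<and> l \<otimes> n = \<epsilon> n \<odot> l)"
    using assms(1) unfolding is_integral_def .
  fix r assume r: "r \<in> A \<and> \<epsilon> r = 1 \<and> (\<forall>n\<in>A. n \<otimes> r = \<epsilon> n \<odot> r \<and> r \<otimes> n = \<epsilon> n \<odot> r)"
  have l: "l \<in> A" "\<epsilon> l = 1" "\<And>n. n \<in> A \<Longrightarrow> n \<otimes> l = \<epsilon> n \<odot> l \<and> l \<otimes> n = \<epsilon> n \<odot> l"
    using assms(1) unfolding is_integral_def by auto
  have "l \<otimes> r = \<epsilon> l \<odot> r" "l \<otimes> r = \<epsilon> r \<odot> l" using r l by blast+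
  then have "l \<otimes> r = r" "l \<otimes> r = l" using r l(1,2) assms(2) by (auto simp: smult_simps(4))
  then show "r = l" by simp
qed

lemma integral_of:
  assumes "left_coideal_subalgebra H A" shows "is_integral (integral_of H A) A"
proof -
  have A: "coideal_subalgebra A" by (rule left_coideal_imp_coideal_subalgebra[OF assms])
  obtain l where l: "is_integral l A" using integral_exists[OF A] by blast
  have "A \<subseteq> carrier H" using coideal_subalgebraD(5)[OF A] by blast
  from integral_of_eqI[OF l this] l show ?thesis by simp
qed

end

context hopf_algebra
begin

text \<open>
  The right legs of the coproduct of \<open>x\<close> may be taken in \<open>A\<close>.
\<close>

lemma sw_cong_coideal:
  assumes A: "coideal_subalgebra A" and x: "x \<in> A" and g: "bilinear_form H g" "bilinear_form H g'"
    and eq: "\<And>p q. p \<in> carrier H \<Longrightarrow> q \<in> A \<Longrightarrow> g p q = g' p q"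
  shows "Sw g x = Sw g' x"
proof -
  note xc = coideal_subalgebraD(5)[OF A x]
  obtain p where p: "p \<in> comult H x" "Poly_Mapping.keys p \<subseteq> carrier H \<times> A"
    using comult_representative[OF xc, of A] coideal_subalgebraD(4)[OF A _ x] by blast
  have "extend_form (case_prod g) p = extend_form (case_prod g') p"
    unfolding extend_form_def by (rule sum.cong) (use p(2) eq in auto)
  then show ?thesis using extend_form_comult[OF xc p(1)] g by metis
qed

lemma left_adjoint_closed [simp]: "a \<in> carrier H \<Longrightarrow> x \<in> carrier H \<Longrightarrow> left_adjoint H a x \<in> carrier H"
  unfolding left_adjoint_def by (rule sweedler_sum_closed) (auto simp: antipode_closed)

lemma dual_left_adjoint:
  "\<phi> \<in> dual H \<Longrightarrow> a \<in> carrier H \<Longrightarrow> x \<in> carrier H \<Longrightarrow> \<phi> (left_adjoint H a x) = Sw (\<lambda>p q. \<phi> (p \<otimes> x \<otimes> S q)) a"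
  unfolding left_adjoint_def by (rule dual_sweedler_sum) (auto simp: antipode_closed)

lemma counit_antipode:
  assumes x: "x \<in> carrier H" shows "\<epsilon> (S x) = \<epsilon> x"
proof -
  have e: "\<epsilon> \<in> dual H" using dual_counit[OF endo_id] by simp
  have "\<epsilon> (S x) = Sw (\<lambda>p q. \<epsilon> q * \<epsilon> (S p)) x"
    by (rule sw_counit_right[OF x, symmetric]) (rule dual_counit[OF endo_S[OF endo_id]])
  also have "\<dots> = Sw (\<lambda>p q. \<epsilon> (S p \<otimes> q)) x"
    by (rule sw_cong[OF x]) (simp add: counit_mult antipode_closed mult.commute)
  also have "\<dots> = \<epsilon> x" using sw_antipode_left[OF x e] by (simp add: counit_one)
  finally show ?thesis .
qed

lemma counit_left_adjoint:
  assumes a: "a \<in> carrier H" and x: "x \<in> carrier H"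
  shows "\<epsilon> (left_adjoint H a x) = \<epsilon> a * \<epsilon> x"
proof -
  have e: "\<epsilon> \<in> dual H" using dual_counit[OF endo_id] by simp
  have "\<epsilon> (left_adjoint H a x) = Sw (\<lambda>p q. \<epsilon> (p \<otimes> x \<otimes> S q)) a" by (rule dual_left_adjoint[OF e a x])
  also have "\<dots> = Sw (\<lambda>p q. \<epsilon> q * (\<epsilon> p * \<epsilon> x)) a"
    by (rule sw_cong[OF a]) (simp add: counit_mult antipode_closed counit_antipode x mult.commute)
  also have "\<dots> = \<epsilon> a * \<epsilon> x" by (rule sw_counit_right[OF a dual_times_left[OF e]])
  finally show ?thesis .
qed

end

section \<open>Normal left coideal subalgebras\<close>

locale normal_coideal = semisimple_hopf H for H :: "('k::field, 'h, 'm) hopf_scheme" (structure) +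
  fixes N :: "'h set"
  assumes normal: "normal_left_coideal_subalgebra H N"
begin

abbreviation L :: 'h where "L \<equiv> integral_of H N"

lemma N: "coideal_subalgebra N"
  using normal left_coideal_imp_coideal_subalgebra unfolding normal_left_coideal_subalgebra_def by blast

lemma N_carrier [simp]: "x \<in> N \<Longrightarrow> x \<in> carrier H"
  by (rule coideal_subalgebraD(5)[OF N])

lemma N_adjoint: "h \<in> carrier H \<Longrightarrow> x \<in> N \<Longrightarrow> left_adjoint H h x \<in> N"
  using normal unfolding normal_left_coideal_subalgebra_def by blast

lemma L_integral: "is_integral L N"
  by (rule integral_of) (use normal in \<open>simp add: normal_left_coideal_subalgebra_def\<close>)

lemma L_N: "L \<in> N" and counit_L [simp]: "\<epsilon> L = 1"
  and N_L: "x \<in> N \<Longrightarrow> x \<otimes> L = \<epsilon> x \<odot> L" and L_Nr: "x \<in> N \<Longrightarrow> L \<otimes> x = \<epsilon> x \<odot> L"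
  using L_integral unfolding is_integral_def by auto

lemma L_closed [simp]: "L \<in> carrier H"
  using L_N by simp

lemma L_L [simp]: "L \<otimes> L = L"
  using N_L[OF L_N] by (simp add: smult_simps(4))

text \<open>
  Write \<open>hx = \<Sum> (h\<^sub>1 x S(h\<^sub>2)) h\<^sub>3\<close>. By normality the factor in parentheses lies in \<open>N\<close>, so
  \<open>L\<close> absorbs it.
\<close>

lemma L_mult_absorb:
  assumes h: "h \<in> carrier H" and x: "x \<in> N"
  shows "L \<otimes> (h \<otimes> x) = \<epsilon> x \<odot> (L \<otimes> h)"
proof (rule dual_eqI)
  fix \<phi> assume \<phi>: "\<phi> \<in> dual H"
  note [simp] = antipode_closed N_carrier[OF x]
  note lin = multilin_intros dual_endo[OF \<phi>] L_closed N_carrier[OF x]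
  define G where "G p q r = \<phi> (L \<otimes> (p \<otimes> x \<otimes> S q \<otimes> r))" for p q r
  have "Sw (\<lambda>h' r. Sw (\<lambda>p q. G p q r) h') h = Sw (\<lambda>h' r. \<epsilon> h' * (\<epsilon> x * \<phi> (L \<otimes> r))) h"
  proof (rule sw_cong[OF h])
    fix h' r assume [simp]: "h' \<in> carrier H" "r \<in> carrier H"
    have "(\<lambda>z. \<phi> (L \<otimes> (z \<otimes> r))) \<in> dual H" by (intro lin; simp)
    from dual_left_adjoint[OF this, of h' x] have "Sw (\<lambda>p q. G p q r) h' = \<phi> (L \<otimes> (left_adjoint H h' x \<otimes> r))"
      by (simp add: G_def)
    also have "L \<otimes> (left_adjoint H h' x \<otimes> r) = \<epsilon> (left_adjoint H h' x) \<odot> (L \<otimes> r)"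
      using L_Nr[OF N_adjoint[OF _ x], of h'] by (simp add: m_assoc[symmetric] smult_mult_left)
    finally show "Sw (\<lambda>p q. G p q r) h' = \<epsilon> h' * (\<epsilon> x * \<phi> (L \<otimes> r))"
      by (simp add: dualD(2)[OF \<phi>] counit_left_adjoint)
  qed
  also have "\<dots> = \<epsilon> x * \<phi> (L \<otimes> h)"
    by (rule sw_counit_left[OF h]) (intro lin; simp)
  finally have 1: "Sw (\<lambda>h' r. Sw (\<lambda>p q. G p q r) h') h = \<epsilon> x * \<phi> (L \<otimes> h)" .
  have "Sw (\<lambda>h' r. Sw (\<lambda>p q. G p q r) h') h = Sw (\<lambda>p h'. Sw (\<lambda>q r. G p q r) h') h"
    by (rule sw_coassoc[OF h]) (unfold G_def, intro lin; simp)
  also have "\<dots> = Sw (\<lambda>p h'. \<epsilon> h' * \<phi> (L \<otimes> (p \<otimes> x))) h"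
  proof (rule sw_cong[OF h])
    fix p h' assume [simp]: "p \<in> carrier H" "h' \<in> carrier H"
    have "(\<lambda>z. \<phi> (L \<otimes> (p \<otimes> x \<otimes> z))) \<in> dual H" by (intro lin; simp)
    from sw_antipode_left[OF _ this, of h']
    have "Sw (\<lambda>q r. \<phi> (L \<otimes> (p \<otimes> x \<otimes> (S q \<otimes> r)))) h' = \<epsilon> h' * \<phi> (L \<otimes> (p \<otimes> x))" by simp
    moreover have "Sw (\<lambda>q r. G p q r) h' = Sw (\<lambda>q r. \<phi> (L \<otimes> (p \<otimes> x \<otimes> (S q \<otimes> r)))) h'"
      unfolding G_def by (rule sw_cong) (simp_all add: m_assoc)
    ultimately show "Sw (\<lambda>q r. G p q r) h' = \<epsilon> h' * \<phi> (L \<otimes> (p \<otimes> x))" by simp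
  qed
  also have "\<dots> = \<phi> (L \<otimes> (h \<otimes> x))"
    by (rule sw_counit_right[OF h]) (intro lin; simp)
  finally show "\<phi> (L \<otimes> (h \<otimes> x)) = \<phi> (\<epsilon> x \<odot> (L \<otimes> h))" using 1 h by (simp add: dualD(2)[OF \<phi>])
qed (use h x in auto)

lemma L_h_L: "h \<in> carrier H \<Longrightarrow> L \<otimes> (h \<otimes> L) = L \<otimes> h"
  using L_mult_absorb[OF _ L_N, of h] by (simp add: smult_simps(4))

text \<open>
  By \<open>L_h_L\<close> we have \<open>hL - Lh = (h - Lh)L\<close>, and \<open>L g (hL - Lh)\<close> is zero for all \<open>g\<close>. Semiprimeness applies.
\<close>

lemma L_central:
  assumes h: "h \<in> carrier H" shows "h \<otimes> L = L \<otimes> h"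
proof -
  let ?y = "h \<otimes> L \<ominus> L \<otimes> h"
  have "?y = \<zero>"
  proof (rule semiprime)
    show "?y \<in> carrier H" using h by simp
    fix g assume g: "g \<in> carrier H"
    have yL: "?y = (h \<ominus> L \<otimes> h) \<otimes> L"
      using h L_h_L[OF h] by (simp add: minus_eq l_distr l_minus m_assoc)
    have "L \<otimes> (g \<otimes> ?y) = L \<otimes> (g \<otimes> h \<otimes> L) \<ominus> L \<otimes> (g \<otimes> L) \<otimes> h"
      using h g by (simp add: minus_eq r_distr r_minus m_assoc)
    also have "\<dots> = L \<otimes> (g \<otimes> h) \<ominus> L \<otimes> g \<otimes> h" using L_h_L[OF m_closed[OF g h]] L_h_L[OF g] by simp
    also have "\<dots> = \<zero>" using h g by (simp add: m_assoc minus_eq r_neg)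
    finally have 0: "L \<otimes> (g \<otimes> ?y) = \<zero>" .
    have "?y \<otimes> g \<otimes> ?y = (h \<ominus> L \<otimes> h) \<otimes> L \<otimes> g \<otimes> ?y" by (simp only: yL[symmetric])
    also have "\<dots> = (h \<ominus> L \<otimes> h) \<otimes> (L \<otimes> (g \<otimes> ?y))" using h g by (simp add: m_assoc)
    finally show "?y \<otimes> g \<otimes> ?y = \<zero>" using 0 h by simp
  qed
  then show ?thesis using h by (simp add: r_right_minus_eq)
qed

text \<open>
  Evaluate \<open>\<Sum> S(x\<^sub>1) x\<^sub>2 L\<close> by the antipode axiom, and by absorbing \<open>x\<^sub>2\<close> into \<open>L\<close>.
\<close>

lemma antipode_L:
  assumes x: "x \<in> N" shows "S x \<otimes> L = \<epsilon> x \<odot> L"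
proof (rule dual_eqI)
  fix \<phi> assume \<phi>: "\<phi> \<in> dual H"
  note [simp] = antipode_closed N_carrier[OF x]
  note lin = multilin_intros dual_endo[OF \<phi>] L_closed
  have l: "(\<lambda>z. \<phi> (z \<otimes> L)) \<in> dual H" by (intro lin)
  have "\<phi> (S x \<otimes> L) = Sw (\<lambda>p q. \<epsilon> q * \<phi> (S p \<otimes> L)) x"
    by (rule sw_counit_right[symmetric]) (simp, intro lin)
  also have "\<dots> = Sw (\<lambda>p q. \<phi> (S p \<otimes> q \<otimes> L)) x"
  proof (rule sw_cong_coideal[OF N x])
    show "bilinear_form H (\<lambda>p q. \<epsilon> q * \<phi> (S p \<otimes> L))" by (intro lin)
    show "bilinear_form H (\<lambda>p q. \<phi> (S p \<otimes> q \<otimes> L))" by (intro lin)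
    show "\<epsilon> q * \<phi> (S p \<otimes> L) = \<phi> (S p \<otimes> q \<otimes> L)" if "p \<in> carrier H" "q \<in> N" for p q
      using that by (simp add: m_assoc N_L smult_mult_right dualD(2)[OF \<phi>])
  qed
  also have "\<dots> = \<epsilon> x * \<phi> (\<one> \<otimes> L)" by (rule sw_antipode_left[OF _ l]) simp
  finally show "\<phi> (S x \<otimes> L) = \<phi> (\<epsilon> x \<odot> L)" by (simp add: dualD(2)[OF \<phi>])
qed (use x in \<open>auto simp: antipode_closed\<close>)

text \<open>
  The right legs of the coproduct of \<open>L\<close> lie in \<open>N\<close>, so their antipodes are absorbed by the outer factor
  \<open>L\<close>. What remains of \<open>L\<close> is a central idempotent.
\<close>

lemma adjoint_mult_L:
  assumes x: "x \<in> carrier H" and c: "c \<in> carrier H"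
  shows "left_adjoint H (x \<otimes> L) c \<otimes> L = left_adjoint H x c \<otimes> L"
proof (rule dual_eqI)
  fix \<phi> assume \<phi>: "\<phi> \<in> dual H"
  note [simp] = antipode_closed x c
  note lin = multilin_intros dual_endo[OF \<phi>] L_closed c
  have l: "(\<lambda>z. \<phi> (z \<otimes> L)) \<in> dual H" by (intro lin)
  have bl: "bilinear_form H (\<lambda>p q. \<phi> (p \<otimes> c \<otimes> S q \<otimes> L))" by (intro lin)
  have "\<phi> (left_adjoint H (x \<otimes> L) c \<otimes> L) = Sw (\<lambda>p q. \<phi> (p \<otimes> c \<otimes> S q \<otimes> L)) (x \<otimes> L)"
    by (rule dual_left_adjoint[OF l]) auto
  also have "\<dots> = Sw (\<lambda>p q. Sw (\<lambda>p' q'. \<phi> ((p \<otimes> p') \<otimes> c \<otimes> S (q \<otimes> q') \<otimes> L)) L) x"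
    by (rule sw_mult[OF x L_closed bl])
  also have "\<dots> = Sw (\<lambda>p q. \<phi> (p \<otimes> c \<otimes> S q \<otimes> L)) x"
  proof (rule sw_cong[OF x])
    fix p q assume [simp]: "p \<in> carrier H" "q \<in> carrier H"
    have "Sw (\<lambda>p' q'. \<phi> ((p \<otimes> p') \<otimes> c \<otimes> S (q \<otimes> q') \<otimes> L)) L
        = Sw (\<lambda>p' q'. \<epsilon> q' * \<phi> (p \<otimes> p' \<otimes> (c \<otimes> S q \<otimes> L))) L"
    proof (rule sw_cong_coideal[OF N L_N])
      show "bilinear_form H (\<lambda>p' q'. \<phi> ((p \<otimes> p') \<otimes> c \<otimes> S (q \<otimes> q') \<otimes> L))" by (intro lin; simp)
      show "bilinear_form H (\<lambda>p' q'. \<epsilon> q' * \<phi> (p \<otimes> p' \<otimes> (c \<otimes> S q \<otimes> L)))" by (intro lin; simp)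
      fix p' q' assume [simp]: "p' \<in> carrier H" and q': "q' \<in> N"
      have [simp]: "q' \<in> carrier H" by (rule N_carrier[OF q'])
      have "S (q \<otimes> q') \<otimes> L = S q' \<otimes> L \<otimes> S q"
        by (simp add: antipode_mult m_assoc L_central)
      also have "\<dots> = (\<epsilon> q' \<odot> L) \<otimes> S q" by (simp only: antipode_L[OF q'])
      also have "\<dots> = \<epsilon> q' \<odot> (S q \<otimes> L)" by (simp add: smult_mult_left L_central)
      finally have "(p \<otimes> p') \<otimes> c \<otimes> S (q \<otimes> q') \<otimes> L = \<epsilon> q' \<odot> (p \<otimes> p' \<otimes> (c \<otimes> S q \<otimes> L))"
        by (simp add: m_assoc smult_mult_right)
      then show "\<phi> ((p \<otimes> p') \<otimes> c \<otimes> S (q \<otimes> q') \<otimes> L) = \<epsilon> q' * \<phi> (p \<otimes> p' \<otimes> (c \<otimes> S q \<otimes> L))"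
        by (simp add: dualD(2)[OF \<phi>])
    qed
    also have "\<dots> = \<phi> (p \<otimes> L \<otimes> (c \<otimes> S q \<otimes> L))"
      by (rule sw_counit_right[OF L_closed]) (intro lin; simp)
    also have "p \<otimes> L \<otimes> (c \<otimes> S q \<otimes> L) = p \<otimes> (L \<otimes> (c \<otimes> S q \<otimes> L))" by (simp add: m_assoc)
    also have "\<dots> = p \<otimes> ((c \<otimes> S q \<otimes> L) \<otimes> L)"
      using L_central[of "c \<otimes> S q \<otimes> L"] by simp
    also have "\<dots> = p \<otimes> c \<otimes> S q \<otimes> L" by (simp add: m_assoc)
    finally show "Sw (\<lambda>p' q'. \<phi> ((p \<otimes> p') \<otimes> c \<otimes> S (q \<otimes> q') \<otimes> L)) L = \<phi> (p \<otimes> c \<otimes> S q \<otimes> L)" .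
  qed
  also have "\<dots> = \<phi> (left_adjoint H x c \<otimes> L)"
    by (rule dual_left_adjoint[OF l, symmetric]) auto
  finally show "\<phi> (left_adjoint H (x \<otimes> L) c \<otimes> L) = \<phi> (left_adjoint H x c \<otimes> L)" .
qed (use x c in auto)

lemma adjoint_cong_L:
  assumes "x \<in> carrier H" "y \<in> carrier H" "c \<in> carrier H" "x \<otimes> L = y \<otimes> L"
  shows "left_adjoint H x c \<otimes> L = left_adjoint H y c \<otimes> L"
  using adjoint_mult_L[of x c] adjoint_mult_L[of y c] assms by simp

section \<open>The quotient Hopf algebra\<close>

definition HNp :: "'h set" where
  "HNp = ideal_prod H (carrier H) (augmentation_part H N)"

text \<open>
  An element killed by \<open>L\<close> is a left multiple of \<open>\<one> - L\<close>, which lies in \<open>N\<^sup>+\<close>.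
\<close>

lemma HNp_eq: "HNp = {x \<in> carrier H. x \<otimes> L = \<zero>}"
proof (intro equalityI subsetI)
  fix x assume "x \<in> HNp"
  then show "x \<in> {x \<in> carrier H. x \<otimes> L = \<zero>}"
    unfolding HNp_def
  proof (induction rule: ideal_prod.induct)
    case (prod i j)
    then show ?case by (auto simp: augmentation_part_def m_assoc N_L)
  next
    case (sum s1 s2)
    then show ?case by (auto simp: l_distr)
  qed
next
  fix x assume x: "x \<in> {x \<in> carrier H. x \<otimes> L = \<zero>}"
  note s = subspD[OF coideal_subalgebraD(1)[OF N]]
  have "\<one> \<ominus> L \<in> augmentation_part H N"
    unfolding augmentation_part_def minus_eq
    using s(3)[OF coideal_subalgebraD(2)[OF N] s(5)[OF L_N]] by (simp add: counit_add counit_one)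
  moreover have "x = x \<otimes> (\<one> \<ominus> L)" using x by (simp add: minus_eq r_distr r_minus)
  ultimately show "x \<in> HNp"
    unfolding HNp_def using ideal_prod.prod[of x "carrier H" "\<one> \<ominus> L" "augmentation_part H N" H] x by simp
qed

lemma HNp_ideal: "ideal HNp H"
proof (rule idealI)
  show "ring H" by unfold_locales
  show "subgroup HNp (add_monoid H)"
  proof (rule subgroup.intro)
    show "inv\<^bsub>add_monoid H\<^esub> x \<in> HNp" if "x \<in> HNp" for x
    proof -
      have x: "x \<in> carrier H" "x \<otimes> L = \<zero>" using that by (simp_all add: HNp_eq)
      have "(\<ominus> x) \<otimes> L = \<ominus> (x \<otimes> L)" by (rule l_minus[OF x(1) L_closed])
      also have "\<dots> = \<zero>" unfolding x(2) by (rule minus_zero)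
      finally show ?thesis unfolding a_inv_def[symmetric] using x(1) by (simp add: HNp_eq)
    qed
  qed (auto simp: HNp_eq l_distr)
  show "x \<otimes> a \<in> HNp" "a \<otimes> x \<in> HNp" if "a \<in> HNp" "x \<in> carrier H" for a x
    using that unfolding HNp_eq by (auto simp: m_assoc) (metis L_central L_closed l_null m_assoc)
qed

definition \<pi> :: "'h \<Rightarrow> 'h set" where "\<pi> x = HNp +> x"

lemma mem_\<pi>:
  assumes x: "x \<in> carrier H"
  shows "y \<in> \<pi> x \<longleftrightarrow> y \<in> carrier H \<and> y \<otimes> L = x \<otimes> L"
proof
  assume "y \<in> \<pi> x"
  then obtain i where i: "i \<in> HNp" "y = i \<oplus> x" unfolding \<pi>_def a_r_coset_def' by (elim UN_E singletonE)
  then have "i \<in> carrier H" "i \<otimes> L = \<zero>" by (simp_all add: HNp_eq)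
  then show "y \<in> carrier H \<and> y \<otimes> L = x \<otimes> L" unfolding i(2) using x by (simp add: l_distr)
next
  assume y: "y \<in> carrier H \<and> y \<otimes> L = x \<otimes> L"
  have yc: "y \<in> carrier H" using y by simp
  have "(y \<ominus> x) \<otimes> L = y \<otimes> L \<oplus> (\<ominus> x) \<otimes> L"
    unfolding minus_eq by (rule l_distr[OF yc a_inv_closed[OF x] L_closed])
  also have "(\<ominus> x) \<otimes> L = \<ominus> (x \<otimes> L)" by (rule l_minus[OF x L_closed])
  also have "y \<otimes> L = x \<otimes> L" using y by simp
  also have "x \<otimes> L \<oplus> \<ominus> (x \<otimes> L) = \<zero>" by (rule r_neg[OF m_closed[OF x L_closed]])
  finally have "y \<ominus> x \<in> HNp" using x y by (simp add: HNp_eq)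
  moreover have "y = (y \<ominus> x) \<oplus> x" using x y by (simp add: minus_eq a_assoc l_neg)
  ultimately show "y \<in> \<pi> x" unfolding \<pi>_def a_r_coset_def' by (intro UN_I[of "y \<ominus> x"]) simp_all
qed

lemma \<pi>_eq_iff:
  assumes "x \<in> carrier H" "y \<in> carrier H"
  shows "\<pi> x = \<pi> y \<longleftrightarrow> x \<otimes> L = y \<otimes> L"
proof
  assume "\<pi> x = \<pi> y"
  then have "x \<in> \<pi> y" using mem_\<pi>[OF assms(1), of x] assms(1) by simp
  then show "x \<otimes> L = y \<otimes> L" using mem_\<pi>[OF assms(2)] by simp
next
  assume "x \<otimes> L = y \<otimes> L"
  then show "\<pi> x = \<pi> y" using mem_\<pi>[OF assms(1)] mem_\<pi>[OF assms(2)] by auto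
qed

lemma self_in_\<pi>: "x \<in> carrier H \<Longrightarrow> x \<in> \<pi> x"
  by (simp add: mem_\<pi>)

abbreviation Qa where "Qa \<equiv> quotient_algebra H HNp"
abbreviation Q where "Q \<equiv> H //h N"

lemma Q_eq: "Q = quotient_by H HNp"
  by (simp add: hopf_quotient_def HNp_def)

lemma Qa_simps: "carrier Qa = \<pi> ` carrier H" "ring.add Qa = set_add H" "monoid.mult Qa = rcoset_mult H HNp"
  "monoid.one Qa = \<pi> \<one>" "ring.zero Qa = HNp" "module.smult Qa = (\<lambda>c C. \<Union>x\<in>C. HNp +> (c \<odot> x))"
  unfolding quotient_algebra_def \<pi>_def
  by (auto simp: ring.defs module.defs FactRing_def A_RCOSETS_def')

lemma Q_simps: "carrier Q = carrier Qa" "ring.add Q = ring.add Qa" "monoid.mult Q = monoid.mult Qa" "monoid.one Q = monoid.one Qa" "ring.zero Q = ring.zero Qa"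
  "module.smult Q = module.smult Qa" "counit Q C = the_elem (\<epsilon> ` C)" "antipode Q C = (\<Union>x\<in>C. HNp +> S x)"
  "comult Q C = (\<Union>x\<in>C. tensor_class Qa
          (formal_extend (\<lambda>(a, b). Poly_Mapping.single (\<pi> a, \<pi> b) 1) (sweedler H x)))"
  unfolding Q_eq quotient_by_def \<pi>_def by (simp_all add: module.defs hopf.defs)

end

context normal_coideal
begin

lemma \<pi>_in [simp]: "x \<in> carrier H \<Longrightarrow> \<pi> x \<in> carrier Q"
  by (simp add: Q_simps(1) Qa_simps(1))

lemma carrier_Q: "C \<in> carrier Q \<Longrightarrow> \<exists>x\<in>carrier H. C = \<pi> x"
  by (auto simp: Q_simps(1) Qa_simps(1))

lemma \<pi>_add: "x \<in> carrier H \<Longrightarrow> y \<in> carrier H \<Longrightarrow> \<pi> x \<oplus>\<^bsub>Q\<^esub> \<pi> y = \<pi> (x \<oplus> y)"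
  using abelian_subgroup.a_rcos_sum[OF abelian_subgroupI3[OF ideal.axioms(1)[OF HNp_ideal] is_abelian_group]]
  by (simp add: Q_simps(2) Qa_simps(2) \<pi>_def)

lemma \<pi>_mult: "x \<in> carrier H \<Longrightarrow> y \<in> carrier H \<Longrightarrow> \<pi> x \<otimes>\<^bsub>Q\<^esub> \<pi> y = \<pi> (x \<otimes> y)"
  using ideal.rcoset_mult_add[OF HNp_ideal] by (simp add: Q_simps(3) Qa_simps(3) \<pi>_def)

text \<open>
  The unions in the definition of the quotient structure are unions of equal sets.
\<close>

lemma UN_\<pi>:
  assumes x: "x \<in> carrier H" and "\<And>y. y \<in> carrier H \<Longrightarrow> y \<otimes> L = x \<otimes> L \<Longrightarrow> F y = F x"
  shows "(\<Union>y\<in>\<pi> x. F y) = F x"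
proof -
  have "F y = F x" if "y \<in> \<pi> x" for y
    using that mem_\<pi>[OF x] assms(2) by blast
  then show ?thesis using self_in_\<pi>[OF x] by blast
qed

lemma \<pi>_smult:
  assumes x: "x \<in> carrier H" shows "c \<odot>\<^bsub>Q\<^esub> \<pi> x = \<pi> (c \<odot> x)"
proof -
  have "(\<Union>y\<in>\<pi> x. \<pi> (c \<odot> y)) = \<pi> (c \<odot> x)"
    by (rule UN_\<pi>[OF x]) (simp add: \<pi>_eq_iff x smult_mult_left)
  then show ?thesis by (simp add: Q_simps(6) Qa_simps(6) \<pi>_def)
qed

lemma \<pi>_one: "\<one>\<^bsub>Q\<^esub> = \<pi> \<one>"
  by (simp add: Q_simps(4) Qa_simps(4))

lemma \<pi>_counit:
  assumes x: "x \<in> carrier H" shows "counit Q (\<pi> x) = \<epsilon> x"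
proof -
  have "\<epsilon> y = \<epsilon> x" if "y \<in> \<pi> x" for y
  proof -
    have y: "y \<in> carrier H" "y \<otimes> L = x \<otimes> L" using that unfolding mem_\<pi>[OF x] by simp_all
    have "\<epsilon> y = \<epsilon> (y \<otimes> L)" using y(1) by (simp add: counit_mult)
    also have "\<dots> = \<epsilon> (x \<otimes> L)" by (simp only: y(2))
    also have "\<dots> = \<epsilon> x" using x by (simp add: counit_mult)
    finally show ?thesis .
  qed
  then have "\<epsilon> ` \<pi> x = (\<lambda>_. \<epsilon> x) ` \<pi> x" by (intro image_cong refl)
  also have "\<dots> = {\<epsilon> x}" by (rule image_constant[OF self_in_\<pi>[OF x]])
  finally have "\<epsilon> ` \<pi> x = {\<epsilon> x}" .
  then show ?thesis by (simp add: Q_simps(7))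
qed

lemma antipode_mod:
  assumes "y \<in> carrier H" shows "S (y \<otimes> L) \<otimes> L = S y \<otimes> L"
proof -
  have "S (y \<otimes> L) \<otimes> L = S L \<otimes> (S y \<otimes> L)" using assms by (simp add: antipode_mult antipode_closed m_assoc)
  also have "S y \<otimes> L = L \<otimes> S y" by (rule L_central[OF antipode_closed[OF assms]])
  also have "S L \<otimes> (L \<otimes> S y) = (S L \<otimes> L) \<otimes> S y"
    by (rule m_assoc[symmetric]) (simp_all add: antipode_closed assms)
  also have "\<dots> = S y \<otimes> L" using assms by (simp add: antipode_L[OF L_N] smult_simps(4) L_central antipode_closed)
  finally show ?thesis .
qed

lemma \<pi>_antipode:
  assumes x: "x \<in> carrier H" shows "antipode Q (\<pi> x) = \<pi> (S x)"
proof -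
  have "(\<Union>y\<in>\<pi> x. \<pi> (S y)) = \<pi> (S x)"
  proof (rule UN_\<pi>[OF x])
    fix y assume y: "y \<in> carrier H" "y \<otimes> L = x \<otimes> L"
    have "S y \<otimes> L = S x \<otimes> L" using antipode_mod[OF y(1)] antipode_mod[OF x] y(2) by simp
    then show "\<pi> (S y) = \<pi> (S x)" using x y by (simp add: \<pi>_eq_iff antipode_closed)
  qed
  then show ?thesis by (simp add: Q_simps(8) \<pi>_def)
qed

lemma \<pi>_zero: "\<zero>\<^bsub>Q\<^esub> = \<pi> \<zero>"
proof -
  have "\<pi> \<zero> = HNp" unfolding \<pi>_def using a_coset_add_zero[of HNp] by (simp add: HNp_eq)
  then show ?thesis by (simp add: Q_simps(5) Qa_simps(5))
qed

lemma abelian_monoid_Q: "abelian_monoid Q"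
proof (rule abelian_monoidI)
  fix A B C assume "A \<in> carrier Q" "B \<in> carrier Q" "C \<in> carrier Q"
  then obtain x y z where "A = \<pi> x" "B = \<pi> y" "C = \<pi> z" "x \<in> carrier H" "y \<in> carrier H" "z \<in> carrier H"
    using carrier_Q by meson
  then show "A \<oplus>\<^bsub>Q\<^esub> B \<oplus>\<^bsub>Q\<^esub> C = A \<oplus>\<^bsub>Q\<^esub> (B \<oplus>\<^bsub>Q\<^esub> C)" by (simp add: \<pi>_add a_assoc)
next
  fix A B assume "A \<in> carrier Q" "B \<in> carrier Q"
  then obtain x y where "A = \<pi> x" "B = \<pi> y" "x \<in> carrier H" "y \<in> carrier H" using carrier_Q by meson
  then show "A \<oplus>\<^bsub>Q\<^esub> B \<in> carrier Q" "A \<oplus>\<^bsub>Q\<^esub> B = B \<oplus>\<^bsub>Q\<^esub> A" by (simp_all add: \<pi>_add a_comm)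
next
  show "\<zero>\<^bsub>Q\<^esub> \<in> carrier Q" by (simp add: \<pi>_zero)
  fix A assume "A \<in> carrier Q"
  then obtain x where "A = \<pi> x" "x \<in> carrier H" using carrier_Q by blast
  then show "\<zero>\<^bsub>Q\<^esub> \<oplus>\<^bsub>Q\<^esub> A = A" by (simp add: \<pi>_zero \<pi>_add)
qed

text \<open>
  The identification of the quotient with the ideal \<open>HL\<close>.
\<close>

definition \<rho> :: "'h set \<Rightarrow> 'h" where "\<rho> C = the_elem ((\<lambda>x. x \<otimes> L) ` C)"

lemma \<rho>_\<pi> [simp]:
  assumes x: "x \<in> carrier H" shows "\<rho> (\<pi> x) = x \<otimes> L"
proof -
  have "(\<lambda>x. x \<otimes> L) ` \<pi> x = {x \<otimes> L}" using self_in_\<pi>[OF x] mem_\<pi>[OF x] by auto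
  then show ?thesis by (simp add: \<rho>_def)
qed

lemma dual_QI:
  assumes "\<psi> \<in> dual H" "\<And>x. x \<in> carrier H \<Longrightarrow> F (\<pi> x) = \<psi> x"
  shows "F \<in> dual Qa"
proof (rule dualI)
  fix A B assume "A \<in> carrier Qa" "B \<in> carrier Qa"
  then obtain x y where xy: "A = \<pi> x" "B = \<pi> y" "x \<in> carrier H" "y \<in> carrier H" by (auto simp: Qa_simps(1))
  then show "F (A \<oplus>\<^bsub>Qa\<^esub> B) = F A + F B"
    using \<pi>_add[of x y] assms by (simp add: Q_simps(2) dualD)
next
  fix c A assume "A \<in> carrier Qa"
  then obtain x where x: "A = \<pi> x" "x \<in> carrier H" by (auto simp: Qa_simps(1))
  then show "F (c \<odot>\<^bsub>Qa\<^esub> A) = c * F A"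
    using \<pi>_smult[of x c] assms by (simp add: Q_simps(6) dualD)
qed

text \<open>
  The image in the quotient of a representative of the coproduct of \<open>x\<close>.
\<close>

definition push :: "'h \<Rightarrow> (('h set \<times> 'h set) \<Rightarrow>\<^sub>0 'k)" where
  "push x = formal_extend (\<lambda>(a, b). Poly_Mapping.single (\<pi> a, \<pi> b) 1) (sweedler H x)"

lemma comult_Q_eq: "comult Q C = (\<Union>x\<in>C. tensor_class Qa (push x))"
  by (simp add: Q_simps(9) push_def)

lemma extend_form_push: "extend_form (case_prod g) (push x) = Sw (\<lambda>a b. g (\<pi> a) (\<pi> b)) x"
  by (simp add: push_def extend_form_formal_extend sweedler_form_def case_prod_beta')

text \<open>
  A member of the coproduct of a coset represents the image of the coproduct of some element \<open>y\<close> of this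
  coset. The lemmas below only refer to \<open>yL\<close>, which does not depend on the choice.
\<close>

lemma extend_form_comult_Q:
  assumes "C \<in> carrier Q" "p \<in> comult Q C"
  shows "\<exists>y\<in>carrier H. \<pi> y = C \<and> (\<forall>g. bilinear_form Qa g \<longrightarrow> extend_form (case_prod g) p = Sw (\<lambda>a b. g (\<pi> a) (\<pi> b)) y)"
proof -
  obtain x where x: "x \<in> carrier H" "C = \<pi> x" using carrier_Q[OF assms(1)] by blast
  obtain y where y: "y \<in> C" "p \<in> tensor_class Qa (push y)" using assms(2) unfolding comult_Q_eq by blast
  have yc: "y \<in> carrier H" "\<pi> y = C" using y(1) x mem_\<pi>[OF x(1)] \<pi>_eq_iff by auto
  have "extend_form (case_prod g) p = Sw (\<lambda>a b. g (\<pi> a) (\<pi> b)) y" if "bilinear_form Qa g" for g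
    using extend_form_tensor_null[OF that, of "p - push y"] y(2) by (simp add: tensor_class_def extend_form_diff extend_form_push)
  with yc show ?thesis by blast
qed

lemma sweedler_Q:
  assumes C: "C \<in> carrier Q"
  shows "sweedler Q C \<in> comult Q C" "Poly_Mapping.keys (sweedler Q C) \<subseteq> carrier Q \<times> carrier Q"
proof -
  obtain x where x: "x \<in> carrier H" "C = \<pi> x" using carrier_Q[OF C] by blast
  have "push x \<in> comult Q C"
    unfolding comult_Q_eq x(2)
    by (rule UN_I[OF self_in_\<pi>[OF x(1)]]) (simp add: tensor_class_def tensor_null.zero)
  moreover have "Poly_Mapping.keys (push x) \<subseteq> carrier Q \<times> carrier Q"
    unfolding push_def formal_extend_def
  proof (rule keys_sum_subset)
    fix u assume "u \<in> Poly_Mapping.keys (sweedler H x)"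
    then have "u \<in> carrier H \<times> carrier H" using sweedler_comult(2)[OF x(1)] by blast
    then have "Poly_Mapping.keys (case u of (a, b) \<Rightarrow> Poly_Mapping.single (\<pi> a, \<pi> b) (1::'k)) \<subseteq> carrier Q \<times> carrier Q"
      by auto
    then show "Poly_Mapping.keys (Poly_Mapping.map ((*) (Poly_Mapping.lookup (sweedler H x) u))
        (case u of (a, b) \<Rightarrow> Poly_Mapping.single (\<pi> a, \<pi> b) 1)) \<subseteq> carrier Q \<times> carrier Q"
      using keys_scale by (rule order_trans[rotated])
  qed
  ultimately have "push x \<in> comult Q C \<and> Poly_Mapping.keys (push x) \<subseteq> carrier Q \<times> carrier Q" by simp
  from someI[of "\<lambda>p. p \<in> comult Q C \<and> Poly_Mapping.keys p \<subseteq> carrier Q \<times> carrier Q", OF this]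
  show "sweedler Q C \<in> comult Q C" "Poly_Mapping.keys (sweedler Q C) \<subseteq> carrier Q \<times> carrier Q"
    unfolding sweedler_def by auto
qed

text \<open>
  The adjoint action of a coset is calculated with the coproduct of some representative \<open>y\<close>. By
  \<open>adjoint_cong_L\<close> the result modulo \<open>HN\<^sup>+\<close> is that for \<open>a\<close>.
\<close>

lemma left_adjoint_Q:
  assumes a: "a \<in> carrier H" and c: "c \<in> carrier H"
  shows "left_adjoint Q (\<pi> a) (\<pi> c) = \<pi> (left_adjoint H a c)"
proof -
  interpret Q: abelian_monoid Q by (rule abelian_monoid_Q)
  let ?p = "sweedler Q (\<pi> a)"
  let ?f = "\<lambda>u. Poly_Mapping.lookup ?p u \<odot>\<^bsub>Q\<^esub> (fst u \<otimes>\<^bsub>Q\<^esub> \<pi> c \<otimes>\<^bsub>Q\<^esub> antipode Q (snd u))"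
  note p = sweedler_Q[OF \<pi>_in[OF a]]
  have rep: "\<exists>x\<in>carrier H. \<exists>y\<in>carrier H. u = (\<pi> x, \<pi> y)" if "u \<in> Poly_Mapping.keys ?p" for u
  proof -
    have "fst u \<in> carrier Q" "snd u \<in> carrier Q" using that p(2) by (auto dest!: subsetD)
    then obtain x y where "x \<in> carrier H" "fst u = \<pi> x" "y \<in> carrier H" "snd u = \<pi> y"
      using carrier_Q by meson
    then show ?thesis by (intro bexI[of _ x] bexI[of _ y]) (simp_all add: prod_eq_iff)
  qed
  have f_eq: "?f u = \<pi> (Poly_Mapping.lookup ?p u \<odot> (x \<otimes> c \<otimes> S y))"
    if "x \<in> carrier H" "y \<in> carrier H" "u = (\<pi> x, \<pi> y)" for u x y
    using that c by (simp add: \<pi>_antipode \<pi>_mult \<pi>_smult antipode_closed)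
  have f_in: "?f \<in> Poly_Mapping.keys ?p \<rightarrow> carrier Q"
  proof
    fix u assume "u \<in> Poly_Mapping.keys ?p"
    then obtain x y where xy: "x \<in> carrier H" "y \<in> carrier H" "u = (\<pi> x, \<pi> y)" using rep by blast
    show "?f u \<in> carrier Q" unfolding f_eq[OF xy] using xy c by (simp add: antipode_closed)
  qed
  have la: "left_adjoint Q (\<pi> a) (\<pi> c) = (\<Oplus>\<^bsub>Q\<^esub>u\<in>Poly_Mapping.keys ?p. ?f u)"
    unfolding left_adjoint_def sweedler_sum_def by simp
  have la_in: "left_adjoint Q (\<pi> a) (\<pi> c) \<in> carrier Q"
    unfolding la by (rule Q.finsum_closed[OF f_in])
  obtain z where z: "z \<in> carrier H" "left_adjoint Q (\<pi> a) (\<pi> c) = \<pi> z" using carrier_Q[OF la_in] by blast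
  obtain y where y: "y \<in> carrier H" "\<pi> y = \<pi> a"
    and ex: "\<forall>g. bilinear_form Qa g \<longrightarrow> extend_form (case_prod g) ?p = Sw (\<lambda>a b. g (\<pi> a) (\<pi> b)) y"
    using extend_form_comult_Q[OF \<pi>_in[OF a] p(1)] by blast
  have "z \<otimes> L = left_adjoint H y c \<otimes> L"
  proof (rule dual_eqI)
    fix \<phi> assume \<phi>: "\<phi> \<in> dual H"
    have \<phi>L: "(\<lambda>x. \<phi> (x \<otimes> L)) \<in> dual H" by (rule dual_endo[OF \<phi> endo_mult_left[OF endo_id L_closed]])
    define \<psi> where "\<psi> C = \<phi> (\<rho> C)" for C
    have \<psi>\<pi>: "\<psi> (\<pi> x) = \<phi> (x \<otimes> L)" if "x \<in> carrier H" for x using that by (simp add: \<psi>_def)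
    have \<psi>Q: "\<psi> (A \<oplus>\<^bsub>Q\<^esub> B) = \<psi> A + \<psi> B" if AB: "A \<in> carrier Q" "B \<in> carrier Q" for A B
    proof -
      obtain u v where "u \<in> carrier H" "A = \<pi> u" "v \<in> carrier H" "B = \<pi> v"
        using carrier_Q[OF AB(1)] carrier_Q[OF AB(2)] by blast
      then show ?thesis by (simp add: \<pi>_add \<psi>\<pi> l_distr dualD[OF \<phi>])
    qed
    have \<psi>0: "\<psi> \<zero>\<^bsub>Q\<^esub> = 0" by (simp add: \<pi>_zero \<psi>\<pi> dual_zero[OF \<phi>])
    define g where "g A B = \<psi> (A \<otimes>\<^bsub>Q\<^esub> \<pi> c \<otimes>\<^bsub>Q\<^esub> antipode Q B)" for A B
    have g\<pi>: "g (\<pi> p) (\<pi> q) = \<phi> (p \<otimes> c \<otimes> S q \<otimes> L)" if "p \<in> carrier H" "q \<in> carrier H" for p q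
      using that c by (simp add: g_def \<pi>_antipode \<pi>_mult \<psi>\<pi> antipode_closed)
    note lin = multilin_intros dual_endo[OF \<phi>] L_closed c
    have g: "bilinear_form Qa g"
    proof (rule bilinear_formI)
      fix B assume "B \<in> carrier Qa"
      then obtain q where q: "q \<in> carrier H" "B = \<pi> q" by (auto simp: Qa_simps(1))
      have "(\<lambda>p. \<phi> (p \<otimes> c \<otimes> S q \<otimes> L)) \<in> dual H" using q(1) by (intro lin)
      then show "(\<lambda>A. g A B) \<in> dual Qa" by (rule dual_QI) (simp add: q g\<pi>)
    next
      fix A assume "A \<in> carrier Qa"
      then obtain p where p: "p \<in> carrier H" "A = \<pi> p" by (auto simp: Qa_simps(1))
      have "(\<lambda>q. \<phi> (p \<otimes> c \<otimes> S q \<otimes> L)) \<in> dual H" using p(1) by (intro lin)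
      then show "(\<lambda>B. g A B) \<in> dual Qa" by (rule dual_QI) (simp add: p g\<pi>)
    qed
    have "\<phi> (z \<otimes> L) = \<psi> (\<Oplus>\<^bsub>Q\<^esub>u\<in>Poly_Mapping.keys ?p. ?f u)"
      using z by (simp add: la[symmetric] \<psi>\<pi>)
    also have "\<dots> = (\<Sum>u\<in>Poly_Mapping.keys ?p. \<psi> (?f u))"
      by (rule Q.additive_finsum[OF \<psi>Q \<psi>0 finite_keys f_in])
    also have "\<dots> = extend_form (case_prod g) ?p"
      unfolding extend_form_def
    proof (rule sum.cong[OF refl])
      fix u assume "u \<in> Poly_Mapping.keys ?p"
      then obtain x y where xy: "x \<in> carrier H" "y \<in> carrier H" "u = (\<pi> x, \<pi> y)" using rep by blast
      show "\<psi> (?f u) = Poly_Mapping.lookup ?p u * (case u of (A, B) \<Rightarrow> g A B)"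
        unfolding f_eq[OF xy] using xy c
        by (simp add: \<psi>\<pi> g\<pi> antipode_closed smult_mult_left dualD(2)[OF \<phi>])
    qed
    also have "\<dots> = Sw (\<lambda>p q. g (\<pi> p) (\<pi> q)) y" using ex g by blast
    also have "\<dots> = Sw (\<lambda>p q. \<phi> (p \<otimes> c \<otimes> S q \<otimes> L)) y"
      by (rule sw_cong[OF y(1)]) (rule g\<pi>)
    also have "\<dots> = \<phi> (left_adjoint H y c \<otimes> L)"
      by (rule dual_left_adjoint[OF \<phi>L y(1) c, symmetric])
    finally show "\<phi> (z \<otimes> L) = \<phi> (left_adjoint H y c \<otimes> L)" .
  qed (use z y c in auto)
  also have "\<dots> = left_adjoint H a c \<otimes> L"
    by (rule adjoint_cong_L[OF y(1) a c]) (use y a in \<open>simp add: \<pi>_eq_iff\<close>)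
  finally show ?thesis using z a c by (simp add: \<pi>_eq_iff)
qed

section \<open>Pulling back left coideal subalgebras\<close>

definition preim :: "'h set set \<Rightarrow> 'h set" where
  "preim R = {x \<in> carrier H. \<pi> x \<in> R}"

text \<open>
  The largest left coideal that is contained in the preimage of \<open>R\<close>.
\<close>

definition pullback :: "'h set set \<Rightarrow> 'h set" where
  "pullback R = {x \<in> carrier H. \<forall>\<phi>\<in>dual H. delta \<phi> x \<in> preim R}"

lemma pullback_mono: "R \<subseteq> R' \<Longrightarrow> pullback R \<subseteq> pullback R'"
  unfolding pullback_def preim_def by blast

lemma pullback_carrier: "pullback (carrier Q) = carrier H"
  unfolding pullback_def preim_def by auto

lemma delta_counit: "x \<in> carrier H \<Longrightarrow> delta \<epsilon> x = x"
  by (rule dual_eqI) (simp_all add: dual_delta sw_counit_left)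

lemma pullback_preim: "pullback R \<subseteq> preim R"
proof
  fix x assume "x \<in> pullback R"
  then have "x \<in> carrier H" "delta \<epsilon> x \<in> preim R"
    unfolding pullback_def using dual_counit[OF endo_id] by auto
  then show "x \<in> preim R" by (simp add: delta_counit)
qed

lemma delta_mult:
  assumes \<phi>: "\<phi> \<in> dual H" and x: "x \<in> carrier H" and y: "y \<in> carrier H"
  obtains n u f where "frame n u f"
    "delta \<phi> (x \<otimes> y) = (\<Oplus>i\<in>{..<n}. delta (f i) x \<otimes> delta (\<lambda>p. \<phi> (u i \<otimes> p)) y)"
proof -
  obtain n u f where F: "frame n u f"
    and ex: "\<forall>g. bilinear_form H g \<longrightarrow> Sw g x = (\<Sum>i<n. g (u i) (delta (f i) x))"
    using sw_expand_exists[OF x] by auto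
  note uf = frameD[OF F]
  have "delta \<phi> (x \<otimes> y) = (\<Oplus>i\<in>{..<n}. delta (f i) x \<otimes> delta (\<lambda>p. \<phi> (u i \<otimes> p)) y)"
  proof (rule dual_eqI)
    fix \<chi> assume \<chi>: "\<chi> \<in> dual H"
    note lin = multilin_intros dual_endo[OF \<chi>] dual_endo[OF \<phi>]
    have "\<chi> (delta \<phi> (x \<otimes> y)) = Sw (\<lambda>a b. Sw (\<lambda>a' b'. \<phi> (a \<otimes> a') * \<chi> (b \<otimes> b')) y) x"
      unfolding dual_delta[OF \<chi> m_closed[OF x y]] by (rule sw_mult[OF x y bilinear_mult[OF \<phi> \<chi>]])
    also have "\<dots> = (\<Sum>i<n. Sw (\<lambda>a' b'. \<phi> (u i \<otimes> a') * \<chi> (delta (f i) x \<otimes> b')) y)"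
      by (rule ex[rule_format]) (intro lin; simp add: y)
    also have "\<dots> = (\<Sum>i<n. \<chi> (delta (f i) x \<otimes> delta (\<lambda>p. \<phi> (u i \<otimes> p)) y))"
    proof (rule sum.cong[OF refl])
      fix i assume "i \<in> {..<n}"
      have "(\<lambda>z. \<chi> (delta (f i) x \<otimes> z)) \<in> dual H"
        by (rule dual_endo[OF \<chi> endo_mult_right[OF endo_id delta_closed[OF x]]])
      from dual_delta[OF this y]
      show "Sw (\<lambda>a' b'. \<phi> (u i \<otimes> a') * \<chi> (delta (f i) x \<otimes> b')) y = \<chi> (delta (f i) x \<otimes> delta (\<lambda>p. \<phi> (u i \<otimes> p)) y)"
        by simp
    qed
    also have "\<dots> = \<chi> (\<Oplus>i\<in>{..<n}. delta (f i) x \<otimes> delta (\<lambda>p. \<phi> (u i \<otimes> p)) y)"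
      by (rule dual_finsum[OF \<chi>, symmetric]) (auto simp: x y)
    finally show "\<chi> (delta \<phi> (x \<otimes> y)) = \<chi> (\<Oplus>i\<in>{..<n}. delta (f i) x \<otimes> delta (\<lambda>p. \<phi> (u i \<otimes> p)) y)" .
  qed (auto simp: x y intro!: finsum_closed)
  with F show ?thesis by (rule that)
qed

lemma delta_one: "\<phi> \<in> dual H \<Longrightarrow> delta \<phi> \<one> = \<phi> \<one> \<odot> \<one>"
  by (rule dual_eqI) (simp_all add: dual_delta sw_one bilinear_mult dualD)

context
  fixes R assumes R: "left_coideal_subalgebra Q R"
begin

lemma R_closed:
  "x \<in> carrier H \<Longrightarrow> \<pi> x \<in> R \<Longrightarrow> \<pi> (c \<odot> x) \<in> R"
  "x \<in> carrier H \<Longrightarrow> y \<in> carrier H \<Longrightarrow> \<pi> x \<in> R \<Longrightarrow> \<pi> y \<in> R \<Longrightarrow> \<pi> (x \<oplus> y) \<in> R"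
  "x \<in> carrier H \<Longrightarrow> y \<in> carrier H \<Longrightarrow> \<pi> x \<in> R \<Longrightarrow> \<pi> y \<in> R \<Longrightarrow> \<pi> (x \<otimes> y) \<in> R"
  "\<pi> \<one> \<in> R" "R \<subseteq> carrier Q"
proof -
  have sr: "subring R Q" and sm: "\<And>c C. C \<in> R \<Longrightarrow> c \<odot>\<^bsub>Q\<^esub> C \<in> R"
    using R unfolding left_coideal_subalgebra_def by auto
  show "x \<in> carrier H \<Longrightarrow> \<pi> x \<in> R \<Longrightarrow> \<pi> (c \<odot> x) \<in> R" using sm[of "\<pi> x" c] by (simp add: \<pi>_smult)
  show "x \<in> carrier H \<Longrightarrow> y \<in> carrier H \<Longrightarrow> \<pi> x \<in> R \<Longrightarrow> \<pi> y \<in> R \<Longrightarrow> \<pi> (x \<oplus> y) \<in> R"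
    using subringE(7)[OF sr, of "\<pi> x" "\<pi> y"] by (simp add: \<pi>_add)
  show "x \<in> carrier H \<Longrightarrow> y \<in> carrier H \<Longrightarrow> \<pi> x \<in> R \<Longrightarrow> \<pi> y \<in> R \<Longrightarrow> \<pi> (x \<otimes> y) \<in> R"
    using subringE(6)[OF sr, of "\<pi> x" "\<pi> y"] by (simp add: \<pi>_mult)
  show "\<pi> \<one> \<in> R" using subringE(3)[OF sr] by (simp add: \<pi>_one)
  show "R \<subseteq> carrier Q" by (rule subringE(1)[OF sr])
qed

lemma subsp_preim: "subsp (preim R)"
proof -
  have "\<pi> \<zero> \<in> R" using R_closed(1)[OF one_closed R_closed(4), of 0] by simp
  then show ?thesis unfolding subsp_def preim_def using R_closed by auto
qed

lemma coideal_subalgebra_pullback: "coideal_subalgebra (pullback R)"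
proof -
  note P = subspD[OF subsp_preim]
  have "subsp (pullback R)"
    unfolding subsp_def pullback_def
    using P endoD[OF endo_delta] endoD(3)[OF endo_delta, of _ \<one> 0]
    by (auto simp: P(2))
  moreover have "\<one> \<in> pullback R"
    unfolding pullback_def using P(4) R_closed(4) by (auto simp: delta_one preim_def R_closed(1))
  moreover have "x \<otimes> y \<in> pullback R" if "x \<in> pullback R" "y \<in> pullback R" for x y
  proof -
    have c: "x \<in> carrier H" "y \<in> carrier H" using that unfolding pullback_def by auto
    have "delta \<phi> (x \<otimes> y) \<in> preim R" if \<phi>: "\<phi> \<in> dual H" for \<phi>
    proof -
      obtain n u f where F: "frame n u f"
        and e: "delta \<phi> (x \<otimes> y) = (\<Oplus>i\<in>{..<n}. delta (f i) x \<otimes> delta (\<lambda>p. \<phi> (u i \<otimes> p)) y)"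
        by (rule delta_mult[OF \<phi> c])
      note uf = frameD[OF F]
      show ?thesis unfolding e
      proof (rule subsp_finsum[OF subsp_preim])
        fix i assume i: "i \<in> {..<n}"
        have "(\<lambda>p. \<phi> (u i \<otimes> p)) \<in> dual H"
          by (rule dual_endo[OF \<phi> endo_mult_right[OF endo_id]]) (use i uf in auto)
        then have "delta (f i) x \<in> preim R" "delta (\<lambda>p. \<phi> (u i \<otimes> p)) y \<in> preim R"
          using \<open>x \<in> pullback R\<close> \<open>y \<in> pullback R\<close> i uf(2) unfolding pullback_def by auto
        then show "delta (f i) x \<otimes> delta (\<lambda>p. \<phi> (u i \<otimes> p)) y \<in> preim R"
          unfolding preim_def using R_closed(3) by auto
      qed simp
    qed
    then show ?thesis unfolding pullback_def using c by simp
  qed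
  moreover have "delta \<phi> x \<in> pullback R" if "\<phi> \<in> dual H" "x \<in> pullback R" for \<phi> x
    using that unfolding pullback_def by (auto simp: delta_delta dual_conv)
  ultimately show ?thesis unfolding coideal_subalgebra_def by blast
qed

lemma N_pullback: "N \<subseteq> pullback R"
proof -
  have "x \<in> preim R" if x: "x \<in> N" for x
  proof -
    have "\<pi> x = \<pi> (\<epsilon> x \<odot> \<one>)" using x N_L[OF x] by (simp add: \<pi>_eq_iff smult_mult_left)
    then show ?thesis using x R_closed(1)[OF one_closed R_closed(4)] by (simp add: preim_def)
  qed
  then show ?thesis unfolding pullback_def using coideal_subalgebraD(4)[OF N] by auto
qed

text \<open>
  The right legs of the coproduct of \<open>L\<close> lie in \<open>N\<close> and are absorbed by \<open>L\<close>.
\<close>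

lemma delta_mult_L:
  assumes \<phi>: "\<phi> \<in> dual H" and x: "x \<in> carrier H"
  shows "delta \<phi> (x \<otimes> L) \<otimes> L = delta (\<lambda>p. \<phi> (p \<otimes> L)) x \<otimes> L"
proof (rule dual_eqI)
  fix \<chi> assume \<chi>: "\<chi> \<in> dual H"
  note lin = multilin_intros dual_endo[OF \<chi>] dual_endo[OF \<phi>]
  have \<chi>L: "(\<lambda>z. \<chi> (z \<otimes> L)) \<in> dual H" by (rule dual_endo[OF \<chi> endo_mult_left[OF endo_id L_closed]])
  have "\<chi> (delta \<phi> (x \<otimes> L) \<otimes> L) = Sw (\<lambda>a b. \<phi> a * \<chi> (b \<otimes> L)) (x \<otimes> L)"
    by (rule dual_delta[OF \<chi>L]) (simp add: x)
  also have "\<dots> = Sw (\<lambda>a b. Sw (\<lambda>a' b'. \<phi> (a \<otimes> a') * \<chi> (b \<otimes> b' \<otimes> L)) L) x"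
    by (rule sw_mult[OF x L_closed bilinear_mult[OF \<phi> \<chi>L]])
  also have "\<dots> = Sw (\<lambda>a b. \<phi> (a \<otimes> L) * \<chi> (b \<otimes> L)) x"
  proof (rule sw_cong[OF x])
    fix a b assume [simp]: "a \<in> carrier H" "b \<in> carrier H"
    have "Sw (\<lambda>a' b'. \<phi> (a \<otimes> a') * \<chi> (b \<otimes> b' \<otimes> L)) L = Sw (\<lambda>a' b'. \<epsilon> b' * (\<phi> (a \<otimes> a') * \<chi> (b \<otimes> L))) L"
    proof (rule sw_cong_coideal[OF N L_N])
      show "bilinear_form H (\<lambda>a' b'. \<phi> (a \<otimes> a') * \<chi> (b \<otimes> b' \<otimes> L))" by (intro lin; simp)
      show "bilinear_form H (\<lambda>a' b'. \<epsilon> b' * (\<phi> (a \<otimes> a') * \<chi> (b \<otimes> L)))" by (intro lin; simp)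
      show "\<phi> (a \<otimes> a') * \<chi> (b \<otimes> b' \<otimes> L) = \<epsilon> b' * (\<phi> (a \<otimes> a') * \<chi> (b \<otimes> L))" if "b' \<in> N" for a' b'
        using that by (simp add: m_assoc N_L smult_mult_right dualD(2)[OF \<chi>])
    qed
    also have "\<dots> = \<phi> (a \<otimes> L) * \<chi> (b \<otimes> L)"
      by (rule sw_counit_right[OF L_closed]) (intro lin; simp)
    finally show "Sw (\<lambda>a' b'. \<phi> (a \<otimes> a') * \<chi> (b \<otimes> b' \<otimes> L)) L = \<phi> (a \<otimes> L) * \<chi> (b \<otimes> L)" .
  qed
  also have "\<dots> = \<chi> (delta (\<lambda>p. \<phi> (p \<otimes> L)) x \<otimes> L)"
    by (rule dual_delta[OF \<chi>L x, symmetric])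
  finally show "\<chi> (delta \<phi> (x \<otimes> L) \<otimes> L) = \<chi> (delta (\<lambda>p. \<phi> (p \<otimes> L)) x \<otimes> L)" .
qed (simp_all add: x)

lemma preim_cong: "x \<in> carrier H \<Longrightarrow> y \<in> carrier H \<Longrightarrow> x \<otimes> L = y \<otimes> L \<Longrightarrow> x \<in> preim R \<longleftrightarrow> y \<in> preim R"
  using \<pi>_eq_iff[of x y] by (simp add: preim_def)

text \<open>
  Modulo \<open>HN\<^sup>+\<close> the partial coproducts of \<open>xL\<close> are \<open>\<Sum> \<phi>(x\<^sub>1 L) x\<^sub>2\<close>. Here \<open>\<phi>\<close> sees the left leg only
  modulo \<open>HN\<^sup>+\<close>, so the sum can be calculated from the coproduct of \<open>\<pi> x\<close>, whose right legs lie in \<open>R\<close>.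
\<close>

lemma preim_mult_L:
  assumes "x \<in> preim R" shows "x \<otimes> L \<in> pullback R"
proof -
  have x: "x \<in> carrier H" "\<pi> x \<in> R" using assms unfolding preim_def by auto
  obtain p where p: "p \<in> comult Q (\<pi> x)" "Poly_Mapping.keys p \<subseteq> carrier Q \<times> R"
    using R x(2) unfolding left_coideal_subalgebra_def by blast
  obtain y where y: "y \<in> carrier H" "\<pi> y = \<pi> x"
    and ex: "\<forall>g. bilinear_form Qa g \<longrightarrow> extend_form (case_prod g) p = Sw (\<lambda>a b. g (\<pi> a) (\<pi> b)) y"
    using extend_form_comult_Q[OF \<pi>_in[OF x(1)] p(1)] by blast
  have yx: "y \<otimes> L = x \<otimes> L" using y x by (simp add: \<pi>_eq_iff)
  have "delta \<phi> (x \<otimes> L) \<in> preim R" if \<phi>: "\<phi> \<in> dual H" for \<phi>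
  proof -
    define \<phi>' where "\<phi>' = (\<lambda>p. \<phi> (p \<otimes> L))"
    have \<phi>': "\<phi>' \<in> dual H" unfolding \<phi>'_def by (rule dual_endo[OF \<phi> endo_mult_left[OF endo_id L_closed]])
    have "delta \<phi>' y \<in> preim R"
    proof (rule ccontr)
      assume "delta \<phi>' y \<notin> preim R"
      then obtain \<psi> where \<psi>: "\<psi> \<in> dual H" "\<forall>z\<in>preim R. \<psi> z = 0" "\<psi> (delta \<phi>' y) = 1"
        using dual_separates_subsp[OF subsp_preim delta_closed[OF y(1)]] by blast
      \<comment> \<open>The functional \<open>\<psi>\<close> vanishes on \<open>HN\<^sup>+\<close>, so \<open>g\<close> below is a form on the quotient.\<close>
      have \<psi>L: "\<psi> (z \<otimes> L) = \<psi> z" if z: "z \<in> carrier H" for z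
      proof -
        have "(z \<oplus> (- 1) \<odot> (z \<otimes> L)) \<otimes> L = \<zero> \<otimes> L"
        proof -
          have "(z \<oplus> (- 1) \<odot> (z \<otimes> L)) \<otimes> L = z \<otimes> L \<oplus> (- 1) \<odot> (z \<otimes> L)"
            using z by (simp add: l_distr smult_mult_left m_assoc)
          also have "\<dots> = \<zero>" using smult_minus_one[of "z \<otimes> L"] z by (simp add: r_neg)
          finally show ?thesis by simp
        qed
        then have "z \<oplus> (- 1) \<odot> (z \<otimes> L) \<in> preim R"
          using preim_cong[of "z \<oplus> (- 1) \<odot> (z \<otimes> L)" \<zero>] subspD(2)[OF subsp_preim] z by simp
        then have "\<psi> (z \<oplus> (- 1) \<odot> (z \<otimes> L)) = 0" using \<psi>(2) by blast
        then show ?thesis using z dualD(1)[OF \<psi>(1), of z "(- 1) \<odot> (z \<otimes> L)"] dualD(2)[OF \<psi>(1), of "z \<otimes> L" "- 1"]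
          by simp
      qed
      define g where "g A B = \<phi> (\<rho> A) * \<psi> (\<rho> B)" for A B
      have \<psi>': "(\<lambda>z. \<psi> (z \<otimes> L)) \<in> dual H" by (rule dual_endo[OF \<psi>(1) endo_mult_left[OF endo_id L_closed]])
      have g: "bilinear_form Qa g"
        unfolding g_def
      proof (rule bilinear_formI)
        show "(\<lambda>A. \<phi> (\<rho> A) * \<psi> (\<rho> B)) \<in> dual Qa" for B
          by (rule dual_QI[OF dual_times_left[OF \<phi>', of "\<psi> (\<rho> B)"]]) (simp add: \<phi>'_def)
        show "(\<lambda>B. \<phi> (\<rho> A) * \<psi> (\<rho> B)) \<in> dual Qa" for A
          by (rule dual_QI[OF dual_times_right[OF \<psi>', of "\<phi> (\<rho> A)"]]) simp
      qed
      have "extend_form (case_prod g) p = Sw (\<lambda>a b. \<phi>' a * \<psi> b) y"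
        unfolding ex[rule_format, OF g]
        by (rule sw_cong[OF y(1)]) (simp add: g_def \<phi>'_def \<psi>L)
      also have "\<dots> = 1" using \<psi>(3) by (simp add: dual_delta[OF \<psi>(1) y(1)])
      finally have "extend_form (case_prod g) p = 1" .
      moreover have "extend_form (case_prod g) p = 0"
        unfolding extend_form_def
      proof (rule sum.neutral, rule ballI)
        fix u assume "u \<in> Poly_Mapping.keys p"
        then have u: "snd u \<in> R" using p(2) by auto
        then obtain z where z: "z \<in> carrier H" "snd u = \<pi> z" using R_closed(5) carrier_Q by blast
        have "z \<in> preim R" using u z by (simp add: preim_def)
        then have "\<psi> (\<rho> (snd u)) = 0" using \<psi>(2) \<psi>L z by simp
        then show "Poly_Mapping.lookup p u * (case u of (A, B) \<Rightarrow> g A B) = 0"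
          by (simp add: case_prod_beta' g_def)
      qed
      ultimately show False by simp
    qed
    moreover have "delta \<phi> (x \<otimes> L) \<otimes> L = delta \<phi>' y \<otimes> L"
      using delta_mult_L[OF \<phi> y(1)] by (simp add: yx \<phi>'_def)
    ultimately show ?thesis using preim_cong[of "delta \<phi> (x \<otimes> L)" "delta \<phi>' y"] x y by simp
  qed
  then show ?thesis unfolding pullback_def using x by simp
qed

lemma pullback_closed: "x \<in> pullback R \<Longrightarrow> x \<in> carrier H"
  by (simp add: pullback_def)

lemma left_coideal_pullback: "left_coideal_subalgebra H (pullback R)"
  by (rule coideal_subalgebra_imp_left_coideal[OF coideal_subalgebra_pullback])

text \<open>
  The integral of the pullback is a multiple of \<open>L\<close>, because \<open>L\<close> belongs to the pullback. Its image is an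
  integral of \<open>R\<close>, because every element of \<open>R\<close> is the image of some \<open>xL\<close> in the pullback.
\<close>

lemma pullback_integral:
  defines "l \<equiv> integral_of H (pullback R)"
  shows "l \<in> pullback R" "l \<otimes> L = l" "\<epsilon> l = 1" "integral_of Q R = \<pi> l"
proof -
  have l: "is_integral l (pullback R)" unfolding l_def by (rule integral_of[OF left_coideal_pullback])
  show lp: "l \<in> pullback R" and el: "\<epsilon> l = 1" using l unfolding is_integral_def by auto
  have lc: "l \<in> carrier H" by (rule pullback_closed[OF lp])
  have LM: "L \<in> pullback R" using N_pullback L_N by blast
  show lL: "l \<otimes> L = l" using l LM lc unfolding is_integral_def by (simp add: smult_simps(4))
  have li: "x \<otimes> l = \<epsilon> x \<odot> l" "l \<otimes> x = \<epsilon> x \<odot> l" if "x \<in> pullback R" for x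
    using l that unfolding is_integral_def by auto
  have *: "C \<otimes>\<^bsub>Q\<^esub> \<pi> l = counit Q C \<odot>\<^bsub>Q\<^esub> \<pi> l" "\<pi> l \<otimes>\<^bsub>Q\<^esub> C = counit Q C \<odot>\<^bsub>Q\<^esub> \<pi> l" if C: "C \<in> R" for C
  proof -
    obtain x where x: "x \<in> carrier H" "C = \<pi> x" using C R_closed(5) carrier_Q by blast
    have "x \<otimes> L \<in> pullback R" by (rule preim_mult_L) (use x C in \<open>simp add: preim_def\<close>)
    note xl = li[OF this]
    have "C = \<pi> (x \<otimes> L)" using x by (simp add: \<pi>_eq_iff m_assoc)
    then show "C \<otimes>\<^bsub>Q\<^esub> \<pi> l = counit Q C \<odot>\<^bsub>Q\<^esub> \<pi> l" "\<pi> l \<otimes>\<^bsub>Q\<^esub> C = counit Q C \<odot>\<^bsub>Q\<^esub> \<pi> l"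
      using x(1) lc xl by (simp_all add: \<pi>_mult \<pi>_counit \<pi>_smult counit_mult)
  qed
  show "integral_of Q R = \<pi> l"
    unfolding integral_of_def
  proof (rule the_equality)
    have "\<pi> l \<in> R" using pullback_preim[of R] lp unfolding preim_def by blast
    then show "\<pi> l \<in> R \<and> counit Q (\<pi> l) = 1 \<and>
        (\<forall>n\<in>R. n \<otimes>\<^bsub>Q\<^esub> \<pi> l = counit Q n \<odot>\<^bsub>Q\<^esub> \<pi> l \<and> \<pi> l \<otimes>\<^bsub>Q\<^esub> n = counit Q n \<odot>\<^bsub>Q\<^esub> \<pi> l)"
      using * lc el by (simp add: \<pi>_counit)
    fix C assume C: "C \<in> R \<and> counit Q C = 1 \<and>
        (\<forall>n\<in>R. n \<otimes>\<^bsub>Q\<^esub> C = counit Q n \<odot>\<^bsub>Q\<^esub> C \<and> C \<otimes>\<^bsub>Q\<^esub> n = counit Q n \<odot>\<^bsub>Q\<^esub> C)"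
    then obtain x where x: "x \<in> carrier H" "C = \<pi> x" using R_closed(5) carrier_Q by blast
    have "\<pi> l \<otimes>\<^bsub>Q\<^esub> C = counit Q (\<pi> l) \<odot>\<^bsub>Q\<^esub> C" using C \<open>\<pi> l \<in> R\<close> by blast
    moreover have "\<pi> l \<otimes>\<^bsub>Q\<^esub> C = counit Q C \<odot>\<^bsub>Q\<^esub> \<pi> l" using *(2) C by blast
    moreover have "counit Q (\<pi> l) \<odot>\<^bsub>Q\<^esub> C = C"
      unfolding x(2) using x(1) lc el by (simp add: \<pi>_counit \<pi>_smult smult_simps(4))
    moreover have "counit Q C \<odot>\<^bsub>Q\<^esub> \<pi> l = \<pi> l"
      using conjunct1[OF conjunct2[OF C]] lc by (simp add: \<pi>_smult smult_simps(4))
    ultimately show "C = \<pi> l" by metis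
  qed
qed

end

section \<open>Lifting the solvable series\<close>

text \<open>
  Modulo \<open>HN\<^sup>+\<close> the element \<open>y\<close> is a scalar. It leaves the Sweedler sum, and the antipode axiom applies.
\<close>

lemma adjoint_scalar:
  assumes a: "a \<in> carrier H" and y: "y \<in> carrier H" and s: "y \<otimes> L = c \<odot> L"
  shows "left_adjoint H a y \<otimes> L = \<epsilon> a \<odot> (y \<otimes> L)"
proof (rule dual_eqI)
  fix \<phi> assume \<phi>: "\<phi> \<in> dual H"
  have \<phi>L: "(\<lambda>z. \<phi> (z \<otimes> L)) \<in> dual H" by (rule dual_endo[OF \<phi> endo_mult_left[OF endo_id L_closed]])
  have "\<phi> (left_adjoint H a y \<otimes> L) = Sw (\<lambda>p q. \<phi> (p \<otimes> y \<otimes> S q \<otimes> L)) a"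
    by (rule dual_left_adjoint[OF \<phi>L a y])
  also have "\<dots> = Sw (\<lambda>p q. c * \<phi> (p \<otimes> S q \<otimes> L)) a"
  proof (rule sw_cong[OF a])
    fix p q assume [simp]: "p \<in> carrier H" "q \<in> carrier H"
    have Lq: "L \<otimes> S q = S q \<otimes> L" by (rule L_central[symmetric]) (simp add: antipode_closed)
    have "p \<otimes> y \<otimes> S q \<otimes> L = p \<otimes> (y \<otimes> (S q \<otimes> L))" using y by (simp add: m_assoc antipode_closed)
    also have "\<dots> = p \<otimes> (y \<otimes> L \<otimes> S q)"
      unfolding Lq[symmetric] using y by (simp add: m_assoc antipode_closed)
    also have "\<dots> = c \<odot> (p \<otimes> (L \<otimes> S q))"
      unfolding s by (simp add: smult_mult_left smult_mult_right antipode_closed)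
    also have "\<dots> = c \<odot> (p \<otimes> S q \<otimes> L)" unfolding Lq by (simp add: m_assoc antipode_closed)
    finally show "\<phi> (p \<otimes> y \<otimes> S q \<otimes> L) = c * \<phi> (p \<otimes> S q \<otimes> L)"
      by (simp add: dualD(2)[OF \<phi>] antipode_closed)
  qed
  also have "\<dots> = \<epsilon> a * (c * \<phi> L)"
    using sw_antipode_right[OF a \<phi>L] by (simp add: sw_cmult)
  finally show "\<phi> (left_adjoint H a y \<otimes> L) = \<phi> (\<epsilon> a \<odot> (y \<otimes> L))"
    by (simp add: s dualD(2)[OF \<phi>])
qed (use a y in auto)

text \<open>
  The integral \<open>l\<close> of a pullback satisfies \<open>lL = l\<close>, so the conditions at \<open>l\<close> are equations in \<open>HL\<close> and may
  be checked in the quotient. At the start of the series the integral is \<open>L\<close> itself, which is central.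
\<close>

theorem lift_series:
  assumes ser: "solvable_series Q t R" and R0: "R 0 = range (\<lambda>c. c \<odot>\<^bsub>Q\<^esub> \<one>\<^bsub>Q\<^esub>)" and Rt: "R t = carrier Q"
  shows "\<exists>t M. solvable_series H t M \<and> M 0 = N \<and> M t = carrier H"
proof -
  \<comment> \<open>The index is shifted by one: \<open>N\<close> comes before the pullback of the scalars.\<close>
  define M where "M i = (case i of 0 \<Rightarrow> N | Suc j \<Rightarrow> pullback (R j))" for i
  have M_simps: "M 0 = N" "M (Suc j) = pullback (R j)" for j by (simp_all add: M_def)
  have lc: "left_coideal_subalgebra Q (R i)" if "i \<le> t" for i
    using ser that unfolding solvable_series_def by blast
  have sub: "R i \<subseteq> R (Suc i)" if "i < t" for i
    using ser that unfolding solvable_series_def by blast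
  have cen: "integral_of Q (R i) \<in> center_of Q (R (Suc i))" if "i < t" for i
    using ser that unfolding solvable_series_def by blast
  have adj: "left_adjoint Q a b \<otimes>\<^bsub>Q\<^esub> integral_of Q (R i) = counit Q a \<odot>\<^bsub>Q\<^esub> (b \<otimes>\<^bsub>Q\<^esub> integral_of Q (R i))"
    if "i < t" "a \<in> R (Suc i)" "b \<in> R (Suc i)" for i a b
    using ser that unfolding solvable_series_def by blast
  have pc: "x \<in> carrier H" "\<pi> x \<in> R i" if "x \<in> pullback (R i)" for x i
    using that pullback_preim[of "R i"] unfolding preim_def by auto
  have "solvable_series H (Suc t) M"
    unfolding solvable_series_def
  proof (intro conjI allI impI)
    fix i assume "i \<le> Suc t"
    then show "left_coideal_subalgebra H (M i)"
      using normal left_coideal_pullback[OF lc]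
      by (cases i) (simp_all add: M_simps normal_left_coideal_subalgebra_def)
  next
    fix i assume i: "i < Suc t"
    show "M i \<subseteq> M (Suc i)"
    proof (cases i)
      case 0 then show ?thesis using N_pullback[OF lc[of 0]] by (simp add: M_simps)
    next
      case (Suc j)
      then show ?thesis using i pullback_mono[OF sub[of j]] by (simp add: M_simps)
    qed
  next
    fix i assume i: "i < Suc t"
    show "integral_of H (M i) \<in> center_of H (M (Suc i))"
    proof (cases i)
      case 0
      then show ?thesis
        using N_pullback[OF lc[of 0]] L_N pc(1) by (auto simp: M_simps center_of_def L_central)
    next
      case (Suc j)
      then have j: "j < t" using i by simp
      let ?l = "integral_of H (pullback (R j))"
      note l = pullback_integral[OF lc[OF less_imp_le[OF j]]]
      have lp: "?l \<in> pullback (R (Suc j))" using l(1) pullback_mono[OF sub[OF j]] by blast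
      have "?l \<otimes> m = m \<otimes> ?l" if m: "m \<in> pullback (R (Suc j))" for m
      proof -
        note mc = pc[OF m] and lc = pc(1)[OF lp]
        have "\<pi> ?l \<otimes>\<^bsub>Q\<^esub> \<pi> m = \<pi> m \<otimes>\<^bsub>Q\<^esub> \<pi> ?l"
          using cen[OF j] mc(2) unfolding l(4) center_of_def by blast
        then have "?l \<otimes> m \<otimes> L = m \<otimes> ?l \<otimes> L" using mc lc by (simp add: \<pi>_mult \<pi>_eq_iff)
        moreover have "?l \<otimes> m \<otimes> L = (?l \<otimes> L) \<otimes> m" using mc lc by (simp add: m_assoc L_central)
        moreover have "m \<otimes> ?l \<otimes> L = m \<otimes> (?l \<otimes> L)" using mc lc by (simp add: m_assoc)
        ultimately show ?thesis using l(2) by simp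
      qed
      then show ?thesis using Suc lp by (simp add: M_simps center_of_def)
    qed
  next
    fix i assume i: "i < Suc t"
    show "\<forall>a\<in>M (Suc i). \<forall>b\<in>M (Suc i). left_adjoint H a b \<otimes> integral_of H (M i) = \<epsilon> a \<odot> (b \<otimes> integral_of H (M i))"
    proof (intro ballI)
      fix a c assume "a \<in> M (Suc i)" "c \<in> M (Suc i)"
      then have a: "a \<in> pullback (R i)" and c: "c \<in> pullback (R i)" by (simp_all add: M_simps)
      note ac = pc[OF a] and cc = pc[OF c]
      show "left_adjoint H a c \<otimes> integral_of H (M i) = \<epsilon> a \<odot> (c \<otimes> integral_of H (M i))"
      proof (cases i)
        case 0
        obtain s where "\<pi> c = s \<odot>\<^bsub>Q\<^esub> \<one>\<^bsub>Q\<^esub>" using cc(2) 0 R0 by auto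
        then have "\<pi> c = \<pi> (s \<odot> \<one>)" by (simp add: \<pi>_one \<pi>_smult)
        then have "c \<otimes> L = s \<odot> L" using cc(1) by (simp add: \<pi>_eq_iff smult_mult_left)
        from adjoint_scalar[OF ac(1) cc(1) this] show ?thesis using 0 by (simp add: M_simps)
      next
        case (Suc j)
        then have j: "j < t" using i by simp
        let ?l = "integral_of H (pullback (R j))"
        note l = pullback_integral[OF lc[OF less_imp_le[OF j]]]
        have lc: "?l \<in> carrier H" by (rule pc(1)[OF l(1)])
        have "left_adjoint Q (\<pi> a) (\<pi> c) \<otimes>\<^bsub>Q\<^esub> \<pi> ?l = counit Q (\<pi> a) \<odot>\<^bsub>Q\<^esub> (\<pi> c \<otimes>\<^bsub>Q\<^esub> \<pi> ?l)"
          using adj[OF j, of "\<pi> a" "\<pi> c"] ac(2) cc(2) Suc unfolding l(4) by simp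
        then have "\<pi> (left_adjoint H a c \<otimes> ?l) = \<pi> (\<epsilon> a \<odot> (c \<otimes> ?l))"
          using ac(1) cc(1) lc by (simp add: left_adjoint_Q \<pi>_mult \<pi>_counit \<pi>_smult)
        then have "left_adjoint H a c \<otimes> ?l \<otimes> L = \<epsilon> a \<odot> (c \<otimes> ?l) \<otimes> L"
          using ac(1) cc(1) lc by (simp add: \<pi>_eq_iff)
        then show ?thesis
          using ac(1) cc(1) lc l(2) Suc by (simp add: M_simps m_assoc smult_mult_left)
      qed
    qed
  qed
  moreover have "M (Suc t) = carrier H" by (simp add: M_simps Rt pullback_carrier)
  ultimately show ?thesis using M_simps(1) by blast
qed

end

theorem proposition3p7:
  fixes H :: "('k::{alg_closed_field, field_char_0}, 'h) hopf" and N :: "'h set"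
  assumes "semisimple_hopf_algebra H"
    and "normal_left_coideal_subalgebra H N"
    and "solvable_hopf_algebra (H //h N)"
  shows "\<exists>t M. solvable_series H t M \<and> M 0 = N \<and> M t = carrier H"
proof -
  interpret hopf_algebra H using assms(1) unfolding semisimple_hopf_algebra_def by blast
  interpret normal_coideal H N
    by unfold_locales (use assms in \<open>auto simp: semisimple_hopf_algebra_def\<close>)
  show ?thesis
    using assms(3) lift_series unfolding solvable_hopf_algebra_def by blast
qed

end
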